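(* Let $m,n\ge 0$ be integers with $m+n\ge 1$, let $r\ge 1$, and let $V=\bigoplus_{k=1}^{m+n}\mathbb{Q}(q)v_k$ be the $\mathbb{Z}_2$-graded vector space with $|v_k|=0$ for $k\le m$ and $|v_k|=1$ for $k>m$. Let $\pi_r$ be the sign $q$-permutation representation of the Iwahori-Hecke algebra $\mathcal{H}_{\mathbb{Q}(q),r}(q)$ on $V^{\otimes r}$, and let $\rho_r$ be the representation of $U_q^\sigma(\mathfrak{gl}(m,n))$ on $V^{\otimes r}$ obtained from the vector representation. Put $$\mathcal{A}_q=\pi_r\big(\mathcal{H}_{\mathbb{Q}(q),r}(q)\big),\qquad \mathcal{B}_q=\rho_r\big(U_q^\sigma(\mathfrak{gl}(m,n))\big),$$ regarded as subalgebras of $\operatorname{End}_{\mathbb{Q}(q)}(V^{\otimes r})$. Then $$\operatorname{End}_{\mathcal{B}_q}V^{\otimes r}=\mathcal{A}_q\qquad\text{and}\qquad \operatorname{End}_{\mathcal{A}_q}V^{\otimes r}=\mathcal{B}_q .$$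
   Context: Here $q$ is an indeterminate and tensor products are over $\mathbb{Q}(q)$. $\operatorname{End}_{\mathcal{C}}V^{\otimes r}$ denotes the set of all $\mathbb{Q}(q)$-linear endomorphisms of $V^{\otimes r}$ commuting (in the ordinary, unsigned sense) with every element of $\mathcal{C}$. **Hecke algebra and $\pi_r$.** $\mathcal{H}_{\mathbb{Q}(q),r}(q)$ is the unital associative $\mathbb{Q}(q)$-algebra generated by $T_1,\dots,T_{r-1}$ with relations $T_i^2=(q-q^{-1})T_i+1$; $T_iT_{i+1}T_i=T_{i+1}T_iT_{i+1}$; $T_iT_j=T_jT_i$ for $|i-j|>1$. Let $T$ be the right operator on $V\otimes V$ given by $$(v_k\otimes v_l)T=\begin{cases}\dfrac{(-1)^{|v_k|}(q+q^{-1})+q-q^{-1}}{2}\,v_k\otimes v_l & \text{if } k=l,\\ (-1)^{|v_k||v_l|}v_l\otimes v_k+(q-q^{-1})v_k\otimes v_l & \text{if } k<l,\\ (-1)^{|v_k||v_l|}v_l\otimes v_k & \text{if } k>l.\end{cases}$$ The sign $q$-permutation representation $\pi_r$ is the right representation with $\pi_r(T_i)=\operatorname{Id}^{\otimes (i-1)}\otimes T\otimes \operatorname{Id}^{\otimes (r-i-1)}$. **Root data.** $I=\{1,\dots,m+n-1\}$; $p(i)=1$ if $i=m$ and $p(i)=0$ if $i\ne m$. $P=\bigoplus_{b=1}^{m+n}\mathbb{Z}\epsilon_b$ with symmetric bilinear form $(\epsilon_a,\epsilon_{a'})=0$ for $a\neq a'$, $(\epsilon_a,\epsilon_a)=1$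 for $a\le m$, $(\epsilon_a,\epsilon_a)=-1$ for $a>m$. $P^*=\operatorname{Hom}_{\mathbb{Z}}(P,\mathbb{Z})$, with natural pairing $\langle h,\lambda\rangle$, also written $\lambda(h)$. $\alpha_i=\epsilon_i-\epsilon_{i+1}$ for $i\in I$; $\ell_i=1$ for $i\le m$ and $\ell_i=-1$ for $i>m$; $h_i\in P^*$ is determined by $\ell_i\langle h_i,\lambda\rangle=(\alpha_i,\lambda)$ for all $\lambda\in P$. **Quantum superalgebra.** $U_q(\mathfrak{gl}(m,n))$ is the unital associative $\mathbb{Q}(q)$-algebra generated by $q^h$ ($h\in P^*$), $e_i,f_i$ ($i\in I$) with: $q^0=1$; $q^{h}q^{h'}=q^{h+h'}$; $q^he_i=q^{\langle h,\alpha_i\rangle}e_iq^h$; $q^hf_i=q^{-\langle h,\alpha_i\rangle}f_iq^h$; $e_if_j-(-1)^{p(i)p(j)}f_je_i=\delta_{ij}\frac{q^{\ell_ih_i}-q^{-\ell_ih_i}}{q^{\ell_i}-q^{-\ell_i}}$; and with the following further conditions imposed, where $U_q(\mathfrak n_+)$ (resp. $U_q(\mathfrak n_-)$) is the subalgebra generated by the $e_i$ (resp. $f_i$): if $a\in\sum_iU_q(\mathfrak n_+)e_iU_q(\mathfrak n_+)$ satisfies $f_ia\in U_q(\mathfrak n_+)f_i$ for all $i\in I$, then $a=0$; if $a\in\sum_iU_q(\mathfrak n_-)f_iU_q(\mathfrak n_-)$ satisfies $e_ia\in U_q(\mathfrak n_-)e_i$ for all $i\in I$, then $a=0$. Let $\sigma$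 be the involutive automorphism of $U_q(\mathfrak{gl}(m,n))$ with $\sigma(q^h)=q^h$, $\sigma(e_i)=(-1)^{p(i)}e_i$, $\sigma(f_i)=(-1)^{p(i)}f_i$. Then $U_q^\sigma(\mathfrak{gl}(m,n))=U_q(\mathfrak{gl}(m,n))\oplus U_q(\mathfrak{gl}(m,n))\sigma$ is the algebra with the additional multiplication law $\sigma^2=1$, $\sigma^{-1}x\sigma=\sigma(x)$. It is a Hopf algebra with comultiplication $\triangle_\sigma(\sigma)=\sigma\otimes\sigma$, $\triangle_\sigma(q^h)=q^h\otimes q^h$, $\triangle_\sigma(e_i)=e_i\otimes q^{-\ell_ih_i}+\sigma^{p(i)}\otimes e_i$, $\triangle_\sigma(f_i)=f_i\otimes 1+\sigma^{p(i)}q^{\ell_ih_i}\otimes f_i$. **Vector representation.** $\rho$ is the (known to be well-defined) representation of $U_q^\sigma(\mathfrak{gl}(m,n))$ on $V$ given by $\rho(\sigma)v_j=(-1)^{|v_j|}v_j$; $\rho(q^h)v_j=q^{\epsilon_j(h)}v_j$; $\rho(e_j)v_{j+1}=v_j$ and $\rho(e_j)v_k=0$ for $k\neq j+1$; $\rho(f_j)v_j=v_{j+1}$ and $\rho(f_j)v_k=0$ for $k\ne j$. The representation $\rho_r$ on $V^{\otimes r}$ is obtained from $\rho$ by iterating $\triangle_\sigma$; explicitly $\rho_r(\sigma)=\rho(\sigma)^{\otimes r}$, $\rho_r(q^h)=\rho(q^h)^{\otimes r}$, $\rho_r(e_i)=\sum_{k=1}^r\rho(\sigma^{p(i)})^{\otimes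 (k-1)}\otimes\rho(e_i)\otimes\rho(q^{-\ell_ih_i})^{\otimes (r-k)}$, $\rho_r(f_i)=\sum_{k=1}^r\rho(\sigma^{p(i)}q^{\ell_ih_i})^{\otimes (k-1)}\otimes\rho(f_i)\otimes\operatorname{Id}^{\otimes (r-k)}$. In particular $\mathcal{B}_q$ is the $\mathbb{Q}(q)$-subalgebra generated by $\rho_r(\sigma),\rho_r(q^h),\rho_r(e_i),\rho_r(f_i)$ ($h\in P^*$, $i\in I$). *)

theory Defs
  imports
    "HOL-Library.Poly_Mapping"
    "HOL-Library.FuncSet"
    "HOL-Computational_Algebra.Polynomial"
    "HOL-Computational_Algebra.Fraction_Field"
    "HOL-Algebra.QuotRing"
    "HOL-Algebra.Generated_Rings"
begin

section \<open>The ground field\<close>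

type_synonym ratfun = "rat poly fract"

definition qvar :: ratfun where
  "qvar = Fract [:0, 1:] 1"


section \<open>Algebras given by generators and relations\<close>

text \<open>Words form the free monoid; the wrapper type only serves to make concatenation an
  instance of the (additively written) class of monoids, so that finitely supported functions on
  words, with the convolution product of \<^theory>\<open>HOL-Library.Poly_Mapping\<close>, form the free
  associative unital algebra.\<close>

datatype 'g word = Word (letters: "'g list")

instantiation word :: (type) monoid_add
begin

definition zero_word :: "'a word" where
  "zero_word = Word []"

definition plus_word :: "'a word \<Rightarrow> 'a word \<Rightarrow> 'a word" where
  "plus_word v w = Word (letters v @ letters w)"

instance
  by standard (simp_all add: zero_word_def plus_word_def)

end

type_synonym 'g fpoly = "'g word \<Rightarrow>\<^sub>0 ratfun"

definition fgen :: "'g \<Rightarrow> 'g fpoly" where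
  "fgen g = Poly_Mapping.single (Word [g]) 1"

definition fconst :: "ratfun \<Rightarrow> 'g fpoly" where
  "fconst c = Poly_Mapping.single 0 c"

definition free_algebra :: "'g set \<Rightarrow> 'g fpoly ring" where
  "free_algebra G =
    \<lparr>carrier = {x. \<forall>w\<in>Poly_Mapping.keys x. set (letters w) \<subseteq> G},
     mult = (*), one = 1, zero = 0, add = (+)\<rparr>"

definition opposite_ring :: "'a ring \<Rightarrow> 'a ring" where
  "opposite_ring R = R\<lparr>mult := \<lambda>x y. y \<otimes>\<^bsub>R\<^esub> x\<rparr>"


section \<open>Tensor space and its endomorphisms\<close>

text \<open>With \<open>N = m + n\<close>, the basis vector \<open>v_k1 \<otimes> \<dots> \<otimes> v_kr\<close> of the tensor power is indexed by the
  list \<open>[k1, \<dots>, kr]\<close>, and a tensor is the function giving its coordinates.\<close>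

definition tensor_index :: "nat \<Rightarrow> nat \<Rightarrow> nat list set" where
  "tensor_index N r = {w. length w = r \<and> set w \<subseteq> {1..N}}"

definition tensor_space :: "nat \<Rightarrow> nat \<Rightarrow> (nat list \<Rightarrow> ratfun) set" where
  "tensor_space N r = {x. \<forall>w. w \<notin> tensor_index N r \<longrightarrow> x w = 0}"

type_synonym operator = "(nat list \<Rightarrow> ratfun) \<Rightarrow> (nat list \<Rightarrow> ratfun)"

definition tensor_End :: "nat \<Rightarrow> nat \<Rightarrow> operator ring" where
  "tensor_End N r = (let W = tensor_space N r in
    \<lparr>carrier = {\<phi> \<in> W \<rightarrow>\<^sub>E W.
        (\<forall>x\<in>W. \<forall>y\<in>W. \<phi> (\<lambda>u. x u + y u) = (\<lambda>u. \<phi> x u + \<phi> y u)) \<and>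
        (\<forall>c. \<forall>x\<in>W. \<phi> (\<lambda>u. c * x u) = (\<lambda>u. c * \<phi> x u))},
     mult = (\<lambda>\<phi> \<psi>. \<lambda>x\<in>W. \<phi> (\<psi> x)),
     one = (\<lambda>x\<in>W. x),
     zero = (\<lambda>x\<in>W. \<lambda>u. 0),
     add = (\<lambda>\<phi> \<psi>. \<lambda>x\<in>W. \<lambda>u. \<phi> x u + \<psi> x u)\<rparr>)"

definition scalar_op :: "nat \<Rightarrow> nat \<Rightarrow> ratfun \<Rightarrow> operator" where
  "scalar_op N r c = (\<lambda>x\<in>tensor_space N r. \<lambda>u. c * x u)"

text \<open>The operator with given matrix coefficients: \<open>A w u\<close> is the coefficient of the basis vector
  \<open>u\<close> in the image of the basis vector \<open>w\<close>.\<close>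

definition matrix_op :: "nat \<Rightarrow> nat \<Rightarrow> (nat list \<Rightarrow> nat list \<Rightarrow> ratfun) \<Rightarrow> operator" where
  "matrix_op N r A = (\<lambda>x\<in>tensor_space N r. \<lambda>u.
     if u \<in> tensor_index N r then \<Sum>w\<in>tensor_index N r. x w * A w u else 0)"

text \<open>Matrix coefficients of \<open>A_1 \<otimes> \<dots> \<otimes> A_r\<close>, where each \<open>A_i\<close> is an operator on \<open>V\<close> written in the
  same way: \<open>A_i k l\<close> is the coefficient of \<open>v_l\<close> in \<open>A_i v_k\<close>.\<close>

definition tensor_coeff ::
    "(nat \<Rightarrow> nat \<Rightarrow> ratfun) list \<Rightarrow> nat list \<Rightarrow> nat list \<Rightarrow> ratfun" where
  "tensor_coeff As w u = (\<Prod>i<length As. (As ! i) (w ! i) (u ! i))"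

definition commutant :: "'a ring \<Rightarrow> 'a set \<Rightarrow> 'a set" where
  "commutant E C = {\<phi> \<in> carrier E. \<forall>\<psi>\<in>C. \<phi> \<otimes>\<^bsub>E\<^esub> \<psi> = \<psi> \<otimes>\<^bsub>E\<^esub> \<phi>}"

definition vpar :: "nat \<Rightarrow> nat \<Rightarrow> nat" where
  "vpar m k = (if k \<le> m then 0 else 1)"


section \<open>The Hecke algebra and the sign q-permutation representation\<close>

definition hecke_free :: "nat \<Rightarrow> nat fpoly ring" where
  "hecke_free r = free_algebra {1..<r}"

definition hecke_relators :: "nat \<Rightarrow> nat fpoly set" where
  "hecke_relators r =
     {fgen i * fgen i - (fconst (qvar - inverse qvar) * fgen i + 1) | i. i \<in> {1..<r}}
   \<union> {fgen i * fgen (i + 1) * fgen i - fgen (i + 1) * fgen i * fgen (i + 1) | i.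
        i \<in> {1..<r} \<and> i + 1 \<in> {1..<r}}
   \<union> {fgen i * fgen j - fgen j * fgen i | i j.
        i \<in> {1..<r} \<and> j \<in> {1..<r} \<and> (i + 1 < j \<or> j + 1 < i)}"

definition hecke_ideal :: "nat \<Rightarrow> nat fpoly set" where
  "hecke_ideal r = Idl\<^bsub>hecke_free r\<^esub> (hecke_relators r)"

definition hecke :: "nat \<Rightarrow> nat fpoly set ring" where
  "hecke r = hecke_free r Quot hecke_ideal r"

definition hecke_class :: "nat \<Rightarrow> nat fpoly \<Rightarrow> nat fpoly set" where
  "hecke_class r x = hecke_ideal r +>\<^bsub>hecke_free r\<^esub> x"

text \<open>\<open>T_coeff m k l k' l'\<close> is the coefficient of \<open>v_k' \<otimes> v_l'\<close> in \<open>(v_k \<otimes> v_l)T\<close>.\<close>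

definition T_coeff :: "nat \<Rightarrow> nat \<Rightarrow> nat \<Rightarrow> nat \<Rightarrow> nat \<Rightarrow> ratfun" where
  "T_coeff m k l k' l' =
    (if k = l then
       ((-1) ^ vpar m k * (qvar + inverse qvar) + qvar - inverse qvar) / 2
         * of_bool (k' = k \<and> l' = l)
     else if k < l then
       (-1) ^ (vpar m k * vpar m l) * of_bool (k' = l \<and> l' = k)
         + (qvar - inverse qvar) * of_bool (k' = k \<and> l' = l)
     else
       (-1) ^ (vpar m k * vpar m l) * of_bool (k' = l \<and> l' = k))"

text \<open>\<open>Id^(i-1) \<otimes> T \<otimes> Id^(r-i-1)\<close>; the tensor factors \<open>i\<close> and \<open>i+1\<close> are the list positions
  \<open>i - 1\<close> and \<open>i\<close>.\<close>

definition T_op :: "nat \<Rightarrow> nat \<Rightarrow> nat \<Rightarrow> nat \<Rightarrow> operator" where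
  "T_op m n r i = matrix_op (m + n) r (\<lambda>w u.
     T_coeff m (w ! (i - 1)) (w ! i) (u ! (i - 1)) (u ! i)
       * (\<Prod>j\<in>{..<r} - {i - 1, i}. of_bool (u ! j = w ! j)))"

text \<open>A right representation is a homomorphism into the opposite of the endomorphism algebra;
  compatibility with the scalars makes the ring homomorphism an algebra homomorphism.\<close>

definition is_sign_q_perm_rep ::
    "nat \<Rightarrow> nat \<Rightarrow> nat \<Rightarrow> (nat fpoly set \<Rightarrow> operator) \<Rightarrow> bool" where
  "is_sign_q_perm_rep m n r \<pi> \<longleftrightarrow>
     \<pi> \<in> ring_hom (hecke r) (opposite_ring (tensor_End (m + n) r)) \<and>
     (\<forall>c. \<pi> (hecke_class r (fconst c)) = scalar_op (m + n) r c) \<and>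
     (\<forall>i\<in>{1..<r}. \<pi> (hecke_class r (fgen i)) = T_op m n r i)"


section \<open>Root data\<close>

text \<open>Elements of \<open>P\<close> are given by their coordinates with respect to the \<open>\<epsilon>_b\<close>, elements \<open>h\<close> of
  \<open>P*\<close> by the values \<open>\<langle>h, \<epsilon>_b\<rangle>\<close>; both vanish outside \<open>{1..m+n}\<close>.\<close>

definition lattice :: "nat \<Rightarrow> nat \<Rightarrow> (nat \<Rightarrow> int) set" where
  "lattice m n = {h. \<forall>b. b \<notin> {1..m + n} \<longrightarrow> h b = 0}"

definition pairing :: "nat \<Rightarrow> nat \<Rightarrow> (nat \<Rightarrow> int) \<Rightarrow> (nat \<Rightarrow> int) \<Rightarrow> int" where
  "pairing m n h a = (\<Sum>b\<in>{1..m + n}. h b * a b)"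

definition wform :: "nat \<Rightarrow> nat \<Rightarrow> (nat \<Rightarrow> int) \<Rightarrow> (nat \<Rightarrow> int) \<Rightarrow> int" where
  "wform m n a a' = (\<Sum>b\<in>{1..m + n}. (if b \<le> m then 1 else -1) * a b * a' b)"

definition eps :: "nat \<Rightarrow> nat \<Rightarrow> int" where
  "eps a = (\<lambda>b. of_bool (b = a))"

definition alpha :: "nat \<Rightarrow> nat \<Rightarrow> int" where
  "alpha i = (\<lambda>b. eps i b - eps (i + 1) b)"

definition simple_ix :: "nat \<Rightarrow> nat \<Rightarrow> nat set" where
  "simple_ix m n = {1..<m + n}"

definition gpar :: "nat \<Rightarrow> nat \<Rightarrow> nat" where
  "gpar m i = (if i = m then 1 else 0)"

definition ell :: "nat \<Rightarrow> nat \<Rightarrow> int" where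
  "ell m i = (if i \<le> m then 1 else -1)"

definition coroot :: "nat \<Rightarrow> nat \<Rightarrow> nat \<Rightarrow> nat \<Rightarrow> int" where
  "coroot m n i = (THE h. h \<in> lattice m n \<and>
     (\<forall>a\<in>lattice m n. ell m i * pairing m n h a = wform m n (alpha i) a))"


section \<open>The quantum superalgebra\<close>

datatype uq_gen = GenQ "nat \<Rightarrow> int" | GenE nat | GenF nat

definition uq_gens :: "nat \<Rightarrow> nat \<Rightarrow> uq_gen set" where
  "uq_gens m n = GenQ ` lattice m n \<union> GenE ` simple_ix m n \<union> GenF ` simple_ix m n"

definition uq_free :: "nat \<Rightarrow> nat \<Rightarrow> uq_gen fpoly ring" where
  "uq_free m n = free_algebra (uq_gens m n)"

definition uq_relators :: "nat \<Rightarrow> nat \<Rightarrow> uq_gen fpoly set" where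
  "uq_relators m n =
     {fgen (GenQ (\<lambda>b. 0)) - 1}
   \<union> {fgen (GenQ h) * fgen (GenQ h') - fgen (GenQ (\<lambda>b. h b + h' b)) | h h'.
        h \<in> lattice m n \<and> h' \<in> lattice m n}
   \<union> {fgen (GenQ h) * fgen (GenE i)
        - fconst (qvar powi pairing m n h (alpha i)) * fgen (GenE i) * fgen (GenQ h) | h i.
        h \<in> lattice m n \<and> i \<in> simple_ix m n}
   \<union> {fgen (GenQ h) * fgen (GenF i)
        - fconst (qvar powi (- pairing m n h (alpha i))) * fgen (GenF i) * fgen (GenQ h) | h i.
        h \<in> lattice m n \<and> i \<in> simple_ix m n}
   \<union> {fgen (GenE i) * fgen (GenF j)
        - (-1) ^ (gpar m i * gpar m j) * fgen (GenF j) * fgen (GenE i)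
        - fconst (of_bool (i = j) / (qvar powi ell m i - qvar powi (- ell m i)))
            * (fgen (GenQ (\<lambda>b. ell m i * coroot m n i b))
               - fgen (GenQ (\<lambda>b. - (ell m i * coroot m n i b)))) | i j.
        i \<in> simple_ix m n \<and> j \<in> simple_ix m n}"

text \<open>The further conditions on an algebra \<open>A\<close> with scalars \<open>K\<close>, in the form used for both signs:
  \<open>S\<close> is the subalgebra generated by the \<open>x i\<close>, the set \<open>Idl S\<close> is the span of \<open>S (x i) S\<close>, and
  \<open>y\<close> is the opposite family.\<close>

definition no_singular ::
    "'a ring \<Rightarrow> 'a set \<Rightarrow> nat set \<Rightarrow> (nat \<Rightarrow> 'a) \<Rightarrow> (nat \<Rightarrow> 'a) \<Rightarrow> bool" where
  "no_singular A K J x y \<longleftrightarrow>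
    (let S = generate_ring A (K \<union> x ` J) in
      \<forall>a \<in> Idl\<^bsub>A\<lparr>carrier := S\<rparr>\<^esub> (x ` J).
        (\<forall>i\<in>J. y i \<otimes>\<^bsub>A\<^esub> a \<in> (\<lambda>b. b \<otimes>\<^bsub>A\<^esub> y i) ` S) \<longrightarrow> a = \<zero>\<^bsub>A\<^esub>)"

definition uq_admissible :: "nat \<Rightarrow> nat \<Rightarrow> uq_gen fpoly set \<Rightarrow> bool" where
  "uq_admissible m n I \<longleftrightarrow>
     ideal I (uq_free m n) \<and> uq_relators m n \<subseteq> I \<and>
     (let A = uq_free m n Quot I;
          cls = (\<lambda>x. I +>\<^bsub>uq_free m n\<^esub> x);
          K = cls ` range fconst;
          e = (\<lambda>i. cls (fgen (GenE i)));
          f = (\<lambda>i. cls (fgen (GenF i)))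
      in no_singular A K (simple_ix m n) e f \<and> no_singular A K (simple_ix m n) f e)"

text \<open>The algebra generated by the \<open>q^h\<close>, \<open>e_i\<close>, \<open>f_i\<close> subject to the relations and the further
  conditions is the largest quotient of the free algebra that satisfies all of them: the
  intersection below is itself admissible (\<open>uq_admissible_uq_ideal\<close>).\<close>

definition uq_ideal :: "nat \<Rightarrow> nat \<Rightarrow> uq_gen fpoly set" where
  "uq_ideal m n = \<Inter>{I. uq_admissible m n I}"

definition Uq :: "nat \<Rightarrow> nat \<Rightarrow> uq_gen fpoly set ring" where
  "Uq m n = uq_free m n Quot uq_ideal m n"

definition uq_class :: "nat \<Rightarrow> nat \<Rightarrow> uq_gen fpoly \<Rightarrow> uq_gen fpoly set" where
  "uq_class m n x = uq_ideal m n +>\<^bsub>uq_free m n\<^esub> x"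

text \<open>The automorphism \<open>\<sigma>\<close> of the free algebra multiplies a word by the sign of its parity; it
  preserves the ideal, so on the quotient it maps a coset to its image (\<open>uq_sigma_class\<close>).\<close>

fun letter_parity :: "nat \<Rightarrow> uq_gen \<Rightarrow> nat" where
  "letter_parity m (GenQ h) = 0"
| "letter_parity m (GenE i) = gpar m i"
| "letter_parity m (GenF i) = gpar m i"

definition word_sign :: "nat \<Rightarrow> uq_gen word \<Rightarrow> ratfun" where
  "word_sign m w = (-1) ^ sum_list (map (letter_parity m) (letters w))"

definition sigma_free :: "nat \<Rightarrow> uq_gen fpoly \<Rightarrow> uq_gen fpoly" where
  "sigma_free m x = Poly_Mapping.mapp
     (\<lambda>w c. word_sign m w * c) x"

definition uq_sigma :: "nat \<Rightarrow> uq_gen fpoly set \<Rightarrow> uq_gen fpoly set" where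
  "uq_sigma m X = sigma_free m ` X"

text \<open>The pair \<open>(x, y)\<close> stands for \<open>x + y\<sigma>\<close>, and \<open>\<sigma> x = \<sigma>(x) \<sigma>\<close>.\<close>

definition Uq_sigma ::
    "nat \<Rightarrow> nat \<Rightarrow> (uq_gen fpoly set \<times> uq_gen fpoly set) ring" where
  "Uq_sigma m n = (let U = Uq m n in
    \<lparr>carrier = carrier U \<times> carrier U,
     mult = (\<lambda>(x, y) (x', y').
       (x \<otimes>\<^bsub>U\<^esub> x' \<oplus>\<^bsub>U\<^esub> y \<otimes>\<^bsub>U\<^esub> uq_sigma m y', x \<otimes>\<^bsub>U\<^esub> y' \<oplus>\<^bsub>U\<^esub> y \<otimes>\<^bsub>U\<^esub> uq_sigma m x')),
     one = (\<one>\<^bsub>U\<^esub>, \<zero>\<^bsub>U\<^esub>),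
     zero = (\<zero>\<^bsub>U\<^esub>, \<zero>\<^bsub>U\<^esub>),
     add = (\<lambda>(x, y) (x', y'). (x \<oplus>\<^bsub>U\<^esub> x', y \<oplus>\<^bsub>U\<^esub> y'))\<rparr>)"

definition uqs_elem :: "nat \<Rightarrow> nat \<Rightarrow> uq_gen fpoly \<Rightarrow> uq_gen fpoly set \<times> uq_gen fpoly set" where
  "uqs_elem m n x = (uq_class m n x, \<zero>\<^bsub>Uq m n\<^esub>)"

definition uqs_sigma :: "nat \<Rightarrow> nat \<Rightarrow> uq_gen fpoly set \<times> uq_gen fpoly set" where
  "uqs_sigma m n = (\<zero>\<^bsub>Uq m n\<^esub>, \<one>\<^bsub>Uq m n\<^esub>)"


section \<open>The vector representation and its tensor powers\<close>

text \<open>\<open>sq_coeff m s h\<close> is the matrix of \<open>\<rho>(\<sigma>^s q^h)\<close> on \<open>V\<close>.\<close>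

definition sq_coeff :: "nat \<Rightarrow> nat \<Rightarrow> (nat \<Rightarrow> int) \<Rightarrow> nat \<Rightarrow> nat \<Rightarrow> ratfun" where
  "sq_coeff m s h k l = (if l = k then ((-1) ^ vpar m k) ^ s * qvar powi h k else 0)"

definition id_coeff :: "nat \<Rightarrow> nat \<Rightarrow> ratfun" where
  "id_coeff k l = of_bool (l = k)"

definition e_coeff :: "nat \<Rightarrow> nat \<Rightarrow> nat \<Rightarrow> ratfun" where
  "e_coeff i k l = of_bool (k = i + 1 \<and> l = i)"

definition f_coeff :: "nat \<Rightarrow> nat \<Rightarrow> nat \<Rightarrow> ratfun" where
  "f_coeff i k l = of_bool (k = i \<and> l = i + 1)"

definition rho_sigma :: "nat \<Rightarrow> nat \<Rightarrow> nat \<Rightarrow> operator" where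
  "rho_sigma m n r =
     matrix_op (m + n) r (tensor_coeff (replicate r (sq_coeff m 1 (\<lambda>b. 0))))"

definition rho_q :: "nat \<Rightarrow> nat \<Rightarrow> nat \<Rightarrow> (nat \<Rightarrow> int) \<Rightarrow> operator" where
  "rho_q m n r h = matrix_op (m + n) r (tensor_coeff (replicate r (sq_coeff m 0 h)))"

definition rho_e :: "nat \<Rightarrow> nat \<Rightarrow> nat \<Rightarrow> nat \<Rightarrow> operator" where
  "rho_e m n r i = matrix_op (m + n) r (\<lambda>w u. \<Sum>k\<in>{1..r}.
     tensor_coeff
       (replicate (k - 1) (sq_coeff m (gpar m i) (\<lambda>b. 0)) @ [e_coeff i] @
        replicate (r - k) (sq_coeff m 0 (\<lambda>b. - (ell m i * coroot m n i b)))) w u)"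

definition rho_f :: "nat \<Rightarrow> nat \<Rightarrow> nat \<Rightarrow> nat \<Rightarrow> operator" where
  "rho_f m n r i = matrix_op (m + n) r (\<lambda>w u. \<Sum>k\<in>{1..r}.
     tensor_coeff
       (replicate (k - 1) (sq_coeff m (gpar m i) (\<lambda>b. ell m i * coroot m n i b)) @ [f_coeff i] @
        replicate (r - k) id_coeff) w u)"

text \<open>The algebra is generated by the elements below, so these values determine \<open>\<rho>\<close>.\<close>

definition is_tensor_rep ::
    "nat \<Rightarrow> nat \<Rightarrow> nat \<Rightarrow> (uq_gen fpoly set \<times> uq_gen fpoly set \<Rightarrow> operator) \<Rightarrow> bool" where
  "is_tensor_rep m n r \<rho> \<longleftrightarrow>
     \<rho> \<in> ring_hom (Uq_sigma m n) (tensor_End (m + n) r) \<and>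
     (\<forall>c. \<rho> (uqs_elem m n (fconst c)) = scalar_op (m + n) r c) \<and>
     \<rho> (uqs_sigma m n) = rho_sigma m n r \<and>
     (\<forall>h\<in>lattice m n. \<rho> (uqs_elem m n (fgen (GenQ h))) = rho_q m n r h) \<and>
     (\<forall>i\<in>simple_ix m n. \<rho> (uqs_elem m n (fgen (GenE i))) = rho_e m n r i) \<and>
     (\<forall>i\<in>simple_ix m n. \<rho> (uqs_elem m n (fgen (GenF i))) = rho_f m n r i)"

section \<open>The quantum superalgebra is well defined\<close>

lemma coroot_eq:
  "coroot m n i = (\<lambda>b. if b \<in> {1..m + n} then ell m i * wform m n (alpha i) (eps b) else 0)"
  (is "_ = ?h")
proof -
  have ell2: "ell m i * ell m i = 1" by (simp add: ell_def)
  have w: "wform m n (alpha i) (eps b) = (if b \<le> m then 1 else -1) * alpha i b" if "b \<in> {1..m + n}" for b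
    using that by (simp add: wform_def eps_def of_bool_def if_distrib cong: if_cong)
  have p: "pairing m n h (eps b) = h b" if "b \<in> {1..m + n}" for b h
    using that by (simp add: pairing_def eps_def of_bool_def if_distrib cong: if_cong)
  have e: "eps b \<in> lattice m n" if "b \<in> {1..m + n}" for b
    using that by (auto simp: lattice_def eps_def)
  show ?thesis unfolding coroot_def
  proof (rule the_equality)
    have "ell m i * pairing m n ?h a = wform m n (alpha i) a" for a
    proof -
      have eq: "pairing m n ?h a = (\<Sum>b\<in>{1..m + n}. ell m i * ((if b \<le> m then 1 else -1) * alpha i b * a b))"
        unfolding pairing_def by (rule sum.cong) (simp_all add: w)
      show ?thesis
      proof -
        have "ell m i * pairing m n ?h a = (\<Sum>b\<in>{1..m + n}. (ell m i * ell m i) * ((if b \<le> m then 1 else -1) * alpha i b * a b))"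
          unfolding eq by (simp only: sum_distrib_left mult.assoc)
        then show ?thesis by (simp add: wform_def ell2)
      qed
    qed
    then show "?h \<in> lattice m n \<and> (\<forall>a\<in>lattice m n. ell m i * pairing m n ?h a = wform m n (alpha i) a)"
      by (simp add: lattice_def)
  next
    fix h assume h: "h \<in> lattice m n \<and> (\<forall>a\<in>lattice m n. ell m i * pairing m n h a = wform m n (alpha i) a)"
    show "h = ?h"
    proof
      fix b
      show "h b = ?h b"
      proof (cases "b \<in> {1..m + n}")
        case True
        then have "ell m i * h b = wform m n (alpha i) (eps b)" using h e p by metis
        then have "ell m i * ell m i * h b = ell m i * wform m n (alpha i) (eps b)"
          by (simp add: mult.assoc)
        then show ?thesis using True ell2 by simp
      next
        case False then show ?thesis using h by (auto simp: lattice_def)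
      qed
    qed
  qed
qed

lemma free_algebra_simps [simp]:
  "(x \<in> carrier (free_algebra G)) \<longleftrightarrow> (\<forall>w\<in>Poly_Mapping.keys x. set (letters w) \<subseteq> G)"
  "x \<otimes>\<^bsub>free_algebra G\<^esub> y = x * y" "x \<oplus>\<^bsub>free_algebra G\<^esub> y = x + y"
  "\<one>\<^bsub>free_algebra G\<^esub> = 1" "\<zero>\<^bsub>free_algebra G\<^esub> = 0"
  by (auto simp: free_algebra_def)

lemma free_algebra_mult_closed:
  "x \<in> carrier (free_algebra G) \<Longrightarrow> y \<in> carrier (free_algebra G) \<Longrightarrow> x * y \<in> carrier (free_algebra G)"
  using keys_mult[of x y] by (fastforce simp: plus_word_def)

lemma free_algebra_add_closed:
  "x \<in> carrier (free_algebra G) \<Longrightarrow> y \<in> carrier (free_algebra G) \<Longrightarrow> x + y \<in> carrier (free_algebra G)"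
  using Poly_Mapping.keys_add[of x y] by fastforce

lemma free_algebra_uminus_closed:
  "x \<in> carrier (free_algebra G) \<Longrightarrow> - x \<in> carrier (free_algebra G)"
  by (simp add: keys_minus)

lemma free_algebra_diff_closed:
  "x \<in> carrier (free_algebra G) \<Longrightarrow> y \<in> carrier (free_algebra G) \<Longrightarrow> x - y \<in> carrier (free_algebra G)"
  using free_algebra_add_closed[OF _ free_algebra_uminus_closed, of x G y] by simp

lemma free_algebra_one_closed: "1 \<in> carrier (free_algebra G)"
  by (auto simp: zero_word_def)

lemma free_algebra_zero_closed: "0 \<in> carrier (free_algebra G)"
  by simp

lemma free_algebra_const_closed: "fconst c \<in> carrier (free_algebra G)"
  by (auto simp: fconst_def zero_word_def)

lemma free_algebra_gen_closed: "g \<in> G \<Longrightarrow> fgen g \<in> carrier (free_algebra G)"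
  by (auto simp: fgen_def)

lemma ring_free_algebra: "ring (free_algebra G)"
proof (rule ringI)
  show "abelian_group (free_algebra G)"
    by (rule abelian_groupI)
      (auto simp del: free_algebra_simps(1) simp: free_algebra_add_closed free_algebra_zero_closed
        add.assoc add.commute intro!: bexI[OF _ free_algebra_uminus_closed])
  show "Group.monoid (free_algebra G)"
    by (rule monoidI)
      (auto simp del: free_algebra_simps(1) simp: free_algebra_mult_closed free_algebra_one_closed mult.assoc)
qed (auto simp: algebra_simps)

lemma no_singular_transfer:
  fixes A :: "'a ring" and B :: "'b ring"
  assumes A: "ring A" and B: "ring B" and h: "h \<in> ring_hom A B"
    and K: "K \<subseteq> carrier A" and x: "x ` J \<subseteq> carrier A" and y: "y ` J \<subseteq> carrier A"
    and ns: "no_singular B (h ` K) J (h \<circ> x) (h \<circ> y)"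
    and a: "a \<in> Idl\<^bsub>A\<lparr>carrier := generate_ring A (K \<union> x ` J)\<rparr>\<^esub> (x ` J)"
    and ya: "\<And>i. i \<in> J \<Longrightarrow> y i \<otimes>\<^bsub>A\<^esub> a \<in> (\<lambda>b. b \<otimes>\<^bsub>A\<^esub> y i) ` generate_ring A (K \<union> x ` J)"
  shows "h a = \<zero>\<^bsub>B\<^esub>"
proof -
  interpret A: ring A by fact
  interpret B: ring B by fact
  interpret h: ring_hom_ring A B h
    by (rule ring_hom_ringI2) fact+
  define S where "S = generate_ring A (K \<union> x ` J)"
  define S' where "S' = generate_ring B (h ` K \<union> (h \<circ> x) ` J)"
  have KxA: "K \<union> x ` J \<subseteq> carrier A" using K x by auto
  have KxB: "h ` K \<union> (h \<circ> x) ` J \<subseteq> carrier B"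
    using KxA h.hom_closed by auto
  have subS: "subring S A" unfolding S_def by (rule A.generate_ring_is_subring[OF KxA])
  have subS': "subring S' B" unfolding S'_def by (rule B.generate_ring_is_subring[OF KxB])
  interpret S: ring "A\<lparr>carrier := S\<rparr>" by (rule A.subring_is_ring[OF subS])
  interpret S': ring "B\<lparr>carrier := S'\<rparr>" by (rule B.subring_is_ring[OF subS'])
  have SA: "S \<subseteq> carrier A" unfolding S_def by (rule A.generate_ring_incl[OF KxA])
  have hS: "h s \<in> S'" if "s \<in> S" for s
    using that unfolding S_def
  proof (induction rule: generate_ring.induct)
    case (incl s)
    then show ?case by (auto simp: S'_def intro!: generate_ring.incl)
  next
    case one
    then show ?case by (simp add: S'_def generate_ring.one)
  next
    case (a_inv s)
    then have "s \<in> carrier A" using SA S_def by blast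
    then show ?case using a_inv by (simp add: S'_def generate_ring.a_inv)
  next
    case (eng_add s t)
    then have "s \<in> carrier A" "t \<in> carrier A" using SA S_def by blast+
    then show ?case using eng_add by (simp add: S'_def generate_ring.eng_add)
  next
    case (eng_mult s t)
    then have "s \<in> carrier A" "t \<in> carrier A" using SA S_def by blast+
    then show ?case using eng_mult by (simp add: S'_def generate_ring.eng_mult)
  qed
  have hres: "h \<in> ring_hom (A\<lparr>carrier := S\<rparr>) (B\<lparr>carrier := S'\<rparr>)"
    using SA hS by (intro ring_hom_memI) (auto simp: subset_iff)
  interpret hres: ring_hom_ring "A\<lparr>carrier := S\<rparr>" "B\<lparr>carrier := S'\<rparr>" h
    by (rule ring_hom_ringI2) (use hres S.ring_axioms S'.ring_axioms in auto)
  have xS: "x ` J \<subseteq> carrier (A\<lparr>carrier := S\<rparr>)" by (auto simp: S_def intro: generate_ring.incl)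
  have hxS': "(h \<circ> x) ` J \<subseteq> carrier (B\<lparr>carrier := S'\<rparr>)"
    unfolding S'_def by (auto intro: generate_ring.incl)
  define I' where "I' = Idl\<^bsub>B\<lparr>carrier := S'\<rparr>\<^esub> ((h \<circ> x) ` J)"
  have I': "ideal I' (B\<lparr>carrier := S'\<rparr>)" unfolding I'_def by (rule S'.genideal_ideal[OF hxS'])
  have "ideal {s \<in> carrier (A\<lparr>carrier := S\<rparr>). h s \<in> I'} (A\<lparr>carrier := S\<rparr>)"
    by (rule hres.ideal_vimage) fact
  moreover have "x ` J \<subseteq> {s \<in> carrier (A\<lparr>carrier := S\<rparr>). h s \<in> I'}"
    using xS S'.genideal_self[OF hxS'] by (auto simp: I'_def)
  ultimately have "a \<in> {s \<in> carrier (A\<lparr>carrier := S\<rparr>). h s \<in> I'}"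
    using a S.genideal_minimal S_def by blast
  then have aS: "a \<in> S" and ha: "h a \<in> I'" by auto
  have "(h \<circ> y) i \<otimes>\<^bsub>B\<^esub> h a \<in> (\<lambda>b. b \<otimes>\<^bsub>B\<^esub> (h \<circ> y) i) ` S'" if i: "i \<in> J" for i
  proof -
    from ya[OF i] obtain b where b: "b \<in> S" "y i \<otimes>\<^bsub>A\<^esub> a = b \<otimes>\<^bsub>A\<^esub> y i"
      by (auto simp: S_def)
    have "h (y i) \<otimes>\<^bsub>B\<^esub> h a = h b \<otimes>\<^bsub>B\<^esub> h (y i)"
      using b i y aS SA by (metis h.hom_mult image_subset_iff subsetD)
    then show ?thesis using hS[OF b(1)] by auto
  qed
  then show ?thesis
    using ns ha unfolding no_singular_def Let_def I'_def S'_def by blast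
qed


lemma no_singular_sign:
  fixes A :: "'a ring"
  assumes A: "ring A" and K: "K \<subseteq> carrier A" and x: "x ` J \<subseteq> carrier A" and y: "y ` J \<subseteq> carrier A"
    and x': "\<And>i. i \<in> J \<Longrightarrow> x' i = x i \<or> x' i = \<ominus>\<^bsub>A\<^esub> x i"
    and y': "\<And>i. i \<in> J \<Longrightarrow> y' i = y i \<or> y' i = \<ominus>\<^bsub>A\<^esub> y i"
    and ns: "no_singular A K J x y"
  shows "no_singular A K J x' y'"
proof -
  interpret A: ring A by fact
  have x'A: "x' ` J \<subseteq> carrier A" using x x' by fastforce
  have KxA: "K \<union> x ` J \<subseteq> carrier A" "K \<union> x' ` J \<subseteq> carrier A" using K x x'A by auto
  have xx': "x i = x' i \<or> x i = \<ominus>\<^bsub>A\<^esub> x' i" if "i \<in> J" for i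
    using x'[OF that] x that by auto
  have gen: "generate_ring A (K \<union> u ` J) \<subseteq> generate_ring A (K \<union> v ` J)"
    if "K \<union> u ` J \<subseteq> carrier A" "K \<union> v ` J \<subseteq> carrier A"
      "\<And>i. i \<in> J \<Longrightarrow> u i = v i \<or> u i = \<ominus>\<^bsub>A\<^esub> v i" for u v
  proof (rule A.generate_ring_min_subring1)
    show "subring (generate_ring A (K \<union> v ` J)) A" by (rule A.generate_ring_is_subring) fact
    show "K \<union> u ` J \<subseteq> generate_ring A (K \<union> v ` J)"
    proof -
      have "u i \<in> generate_ring A (K \<union> v ` J)" if "i \<in> J" for i
        using that(1) \<open>\<And>i. i \<in> J \<Longrightarrow> u i = v i \<or> u i = \<ominus>\<^bsub>A\<^esub> v i\<close>[OF that]
        by (metis UnI2 generate_ring.a_inv generate_ring.incl imageI)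
      then show ?thesis by (auto intro: generate_ring.incl)
    qed
  qed (use that in auto)
  define S where "S = generate_ring A (K \<union> x ` J)"
  have S': "generate_ring A (K \<union> x' ` J) = S"
    unfolding S_def using gen[OF KxA xx'] gen[OF KxA(2,1) x'] by blast
  have subS: "subring S A" unfolding S_def by (rule A.generate_ring_is_subring[OF KxA(1)])
  interpret S: ring "A\<lparr>carrier := S\<rparr>" by (rule A.subring_is_ring[OF subS])
  have SA: "S \<subseteq> carrier A" unfolding S_def by (rule A.generate_ring_incl[OF KxA(1)])
  have xS: "x ` J \<subseteq> carrier (A\<lparr>carrier := S\<rparr>)" by (auto simp: S_def intro: generate_ring.incl)
  have minus: "\<ominus>\<^bsub>A\<lparr>carrier := S\<rparr>\<^esub> s = \<ominus>\<^bsub>A\<^esub> s" if "s \<in> S" for s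
  proof -
    have 1: "\<ominus>\<^bsub>A\<lparr>carrier := S\<rparr>\<^esub> s \<in> S" and 2: "\<ominus>\<^bsub>A\<lparr>carrier := S\<rparr>\<^esub> s \<oplus>\<^bsub>A\<^esub> s = \<zero>\<^bsub>A\<^esub>"
      using S.a_inv_closed[of s] S.l_neg[of s] that by simp_all
    show ?thesis
      by (rule A.minus_equality[symmetric]) (use 1 2 that SA in auto)
  qed
  have id: "Idl\<^bsub>A\<lparr>carrier := S\<rparr>\<^esub> (x' ` J) \<subseteq> Idl\<^bsub>A\<lparr>carrier := S\<rparr>\<^esub> (x ` J)"
  proof (rule S.genideal_minimal)
    show id: "ideal (Idl\<^bsub>A\<lparr>carrier := S\<rparr>\<^esub> (x ` J)) (A\<lparr>carrier := S\<rparr>)"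
      by (rule S.genideal_ideal[OF xS])
    interpret I: ideal "Idl\<^bsub>A\<lparr>carrier := S\<rparr>\<^esub> (x ` J)" "A\<lparr>carrier := S\<rparr>" by fact
    show "x' ` J \<subseteq> Idl\<^bsub>A\<lparr>carrier := S\<rparr>\<^esub> (x ` J)"
    proof (rule image_subsetI)
      fix i assume i: "i \<in> J"
      have "x i \<in> Idl\<^bsub>A\<lparr>carrier := S\<rparr>\<^esub> (x ` J)" using S.genideal_self[OF xS] i by auto
      moreover from this have "\<ominus>\<^bsub>A\<lparr>carrier := S\<rparr>\<^esub> x i \<in> Idl\<^bsub>A\<lparr>carrier := S\<rparr>\<^esub> (x ` J)"
        by (rule I.a_inv_closed)
      moreover have "x i \<in> S" using xS i by auto
      ultimately show "x' i \<in> Idl\<^bsub>A\<lparr>carrier := S\<rparr>\<^esub> (x ` J)"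
        using x'[OF i] minus[of "x i"] by metis
    qed
  qed
  have idS: "Idl\<^bsub>A\<lparr>carrier := S\<rparr>\<^esub> (x ` J) \<subseteq> S"
    using S.genideal_ideal[OF xS] by (auto dest: ideal.Icarr)
  show ?thesis
    unfolding no_singular_def Let_def S'
  proof (intro ballI impI)
    fix a assume a: "a \<in> Idl\<^bsub>A\<lparr>carrier := S\<rparr>\<^esub> (x' ` J)"
      and ya: "\<forall>i\<in>J. y' i \<otimes>\<^bsub>A\<^esub> a \<in> (\<lambda>b. b \<otimes>\<^bsub>A\<^esub> y' i) ` S"
    have aA: "a \<in> carrier A" using a id idS SA by blast
    have "y i \<otimes>\<^bsub>A\<^esub> a \<in> (\<lambda>b. b \<otimes>\<^bsub>A\<^esub> y i) ` S" if i: "i \<in> J" for i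
    proof -
      obtain b where b: "b \<in> S" "y' i \<otimes>\<^bsub>A\<^esub> a = b \<otimes>\<^bsub>A\<^esub> y' i" using ya i by auto
      have "y i \<in> carrier A" "b \<in> carrier A" using y i b SA by auto
      note c = this
      have "y i \<otimes>\<^bsub>A\<^esub> a = b \<otimes>\<^bsub>A\<^esub> y i"
        using y'[OF i]
      proof
        assume "y' i = \<ominus>\<^bsub>A\<^esub> y i"
        then have "\<ominus>\<^bsub>A\<^esub> (y i \<otimes>\<^bsub>A\<^esub> a) = \<ominus>\<^bsub>A\<^esub> (b \<otimes>\<^bsub>A\<^esub> y i)"
          using b(2) aA c by (simp add: A.l_minus A.r_minus)
        then show ?thesis using aA c by (metis A.m_closed A.minus_minus)
      qed (use b(2) in simp)
      then show ?thesis using b by auto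
    qed
    then show "a = \<zero>\<^bsub>A\<^esub>"
      using ns a id unfolding no_singular_def Let_def S_def by blast
  qed
qed

lemma quot_lift:
  fixes F :: "'a ring" and B :: "'b ring"
  assumes F: "ring F" and B: "ring B" and J: "ideal J F" and g: "g \<in> ring_hom F B"
    and ker: "\<And>x. x \<in> J \<Longrightarrow> g x = \<zero>\<^bsub>B\<^esub>"
  obtains h where "h \<in> ring_hom (F Quot J) B" "\<And>x. x \<in> carrier F \<Longrightarrow> h (J +>\<^bsub>F\<^esub> x) = g x"
proof -
  interpret F: ring F by fact
  interpret B: ring B by fact
  interpret J: ideal J F by fact
  interpret g: ring_hom_ring F B g by (rule ring_hom_ringI2) fact+
  define h where "h X = the_elem (g ` X)" for X
  have h: "h (J +>\<^bsub>F\<^esub> x) = g x" if x: "x \<in> carrier F" for x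
  proof -
    have "g ` (J +>\<^bsub>F\<^esub> x) = {g x}"
    proof
      show "g ` (J +>\<^bsub>F\<^esub> x) \<subseteq> {g x}"
        using x ker J.Icarr by (auto simp: a_r_coset_def' )
      show "{g x} \<subseteq> g ` (J +>\<^bsub>F\<^esub> x)"
        using J.a_rcos_self[OF x] by blast
    qed
    then show ?thesis by (simp add: h_def)
  qed
  have rep: "\<exists>x\<in>carrier F. X = J +>\<^bsub>F\<^esub> x" if "X \<in> carrier (F Quot J)" for X
    using that by (auto simp: FactRing_def A_RCOSETS_def')
  interpret p: ring_hom_ring F "F Quot J" "(+>\<^bsub>F\<^esub>) J" by (rule J.rcos_ring_hom_ring)
  have "h \<in> ring_hom (F Quot J) B"
  proof (rule ring_hom_memI)
    fix X Y assume "X \<in> carrier (F Quot J)" "Y \<in> carrier (F Quot J)"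
    then obtain x y where xy: "x \<in> carrier F" "y \<in> carrier F" "X = J +>\<^bsub>F\<^esub> x" "Y = J +>\<^bsub>F\<^esub> y"
      using rep by metis
    have "X \<otimes>\<^bsub>F Quot J\<^esub> Y = J +>\<^bsub>F\<^esub> (x \<otimes>\<^bsub>F\<^esub> y)" using xy by simp
    then show "h (X \<otimes>\<^bsub>F Quot J\<^esub> Y) = h X \<otimes>\<^bsub>B\<^esub> h Y" by (simp only: xy(3,4)) (simp add: xy h del: p.hom_mult)
    have "X \<oplus>\<^bsub>F Quot J\<^esub> Y = J +>\<^bsub>F\<^esub> (x \<oplus>\<^bsub>F\<^esub> y)" using xy by simp
    then show "h (X \<oplus>\<^bsub>F Quot J\<^esub> Y) = h X \<oplus>\<^bsub>B\<^esub> h Y" by (simp only: xy(3,4)) (simp add: xy h del: p.hom_add)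
  next
    have "h (J +>\<^bsub>F\<^esub> \<one>\<^bsub>F\<^esub>) = \<one>\<^bsub>B\<^esub>"
      using h[OF F.one_closed] g.hom_one by (rule trans)
    then show "h \<one>\<^bsub>F Quot J\<^esub> = \<one>\<^bsub>B\<^esub>" by (simp only: FactRing_def monoid.simps)
  next
    fix X assume "X \<in> carrier (F Quot J)"
    then obtain x where "x \<in> carrier F" "X = J +>\<^bsub>F\<^esub> x" using rep by blast
    then show "h X \<in> carrier B" using h by simp
  qed
  then show ?thesis using h that by blast
qed

lemma poly_mapping_add_induct:
  fixes x :: "'a \<Rightarrow>\<^sub>0 'b::comm_monoid_add"
  assumes "P 0" "\<And>k c. P (Poly_Mapping.single k c)" "\<And>x y. P x \<Longrightarrow> P y \<Longrightarrow> P (x + y)"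
  shows "P x"
proof (induction x rule: update_induct)
  case const then show ?case by (rule assms)
next
  case (update f a b)
  have "Poly_Mapping.update a b f = Poly_Mapping.single a b + f"
    using update(1)
    by (intro poly_mapping_eqI) (auto simp: lookup_update lookup_add lookup_single in_keys_iff when_def)
  then show ?case using assms update by auto
qed

lemma word_sign_add: "word_sign m (v + w) = word_sign m v * word_sign m w"
  by (simp add: word_sign_def plus_word_def power_add)

lemma word_sign_square: "word_sign m w * word_sign m w = 1"
  by (simp add: word_sign_def flip: power_mult_distrib)

lemma lookup_sigma_free:
  "Poly_Mapping.lookup (sigma_free m x) w = word_sign m w * Poly_Mapping.lookup x w"
  by (auto simp: sigma_free_def lookup_mapp when_def in_keys_iff)

lemma sigma_free_add: "sigma_free m (x + y) = sigma_free m x + sigma_free m y"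
  by (rule poly_mapping_eqI) (simp add: lookup_sigma_free lookup_add algebra_simps)

lemma sigma_free_zero [simp]: "sigma_free m 0 = 0"
  by (rule poly_mapping_eqI) (simp add: lookup_sigma_free)

lemma sigma_free_single:
  "sigma_free m (Poly_Mapping.single w c) = Poly_Mapping.single w (word_sign m w * c)"
  by (rule poly_mapping_eqI) (simp add: lookup_sigma_free lookup_single when_def)

lemma sigma_free_mult: "sigma_free m (x * y) = sigma_free m x * sigma_free m y"
proof (induction x rule: poly_mapping_add_induct)
  case (2 v c)
  show ?case
    by (induction y rule: poly_mapping_add_induct)
      (simp_all add: mult_single sigma_free_single word_sign_add sigma_free_add algebra_simps)
qed (simp_all add: sigma_free_add algebra_simps)

lemma sigma_free_invol: "sigma_free m (sigma_free m x) = x"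
  by (rule poly_mapping_eqI) (simp add: lookup_sigma_free word_sign_square flip: mult.assoc)

lemma sigma_free_const: "sigma_free m (fconst c) = fconst c"
  by (simp add: fconst_def sigma_free_single word_sign_def zero_word_def)

lemma sigma_free_gen: "sigma_free m (fgen g) = (-1) ^ letter_parity m g * fgen g"
  by (cases "even (letter_parity m g)")
    (simp_all add: fgen_def sigma_free_single word_sign_def single_uminus)

lemma keys_sigma_free: "Poly_Mapping.keys (sigma_free m x) \<subseteq> Poly_Mapping.keys x"
  by (auto simp: in_keys_iff lookup_sigma_free)

lemma sigma_free_hom: "sigma_free m \<in> ring_hom (free_algebra G) (free_algebra G)"
proof (rule ring_hom_memI)
  show "sigma_free m \<one>\<^bsub>free_algebra G\<^esub> = \<one>\<^bsub>free_algebra G\<^esub>"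
    using sigma_free_const[of m 1] by (simp add: fconst_def)
next
  fix x assume "x \<in> carrier (free_algebra G)"
  then show "sigma_free m x \<in> carrier (free_algebra G)" using keys_sigma_free by auto
qed (simp_all add: sigma_free_add sigma_free_mult)


lemma coroot_lattice: "(\<lambda>b. ell m i * coroot m n i b) \<in> lattice m n"
  by (simp add: coroot_eq lattice_def)

lemma fgen_closed:
  "h \<in> lattice m n \<Longrightarrow> fgen (GenQ h) \<in> carrier (uq_free m n)"
  "i \<in> simple_ix m n \<Longrightarrow> fgen (GenE i) \<in> carrier (uq_free m n)"
  "i \<in> simple_ix m n \<Longrightarrow> fgen (GenF i) \<in> carrier (uq_free m n)"
  unfolding uq_free_def by (rule free_algebra_gen_closed, simp add: uq_gens_def)+

lemma neg_power_fconst: "(-1) ^ k = fconst ((-1) ^ k)"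
  by (cases "even k") (simp_all add: fconst_def single_uminus)

lemma uq_relators_closed: "uq_relators m n \<subseteq> carrier (uq_free m n)"
proof -
  note closed = free_algebra_mult_closed free_algebra_diff_closed free_algebra_one_closed
    free_algebra_const_closed
  have l: "(\<lambda>b. 0) \<in> lattice m n" "(\<lambda>b. - (ell m i * coroot m n i b)) \<in> lattice m n"
    "h \<in> lattice m n \<Longrightarrow> h' \<in> lattice m n \<Longrightarrow> (\<lambda>b. h b + h' b) \<in> lattice m n" for i h h'
    using coroot_lattice[of m i n] by (auto simp: lattice_def)
  show ?thesis
    using fgen_closed(1)[OF l(1)] fgen_closed(1)[OF l(2)] fgen_closed(1)[OF coroot_lattice]
      fgen_closed(1)[OF l(3)] fgen_closed
    unfolding uq_relators_def neg_power_fconst uq_free_def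
    by (auto simp del: free_algebra_simps(1) intro!: closed)
qed

lemma sigma_relators:
  assumes "x \<in> uq_relators m n"
  shows "sigma_free m x = x \<or> sigma_free m x = - x"
proof -
  have diff: "sigma_free m (x - y) = sigma_free m x - sigma_free m y" for x y
    by (rule poly_mapping_eqI) (simp add: lookup_sigma_free lookup_minus algebra_simps)
  have neg: "sigma_free m (- x) = - sigma_free m x" for x
    by (rule poly_mapping_eqI) (simp add: lookup_sigma_free)
  have one: "sigma_free m 1 = 1"
    using sigma_free_const[of m 1] by (simp add: fconst_def)
  have fconst0: "fconst 0 = 0" by (simp add: fconst_def)
  note simps = diff neg sigma_free_add one sigma_free_mult sigma_free_gen sigma_free_const gpar_def neg_power_fconst[symmetric]
  show ?thesis
    using assms unfolding uq_relators_def neg_power_fconst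
    by (auto simp: simps fconst0 split: if_splits)
qed

lemma uq_admissible_inter:
  fixes m n :: nat
  defines "F \<equiv> uq_free m n"
  assumes J: "ideal J F" and rel: "uq_relators m n \<subseteq> J"
    and sep: "\<And>x. x \<in> carrier F \<Longrightarrow> x \<notin> J \<Longrightarrow>
      \<exists>s I. (s = id \<or> s = sigma_free m) \<and> uq_admissible m n I \<and> s ` J \<subseteq> I \<and> s x \<notin> I"
  shows "uq_admissible m n J"
proof -
  have F: "ring F" unfolding F_def uq_free_def by (rule ring_free_algebra)
  interpret F: ring F by fact
  interpret J: ideal J F by fact
  define e where "e = (\<lambda>i. J +>\<^bsub>F\<^esub> fgen (GenE i))"
  define f where "f = (\<lambda>i. J +>\<^bsub>F\<^esub> fgen (GenF i))"
  define K where "K = (\<lambda>x. J +>\<^bsub>F\<^esub> x) ` range fconst"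
  have cF: "fconst c \<in> carrier F" for c
    unfolding F_def uq_free_def by (rule free_algebra_const_closed)
  have gF: "i \<in> simple_ix m n \<Longrightarrow> fgen (GenE i) \<in> carrier F"
    "i \<in> simple_ix m n \<Longrightarrow> fgen (GenF i) \<in> carrier F" for i
    unfolding F_def by (rule fgen_closed, assumption)+
  have A: "ring (F Quot J)" by (rule J.quotient_is_ring)
  interpret A: ring "F Quot J" by fact
  interpret p: ring_hom_ring F "F Quot J" "(+>\<^bsub>F\<^esub>) J" by (rule J.rcos_ring_hom_ring)
  have KA: "K \<subseteq> carrier (F Quot J)" using cF by (auto simp: K_def)
  have eA: "e ` simple_ix m n \<subseteq> carrier (F Quot J)" and fA: "f ` simple_ix m n \<subseteq> carrier (F Quot J)"
    using gF by (auto simp: e_def f_def)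
  have key: "no_singular (F Quot J) K (simple_ix m n) u v"
    if uv: "(u = e \<and> v = f) \<or> (u = f \<and> v = e)" for u v
    unfolding no_singular_def Let_def
  proof (intro ballI impI)
    fix a
    assume a: "a \<in> Idl\<^bsub>(F Quot J)\<lparr>carrier := generate_ring (F Quot J) (K \<union> u ` simple_ix m n)\<rparr>\<^esub> (u ` simple_ix m n)"
      and va: "\<forall>i\<in>simple_ix m n. v i \<otimes>\<^bsub>F Quot J\<^esub> a
        \<in> (\<lambda>b. b \<otimes>\<^bsub>F Quot J\<^esub> v i) ` generate_ring (F Quot J) (K \<union> u ` simple_ix m n)"
    have uA: "u ` simple_ix m n \<subseteq> carrier (F Quot J)" and vA: "v ` simple_ix m n \<subseteq> carrier (F Quot J)"
      using uv eA fA by auto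
    have aA: "a \<in> carrier (F Quot J)"
    proof -
      define S where "S = generate_ring (F Quot J) (K \<union> u ` simple_ix m n)"
      have KuA: "K \<union> u ` simple_ix m n \<subseteq> carrier (F Quot J)" using KA uA by auto
      interpret S: ring "(F Quot J)\<lparr>carrier := S\<rparr>"
        unfolding S_def by (rule A.subring_is_ring[OF A.generate_ring_is_subring[OF KuA]])
      have uS: "u ` simple_ix m n \<subseteq> carrier ((F Quot J)\<lparr>carrier := S\<rparr>)"
        by (auto simp: S_def intro: generate_ring.incl)
      have "a \<in> carrier ((F Quot J)\<lparr>carrier := S\<rparr>)"
        by (rule ideal.Icarr[OF S.genideal_ideal[OF uS]]) (use a S_def in simp)
      then have "a \<in> S" by simp
      then show ?thesis using A.generate_ring_incl[OF KuA] S_def by blast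
    qed
    have "\<exists>x\<in>carrier F. a = J +>\<^bsub>F\<^esub> x"
      using aA unfolding FactRing_def A_RCOSETS_def' partial_object.simps by blast
    then obtain x where x: "x \<in> carrier F" "a = J +>\<^bsub>F\<^esub> x"
      by (elim bexE) (rule that)
    have "x \<in> J"
    proof (rule ccontr)
      assume xJ: "x \<notin> J"
      obtain s I where s: "s = id \<or> s = sigma_free m" and I: "uq_admissible m n I"
        and sJ: "s ` J \<subseteq> I" and sx: "s x \<notin> I"
        using sep[OF x(1) xJ] by (elim exE conjE) (rule that)
      define B where "B = F Quot I"
      have idI: "ideal I F" using I by (simp add: uq_admissible_def F_def)
      interpret I: ideal I F by fact
      have B: "ring B" unfolding B_def by (rule I.quotient_is_ring)
      interpret B: ring B by fact
      have pI: "ring_hom_ring F B ((+>\<^bsub>F\<^esub>) I)" unfolding B_def by (rule I.rcos_ring_hom_ring)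
      interpret pI: ring_hom_ring F B "(+>\<^bsub>F\<^esub>) I" by fact
      have s_hom: "s \<in> ring_hom F F"
        using s sigma_free_hom unfolding F_def uq_free_def by (auto intro: ring_hom_memI)
      have sF: "s y \<in> carrier F" if "y \<in> carrier F" for y
        using s_hom that by (rule ring_hom_closed)
      define g where "g = (\<lambda>y. I +>\<^bsub>F\<^esub> s y)"
      have g: "g \<in> ring_hom F B"
        using ring_hom_trans[OF s_hom pI.homh] by (simp add: g_def comp_def)
      have gJ: "g y = \<zero>\<^bsub>B\<^esub>" if "y \<in> J" for y
      proof -
        have "s y \<in> I" using that sJ by blast
        then show ?thesis by (simp only: g_def B_def FactRing_def ring.simps I.a_rcos_const)
      qed
      obtain h where h: "h \<in> ring_hom (F Quot J) B"
        and hp: "\<And>y. y \<in> carrier F \<Longrightarrow> h (J +>\<^bsub>F\<^esub> y) = g y"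
        by (rule quot_lift[OF F B J g gJ]) (assumption, rule that)
      define e' where "e' = (\<lambda>i. I +>\<^bsub>F\<^esub> fgen (GenE i))"
      define f' where "f' = (\<lambda>i. I +>\<^bsub>F\<^esub> fgen (GenF i))"
      have s_const: "s (fconst c) = fconst c" for c
        using s by (auto simp: sigma_free_const)
      have hK: "h ` K = (\<lambda>x. I +>\<^bsub>F\<^esub> x) ` range fconst"
        by (simp add: K_def image_image hp cF g_def s_const)
      have ns: "no_singular B (h ` K) (simple_ix m n) e' f'" "no_singular B (h ` K) (simple_ix m n) f' e'"
        using I unfolding uq_admissible_def Let_def hK B_def e'_def f'_def F_def by blast+
      have hKB: "h ` K \<subseteq> carrier B" unfolding hK using cF by auto
      have e'B: "e' ` simple_ix m n \<subseteq> carrier B" "f' ` simple_ix m n \<subseteq> carrier B"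
        using gF by (auto simp: e'_def f'_def)
      have sgn: "s (fgen t) = fgen t \<or> s (fgen t) = - fgen t" for t
        using s by (cases "even (letter_parity m t)") (auto simp: sigma_free_gen)
      have neg: "\<ominus>\<^bsub>F\<^esub> y = - y" if "y \<in> carrier F" for y
        using that free_algebra_uminus_closed[of y "uq_gens m n"]
        by (intro F.minus_equality) (simp_all del: free_algebra_simps(1) add: F_def uq_free_def)
      have pm: "(h \<circ> e) i = e' i \<or> (h \<circ> e) i = \<ominus>\<^bsub>B\<^esub> e' i"
        "(h \<circ> f) i = f' i \<or> (h \<circ> f) i = \<ominus>\<^bsub>B\<^esub> f' i" if i: "i \<in> simple_ix m n" for i
      proof -
        have "I +>\<^bsub>F\<^esub> s (fgen t) = I +>\<^bsub>F\<^esub> fgen t \<or> I +>\<^bsub>F\<^esub> s (fgen t) = \<ominus>\<^bsub>B\<^esub> (I +>\<^bsub>F\<^esub> fgen t)"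
          if t: "fgen t \<in> carrier F" for t
          using sgn[of t] neg[OF t] pI.hom_a_inv[OF t] by metis
        then show "(h \<circ> e) i = e' i \<or> (h \<circ> e) i = \<ominus>\<^bsub>B\<^esub> e' i"
          "(h \<circ> f) i = f' i \<or> (h \<circ> f) i = \<ominus>\<^bsub>B\<^esub> f' i"
          unfolding comp_def e_def f_def e'_def f'_def hp[OF gF(1)[OF i]] hp[OF gF(2)[OF i]] g_def
          using gF[OF i] by blast+
      qed
      have ns': "no_singular B (h ` K) (simple_ix m n) (h \<circ> u) (h \<circ> v)"
        using uv
      proof
        assume "u = e \<and> v = f"
        then show ?thesis using no_singular_sign[OF B hKB e'B _ _ ns(1)] pm by blast
      next
        assume "u = f \<and> v = e"
        then show ?thesis using no_singular_sign[OF B hKB e'B(2,1) _ _ ns(2)] pm by blast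
      qed
      have "h a = \<zero>\<^bsub>B\<^esub>"
        by (rule no_singular_transfer[OF A B h KA uA vA ns' a]) (use va in blast)
      then have "I +>\<^bsub>F\<^esub> s x = I"
        using hp[OF x(1)] unfolding x(2) g_def B_def FactRing_def ring.simps by (metis)
      then have "s x \<in> I" using I.a_rcos_self[OF sF[OF x(1)]] by simp
      then show False using sx by simp
    qed
    then show "a = \<zero>\<^bsub>F Quot J\<^esub>" unfolding x(2) by (simp only: FactRing_def ring.simps J.a_rcos_const)
  qed
  show ?thesis
    unfolding uq_admissible_def Let_def
    using J rel key unfolding F_def e_def f_def K_def by blast
qed

lemma uq_admissible_carrier: "uq_admissible m n (carrier (uq_free m n))"
proof -
  interpret F: ring "uq_free m n" unfolding uq_free_def by (rule ring_free_algebra)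
  show ?thesis
    by (rule uq_admissible_inter[OF F.oneideal uq_relators_closed]) simp
qed

theorem uq_admissible_uq_ideal: "uq_admissible m n (uq_ideal m n)"
proof (rule uq_admissible_inter)
  interpret F: ring "uq_free m n" unfolding uq_free_def by (rule ring_free_algebra)
  show "ideal (uq_ideal m n) (uq_free m n)"
    unfolding uq_ideal_def
    by (rule F.i_Intersect) (use uq_admissible_carrier in \<open>auto simp: uq_admissible_def\<close>)
  show "uq_relators m n \<subseteq> uq_ideal m n"
    by (auto simp: uq_ideal_def uq_admissible_def)
  fix x assume "x \<notin> uq_ideal m n"
  then show "\<exists>s I. (s = id \<or> s = sigma_free m) \<and> uq_admissible m n I \<and> s ` uq_ideal m n \<subseteq> I \<and> s x \<notin> I"
    by (intro exI[of _ id]) (auto simp: uq_ideal_def)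
qed

lemma sigma_free_uq_ideal: "sigma_free m ` uq_ideal m n = uq_ideal m n"
proof -
  define F where "F = uq_free m n"
  interpret F: ring F unfolding F_def uq_free_def by (rule ring_free_algebra)
  have s_hom: "sigma_free m \<in> ring_hom F F" unfolding F_def uq_free_def by (rule sigma_free_hom)
  interpret s: ring_hom_ring F F "sigma_free m"
    by (rule ring_hom_ringI2) (use s_hom F.ring_axioms in auto)
  have sub: "sigma_free m x \<in> I" if x: "x \<in> uq_ideal m n" and I: "uq_admissible m n I" for x I
  proof -
    have idI: "ideal I F" and rel: "uq_relators m n \<subseteq> I"
      using I by (simp_all add: uq_admissible_def F_def)
    interpret I: ideal I F by fact
    define J where "J = {x \<in> carrier F. sigma_free m x \<in> I}"
    have "uq_admissible m n J"
    proof (rule uq_admissible_inter)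
      show "ideal J (uq_free m n)" unfolding J_def F_def[symmetric] by (rule s.ideal_vimage[OF idI])
      show "uq_relators m n \<subseteq> J"
      proof
        fix y assume y: "y \<in> uq_relators m n"
        have yF: "y \<in> carrier F" using y uq_relators_closed F_def by blast
        have "\<ominus>\<^bsub>F\<^esub> y = - y"
          using yF free_algebra_uminus_closed[of y "uq_gens m n"]
          by (intro F.minus_equality) (simp_all del: free_algebra_simps(1) add: F_def uq_free_def)
        then show "y \<in> J"
          using sigma_relators[OF y] yF y rel I.a_inv_closed[of y] by (auto simp: J_def)
      qed
      fix x assume "x \<in> carrier (uq_free m n)" "x \<notin> J"
      then show "\<exists>s I. (s = id \<or> s = sigma_free m) \<and> uq_admissible m n I \<and> s ` J \<subseteq> I \<and> s x \<notin> I"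
        using I by (intro exI[of _ "sigma_free m"] exI[of _ I]) (auto simp: J_def F_def)
    qed
    then show ?thesis using x by (auto simp: uq_ideal_def J_def)
  qed
  then have 1: "sigma_free m ` uq_ideal m n \<subseteq> uq_ideal m n" by (auto simp: uq_ideal_def)
  have "x \<in> sigma_free m ` uq_ideal m n" if "x \<in> uq_ideal m n" for x
    using that 1 sigma_free_invol[of m x] by (metis imageI image_subset_iff)
  then show ?thesis using 1 by blast
qed

theorem uq_sigma_class: "uq_sigma m (uq_class m n x) = uq_class m n (sigma_free m x)"
proof -
  have "(\<lambda>h. sigma_free m (h + x)) ` uq_ideal m n
      = (\<lambda>h. h + sigma_free m x) ` sigma_free m ` uq_ideal m n"
    by (simp add: image_image sigma_free_add)
  then show ?thesis
    unfolding sigma_free_uq_ideal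
    by (auto simp: uq_sigma_def uq_class_def a_r_coset_def' uq_free_def)
qed

end

theory Submission
  imports Defs "HOL-Combinatorics.Permutations"
begin

text \<open>Both algebras act on \<open>V^(\<otimes>r)\<close> by matrices over the formally real field \<open>\<rat>(q)\<close>, for which the
  standard bilinear form is anisotropic. The matrices of the \<open>T_i\<close> are symmetric, so the Hecke algebra \<open>A\<close>
  is closed under transposition and hence equals its bicommutant; it therefore suffices to show that the
  commutant of \<open>A\<close> is the algebra \<open>B\<close> of the quantum superalgebra. If not, there is a nonzero \<open>y\<close> in the
  commutant of \<open>A\<close> orthogonal to \<open>B\<close>. After scaling, \<open>y\<close> is regular at \<open>q = 1\<close> with nonzero value \<open>M\<close>,
  and \<open>M\<close> commutes with the signed permutations. By classical super Schur-Weyl duality \<open>M\<close> is the value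
  at \<open>q = 1\<close> of some \<open>b\<close> in \<open>B\<close>, and evaluating \<open>\<langle>y, b\<rangle> = 0\<close> at \<open>q = 1\<close> gives \<open>\<langle>M, M\<rangle> = 0\<close> over \<open>\<rat>\<close>,
  so \<open>M = 0\<close>, a contradiction.\<close>

section \<open>Matrix algebras and the bicommutant theorem\<close>

text \<open>Anisotropy, unlike nondegeneracy, is inherited by every subspace, so an orthogonal
  projection exists onto any subspace of matrices. This is used twice: for the bicommutant, where it
  plays the part of complete reducibility, and for the component of a commuting matrix orthogonal to
  \<open>B\<close>. The passage to q = 1 uses that the local ring there is a discrete valuation
  ring: dividing a nonzero matrix by an entry of least order removes all poles and leaves an entry
  1. Only one direction of the comparison with the classical case has to be controlled, namely that
  the classical commutant lifts to \<open>B\<close> with regular entries, and this can be checked on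
  generators. The simple root vectors lift to the operators of e_i and f_i, whose coproducts
  specialize to the graded Leibniz rule. The torus is the obstacle, since every q^h becomes the
  identity at q = 1; its classical counterpart has to be recovered from the first-order term of
  q^h.\<close>

lemma orthogonal_projection:
  fixes S :: "('j \<Rightarrow> 'k::field) set"
  assumes "finite J"
    and aniso: "\<And>f. (\<Sum>j\<in>J. f j * f j) = 0 \<Longrightarrow> \<forall>j\<in>J. f j = (0::'k)"
    and "\<And>s j. s \<in> S \<Longrightarrow> j \<notin> J \<Longrightarrow> s j = 0"
    and "(\<lambda>_. 0) \<in> S"
    and "\<And>s t. s \<in> S \<Longrightarrow> t \<in> S \<Longrightarrow> (\<lambda>j. s j + t j) \<in> S"
    and "\<And>s c. s \<in> S \<Longrightarrow> (\<lambda>j. c * s j) \<in> S"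
  shows "\<exists>b\<in>S. \<forall>s\<in>S. (\<Sum>j\<in>J. (x j - b j) * s j) = 0"
  using assms
proof (induction J arbitrary: S x rule: finite_induct)
  case empty
  then show ?case by auto
next
  case (insert j0 J)
  define S0 where "S0 = {s \<in> S. s j0 = 0}"
  have aniso: "\<forall>j\<in>J. f j = 0" if "(\<Sum>j\<in>J. f j * f j) = 0" for f :: "'j \<Rightarrow> 'k"
  proof -
    \<comment> \<open>Extension by 0 at \<open>j0\<close> turns a vector on \<open>J\<close> into
      one on \<open>insert j0 J\<close>, so anisotropy is inherited.\<close>
    have "(\<Sum>j\<in>J. (f(j0 := 0)) j * (f(j0 := 0)) j) = (\<Sum>j\<in>J. f j * f j)"
      using insert.hyps by (intro sum.cong) auto
    then show ?thesis using insert.prems(1)[of "f(j0 := 0)"] insert.hyps that by (auto split: if_splits)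
  qed
  have P0: "\<exists>b\<in>S0. \<forall>s\<in>S0. (\<Sum>j\<in>J. (y j - b j) * s j) = 0" for y
  proof (rule insert.IH)
    fix s j assume "s \<in> S0" "j \<notin> J"
    then show "s j = 0" using insert.prems(2)[of s j] by (cases "j = j0") (auto simp: S0_def)
  qed (use aniso insert.prems in \<open>auto simp: S0_def\<close>)
  have P0': "\<exists>b\<in>S0. \<forall>s\<in>S0. (\<Sum>j\<in>insert j0 J. (y j - b j) * s j) = 0" for y
    using P0[of y] insert.hyps by (simp add: S0_def)
  have sub: "(\<lambda>j. s j - c * t j) \<in> S" if "s \<in> S" "t \<in> S" for s t c
    using insert.prems(4)[OF that(1) insert.prems(5)[OF that(2), of "- c"]] by simp
  show ?case
  proof (cases "S = S0")
    case True
    then show ?thesis using P0' by simp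
  next
    case False
    then obtain s where s: "s \<in> S" "s j0 \<noteq> 0" by (auto simp: S0_def)
    \<comment> \<open>Gram-Schmidt: \<open>S0\<close> has codimension 1 in \<open>S\<close>, and
      subtracting from \<open>s\<close> its projection to \<open>S0\<close> leaves a vector
      \<open>s'\<close> orthogonal to \<open>S0\<close>. Elements of \<open>S0\<close> vanish at
      \<open>j0\<close>, so \<open>s' j0 = s j0\<close> is nonzero and, by anisotropy, so is the
      norm \<open>n\<close>.\<close>
    obtain b where b: "b \<in> S0" "\<forall>t\<in>S0. (\<Sum>j\<in>insert j0 J. (s j - b j) * t j) = 0"
      using P0' by blast
    define s' where "s' = (\<lambda>j. s j - b j)"
    have s': "s' \<in> S" "s' j0 \<noteq> 0" "\<forall>t\<in>S0. (\<Sum>j\<in>insert j0 J. s' j * t j) = 0"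
      using sub[OF s(1), of b 1] b s by (auto simp: s'_def S0_def)
    define n where "n = (\<Sum>j\<in>insert j0 J. s' j * s' j)"
    have n: "n \<noteq> 0" using insert.prems(1)[of s'] s'(2) by (auto simp: n_def)
    obtain c where c: "c \<in> S0" "\<forall>t\<in>S0. (\<Sum>j\<in>insert j0 J. (x j - c j) * t j) = 0"
      using P0' by blast
    define d where "d = (\<Sum>j\<in>insert j0 J. (x j - c j) * s' j) / n"
    define p where "p = (\<lambda>j. c j + d * s' j)"
    have "p \<in> S" using c(1) s'(1) insert.prems(4,5) by (auto simp: p_def S0_def)
    moreover have "(\<Sum>j\<in>insert j0 J. (x j - p j) * t j) = 0" if t: "t \<in> S" for t
    proof -
      \<comment> \<open>With this \<open>e\<close> the difference \<open>t - e s'\<close> vanishes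
        at \<open>j0\<close>, which splits \<open>t\<close> into a part in \<open>S0\<close> and a
        multiple of \<open>s'\<close>.\<close>
      define e where "e = t j0 / s' j0"
      define t0 where "t0 = (\<lambda>j. t j - e * s' j)"
      have t0: "t0 \<in> S0" using sub[OF t s'(1), of e] s'(2) by (simp add: t0_def S0_def) (simp add: e_def)
      have "(\<Sum>j\<in>insert j0 J. (x j - p j) * t j)
          = (\<Sum>j\<in>insert j0 J. (x j - c j) * t0 j) - d * (\<Sum>j\<in>insert j0 J. s' j * t0 j)
            + e * (\<Sum>j\<in>insert j0 J. (x j - c j) * s' j) - e * d * n"
        unfolding sum_distrib_left sum.distrib[symmetric] sum_subtractf[symmetric] n_def
        by (intro sum.cong) (auto simp: t0_def p_def algebra_simps)
      also have "\<dots> = 0" using t0 c(2) s'(3) n by (simp add: d_def)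
      finally show ?thesis .
    qed
    ultimately show ?thesis by blast
  qed
qed

section \<open>Matrices on a finite index set and the algebras they generate\<close>

text \<open>Matrices act on row vectors: the first index is the source, as in
  \<open>matrix_op\<close>, so \<open>mm I X Y\<close> means \<open>X\<close> followed by
  \<open>Y\<close>. \<open>matrix_op_mult\<close> reverses the order accordingly.\<close>

definition mm :: "'i set \<Rightarrow> ('i \<Rightarrow> 'i \<Rightarrow> 'k::comm_ring_1) \<Rightarrow> ('i \<Rightarrow> 'i \<Rightarrow> 'k) \<Rightarrow> 'i \<Rightarrow> 'i \<Rightarrow> 'k" where
  "mm I X Y w u = (\<Sum>v\<in>I. X w v * Y v u)"

text \<open>Matrices are total functions of two indices; forcing 0 outside the square makes equality
  of functions agree with equality of matrices.\<close>

definition on_square :: "'i set \<Rightarrow> ('i \<Rightarrow> 'i \<Rightarrow> 'k::zero) \<Rightarrow> bool" where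
  "on_square I X \<longleftrightarrow> (\<forall>w u. w \<notin> I \<or> u \<notin> I \<longrightarrow> X w u = 0)"

definition mat_one :: "'i set \<Rightarrow> 'i \<Rightarrow> 'i \<Rightarrow> 'k::comm_ring_1" where
  "mat_one I w u = of_bool (w \<in> I \<and> u = w)"

inductive_set malg :: "'i set \<Rightarrow> ('i \<Rightarrow> 'i \<Rightarrow> 'k::comm_ring_1) set \<Rightarrow> ('i \<Rightarrow> 'i \<Rightarrow> 'k) set" for I G where
  gen: "X \<in> G \<Longrightarrow> X \<in> malg I G"
| one: "mat_one I \<in> malg I G"
| add: "X \<in> malg I G \<Longrightarrow> Y \<in> malg I G \<Longrightarrow> (\<lambda>w u. X w u + Y w u) \<in> malg I G"
| scale: "X \<in> malg I G \<Longrightarrow> (\<lambda>w u. c * X w u) \<in> malg I G"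
| mult: "X \<in> malg I G \<Longrightarrow> Y \<in> malg I G \<Longrightarrow> mm I X Y \<in> malg I G"

definition mat_commutant :: "'i set \<Rightarrow> ('i \<Rightarrow> 'i \<Rightarrow> 'k::comm_ring_1) set \<Rightarrow> ('i \<Rightarrow> 'i \<Rightarrow> 'k) set" where
  "mat_commutant I S = {X. on_square I X \<and> (\<forall>Y\<in>S. mm I X Y = mm I Y X)}"

lemma on_squareD: "on_square I X \<Longrightarrow> w \<notin> I \<or> u \<notin> I \<Longrightarrow> X w u = 0"
  by (simp add: on_square_def)

lemma mat_eqI:
  assumes "on_square I X" "on_square I Y" "\<And>w u. w \<in> I \<Longrightarrow> u \<in> I \<Longrightarrow> X w u = Y w u"
  shows "X = Y"
  using assms unfolding on_square_def by (intro ext) metis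

lemma on_square_intros [simp, intro]:
  "on_square I (\<lambda>w u. 0)"
  "on_square I (mat_one I)"
  "on_square I X \<Longrightarrow> on_square I Y \<Longrightarrow> on_square I (\<lambda>w u. X w u + Y w u)"
  "on_square I X \<Longrightarrow> on_square I Y \<Longrightarrow> on_square I (\<lambda>w u. X w u - Y w u)"
  "on_square I X \<Longrightarrow> on_square I (\<lambda>w u. c * X w u)"
  "on_square I X \<Longrightarrow> on_square I Y \<Longrightarrow> on_square I (mm I X Y)"
  by (auto simp: on_square_def mat_one_def mm_def)

lemma malg_on_square:
  assumes "X \<in> malg I G" "\<And>Y. Y \<in> G \<Longrightarrow> on_square I Y"
  shows "on_square I X"
  using assms(1) by induction (auto intro: assms(2))

lemma mm_assoc: "mm I (mm I X Y) Z = mm I X (mm I Y Z)"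
  unfolding mm_def sum_distrib_left sum_distrib_right mult.assoc
  by (intro ext, rule sum.swap)

lemma mm_one [simp]:
  assumes "finite I" "on_square I X"
  shows "mm I X (mat_one I) = X" "mm I (mat_one I) X = X"
proof -
  show "mm I X (mat_one I) = X"
  proof (rule mat_eqI)
    fix w u assume "u \<in> I"
    then have "mm I X (mat_one I) w u = (\<Sum>v\<in>I. if v = u then X w u else 0)"
      unfolding mm_def by (intro sum.cong) (auto simp: mat_one_def)
    then show "mm I X (mat_one I) w u = X w u" using assms(1) \<open>u \<in> I\<close> by simp
  qed (use assms in auto)
  show "mm I (mat_one I) X = X"
  proof (rule mat_eqI)
    fix w u assume "w \<in> I"
    then have "mm I (mat_one I) X w u = (\<Sum>v\<in>I. if v = w then X w u else 0)"
      unfolding mm_def by (intro sum.cong) (auto simp: mat_one_def)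
    then show "mm I (mat_one I) X w u = X w u" using assms(1) \<open>w \<in> I\<close> by simp
  qed (use assms in auto)
qed

lemma mm_add: "mm I (\<lambda>w u. X w u + Y w u) Z = (\<lambda>w u. mm I X Z w u + mm I Y Z w u)"
  "mm I Z (\<lambda>w u. X w u + Y w u) = (\<lambda>w u. mm I Z X w u + mm I Z Y w u)"
  by (auto simp: fun_eq_iff mm_def algebra_simps sum.distrib)

lemma mm_diff: "mm I (\<lambda>w u. X w u - Y w u) Z = (\<lambda>w u. mm I X Z w u - mm I Y Z w u)"
  "mm I Z (\<lambda>w u. X w u - Y w u) = (\<lambda>w u. mm I Z X w u - mm I Z Y w u)"
  by (auto simp: fun_eq_iff mm_def algebra_simps sum_subtractf)

lemma mm_scale: "mm I (\<lambda>w u. c * X w u) Z = (\<lambda>w u. c * mm I X Z w u)"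
  "mm I Z (\<lambda>w u. c * X w u) = (\<lambda>w u. c * mm I Z X w u)"
  by (auto simp: fun_eq_iff mm_def sum_distrib_left mult_ac)

lemma mm_sum: "mm I (\<lambda>w u. \<Sum>s\<in>S. X s w u) Z = (\<lambda>w u. \<Sum>s\<in>S. mm I (X s) Z w u)"
  "mm I Z (\<lambda>w u. \<Sum>s\<in>S. X s w u) = (\<lambda>w u. \<Sum>s\<in>S. mm I Z (X s) w u)"
  unfolding mm_def sum_distrib_left sum_distrib_right by (intro ext, rule sum.swap)+

lemma mm_transpose: "mm I (\<lambda>w u. X u w) (\<lambda>w u. Y u w) = (\<lambda>w u. mm I Y X u w)"
  by (auto simp: fun_eq_iff mm_def mult.commute)

lemma malg_zero: "(\<lambda>w u. 0) \<in> malg I G"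
  using malg.scale[OF malg.one, where c = 0] by simp

lemma malg_sum:
  assumes "\<And>s. s \<in> S \<Longrightarrow> X s \<in> malg I G"
  shows "(\<lambda>w u. \<Sum>s\<in>S. X s w u) \<in> malg I G"
  using assms
proof (induction S rule: infinite_finite_induct)
  case (insert s S)
  then have "(\<lambda>w u. X s w u + (\<Sum>s\<in>S. X s w u)) \<in> malg I G"
    by (intro malg.add) auto
  then show ?case using insert.hyps by simp
qed (auto intro: malg_zero)

lemma malg_diff: "X \<in> malg I G \<Longrightarrow> Y \<in> malg I G \<Longrightarrow> (\<lambda>w u. X w u - Y w u) \<in> malg I G"
  using malg.add[OF _ malg.scale[where c = "-1"], of X I G Y] by simp

lemma malg_transpose:
  assumes "X \<in> malg I G" "\<And>Y. Y \<in> G \<Longrightarrow> (\<lambda>w u. Y u w) \<in> malg I G"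
  shows "(\<lambda>w u. X u w) \<in> malg I G"
  using assms(1)
proof induction
  case one
  have "(\<lambda>w u. mat_one I u w) = mat_one I" by (auto simp: mat_one_def fun_eq_iff)
  then show ?case using malg.one by metis
next
  case (mult X Y)
  then show ?case using malg.mult[OF mult.IH(2,1)] by (simp only: mm_transpose[of I Y X])
qed (auto intro: assms(2) malg.intros)

lemma mat_commutant_malg:
  assumes "finite I"
  shows "mat_commutant I (malg I G) = mat_commutant I G"
proof -
  have "mm I X Y = mm I Y X" if X: "on_square I X" "\<forall>Y\<in>G. mm I X Y = mm I Y X" and Y: "Y \<in> malg I G" for X Y
    using Y
  proof induction
    case (mult Y Z)
    then show ?case by (metis mm_assoc)
  qed (use assms X in \<open>auto simp: mm_add mm_scale\<close>)
  then show ?thesis by (auto simp: mat_commutant_def intro: malg.gen)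
qed

lemma malg_subset_commutant:
  assumes "finite I" "\<And>X Y. X \<in> G \<Longrightarrow> Y \<in> H \<Longrightarrow> mm I X Y = mm I Y X"
    and G: "\<And>X. X \<in> G \<Longrightarrow> on_square I X" and H: "\<And>X. X \<in> H \<Longrightarrow> on_square I X"
  shows "malg I G \<subseteq> mat_commutant I (malg I H)"
proof
  fix X assume X: "X \<in> malg I G"
  have "G \<subseteq> mat_commutant I (malg I H)"
    unfolding mat_commutant_malg[OF assms(1)] using assms by (auto simp: mat_commutant_def)
  \<comment> \<open>Commuting is a symmetric relation, so \<open>mat_commutant_malg\<close> applies
    a second time with the roles of \<open>G\<close> and \<open>H\<close> exchanged.\<close>
  then have "Y \<in> mat_commutant I (malg I G)" if "Y \<in> malg I H" for Y
    using that malg_on_square[OF that H] unfolding mat_commutant_malg[OF assms(1), of G]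
    unfolding mat_commutant_def subset_iff mem_Collect_eq by (metis (no_types))
  then have "mm I Y X = mm I X Y" if "Y \<in> malg I H" for Y
    using that X unfolding mat_commutant_def by blast
  then show "X \<in> mat_commutant I (malg I H)"
    using malg_on_square[OF X G] unfolding mat_commutant_def by simp
qed

text \<open>The form is the entrywise one, the trace of X times the transpose of Y; uncurrying turns
  matrices into vectors indexed by \<open>I \<times> I\<close>.\<close>

lemma malg_projection:
  fixes G :: "('i \<Rightarrow> 'i \<Rightarrow> 'k::field) set"
  assumes I: "finite I" and G: "\<And>Y. Y \<in> G \<Longrightarrow> on_square I Y"
    and aniso: "\<And>f :: 'i \<times> 'i \<Rightarrow> 'k. (\<Sum>j\<in>I \<times> I. f j * f j) = 0 \<Longrightarrow> \<forall>j\<in>I \<times> I. f j = 0"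
  shows "\<exists>P\<in>malg I G. \<forall>Y\<in>malg I G. (\<Sum>w\<in>I. \<Sum>u\<in>I. (X w u - P w u) * Y w u) = 0"
proof -
  have "\<exists>b\<in>case_prod ` malg I G. \<forall>s\<in>case_prod ` malg I G. (\<Sum>j\<in>I \<times> I. (case_prod X j - b j) * s j) = 0"
  proof (rule orthogonal_projection)
    fix s j assume "s \<in> case_prod ` malg I G" "j \<notin> I \<times> I"
    then show "s j = 0" by (cases j, auto dest!: malg_on_square[OF _ G] simp: on_square_def)
  next
    have "(\<lambda>_. 0) = case_prod (\<lambda>w u. 0 :: 'k)" by auto
    then show "(\<lambda>_. 0) \<in> case_prod ` malg I G" using malg_zero by blast
  next
    fix s t assume "s \<in> case_prod ` malg I G" "t \<in> case_prod ` malg I G"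
    then obtain Y Z where YZ: "s = case_prod Y" "t = case_prod Z" "Y \<in> malg I G" "Z \<in> malg I G" by blast
    then have "(\<lambda>j. s j + t j) = case_prod (\<lambda>w u. Y w u + Z w u)" by auto
    then show "(\<lambda>j. s j + t j) \<in> case_prod ` malg I G" using malg.add[OF YZ(3,4)] by blast
  next
    fix s and c :: 'k assume "s \<in> case_prod ` malg I G"
    then obtain Y where Y: "s = case_prod Y" "Y \<in> malg I G" by blast
    then have "(\<lambda>j. c * s j) = case_prod (\<lambda>w u. c * Y w u)" by auto
    then show "(\<lambda>j. c * s j) \<in> case_prod ` malg I G" using malg.scale[OF Y(2)] by blast
  qed (use I aniso in auto)
  then show ?thesis by (auto simp: sum.cartesian_product split_beta)
qed

text \<open>Left multiplication by \<open>X\<close> commutes with the orthogonal projection \<open>P\<close> onto the algebra, because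
  the blocks \<open>Q\<close> of \<open>P\<close> lie in the commutant; hence \<open>P X = X P(1) = X\<close>.\<close>

theorem bicommutant:
  fixes G :: "('i \<Rightarrow> 'i \<Rightarrow> 'k::field) set"
  assumes I: "finite I" and G: "\<And>Y. Y \<in> G \<Longrightarrow> on_square I Y"
    and Gt: "\<And>Y. Y \<in> G \<Longrightarrow> (\<lambda>w u. Y u w) \<in> malg I G"
    and aniso: "\<And>f :: 'i \<times> 'i \<Rightarrow> 'k. (\<Sum>j\<in>I \<times> I. f j * f j) = 0 \<Longrightarrow> \<forall>j\<in>I \<times> I. f j = 0"
    and X: "X \<in> mat_commutant I (mat_commutant I (malg I G))"
  shows "X \<in> malg I G"
proof -
  define ip where "ip = (\<lambda>X Y :: 'i \<Rightarrow> 'i \<Rightarrow> 'k. \<Sum>w\<in>I. \<Sum>u\<in>I. X w u * Y w u)"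
  have sq: "on_square I a" if "a \<in> malg I G" for a using malg_on_square[OF that G] .
  have "\<forall>X. \<exists>P. P \<in> malg I G \<and> (\<forall>Y\<in>malg I G. ip (\<lambda>w u. X w u - P w u) Y = 0)"
    using malg_projection[OF I G aniso] unfolding ip_def by blast
  from choice[OF this] obtain P where P: "\<And>X. P X \<in> malg I G"
    and orth: "\<And>X Y. Y \<in> malg I G \<Longrightarrow> ip (\<lambda>w u. X w u - P X w u) Y = 0" by blast
  have uniq: "P X = b" if b: "b \<in> malg I G" "\<And>Y. Y \<in> malg I G \<Longrightarrow> ip (\<lambda>w u. X w u - b w u) Y = 0" for X b
  proof -
    \<comment> \<open>Two candidates differ by an element of the algebra that is orthogonal to the
      algebra, hence to itself.\<close>
    let ?d = "\<lambda>w u. P X w u - b w u"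
    have d: "?d \<in> malg I G" by (intro malg_diff P b)
    have "ip ?d ?d = ip (\<lambda>w u. X w u - b w u) ?d - ip (\<lambda>w u. X w u - P X w u) ?d"
      unfolding ip_def sum_subtractf[symmetric] by (intro sum.cong refl) (simp add: algebra_simps)
    also have "\<dots> = 0" using b(2)[OF d] orth[OF d] by simp
    finally have "(\<Sum>j\<in>I \<times> I. case_prod ?d j * case_prod ?d j) = 0"
      by (simp add: ip_def sum.cartesian_product split_beta)
    from aniso[OF this] show ?thesis by (intro mat_eqI[OF sq[OF P] sq[OF b(1)]]) auto
  qed
  have P_sum: "P (\<lambda>w u. \<Sum>s\<in>S. c s * Y s w u) = (\<lambda>w u. \<Sum>s\<in>S. c s * P (Y s) w u)"
    for S :: "'i set" and c Y
  proof (rule uniq)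
    show "(\<lambda>w u. \<Sum>s\<in>S. c s * P (Y s) w u) \<in> malg I G" by (intro malg_sum malg.scale P)
    fix Z assume Z: "Z \<in> malg I G"
    have "ip (\<lambda>w u. (\<Sum>s\<in>S. c s * Y s w u) - (\<Sum>s\<in>S. c s * P (Y s) w u)) Z
        = (\<Sum>w\<in>I. \<Sum>u\<in>I. \<Sum>s\<in>S. c s * ((Y s w u - P (Y s) w u) * Z w u))"
      unfolding ip_def sum_subtractf[symmetric] sum_distrib_right
      by (intro sum.cong refl) (simp add: algebra_simps)
    also have "\<dots> = (\<Sum>w\<in>I. \<Sum>s\<in>S. \<Sum>u\<in>I. c s * ((Y s w u - P (Y s) w u) * Z w u))"
      by (intro sum.cong refl sum.swap)
    also have "\<dots> = (\<Sum>s\<in>S. \<Sum>w\<in>I. \<Sum>u\<in>I. c s * ((Y s w u - P (Y s) w u) * Z w u))"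
      by (rule sum.swap)
    also have "\<dots> = (\<Sum>s\<in>S. c s * ip (\<lambda>w u. Y s w u - P (Y s) w u) Z)"
      by (simp add: ip_def sum_distrib_left)
    also have "\<dots> = 0" using orth[OF Z] by simp
    finally show "ip (\<lambda>w u. (\<Sum>s\<in>S. c s * Y s w u) - (\<Sum>s\<in>S. c s * P (Y s) w u)) Z = 0" .
  qed
  \<comment> \<open>The adjoint of left multiplication by \<open>a\<close> is left multiplication by
    its transpose. The algebra is closed under transposes, so the projection \<open>P\<close> is
    linear over left multiplication by the algebra.\<close>
  have adj: "ip (mm I a Y) Z = ip Y (mm I (\<lambda>w u. a u w) Z)" for a Y Z
  proof -
    have "ip (mm I a Y) Z = (\<Sum>w\<in>I. \<Sum>u\<in>I. \<Sum>v\<in>I. a w v * Y v u * Z w u)"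
      by (simp add: ip_def mm_def sum_distrib_right)
    also have "\<dots> = (\<Sum>u\<in>I. \<Sum>v\<in>I. \<Sum>w\<in>I. a w v * Y v u * Z w u)"
      unfolding sum.swap[where A = I and B = I and g = "\<lambda>w u. \<Sum>v\<in>I. a w v * Y v u * Z w u"]
      by (intro sum.cong refl sum.swap)
    also have "\<dots> = (\<Sum>v\<in>I. \<Sum>u\<in>I. \<Sum>w\<in>I. a w v * Y v u * Z w u)" by (rule sum.swap)
    also have "\<dots> = ip Y (mm I (\<lambda>w u. a u w) Z)"
      by (simp add: ip_def mm_def sum_distrib_left mult_ac)
    finally show ?thesis .
  qed
  have P_mult: "P (mm I a Y) = mm I a (P Y)" if a: "a \<in> malg I G" for a Y
  proof (rule uniq)
    show "mm I a (P Y) \<in> malg I G" by (intro malg.mult a P)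
    fix Z assume Z: "Z \<in> malg I G"
    have "ip (\<lambda>w u. mm I a Y w u - mm I a (P Y) w u) Z = ip (mm I a (\<lambda>w u. Y w u - P Y w u)) Z"
      by (simp add: mm_diff)
    also have "\<dots> = 0" unfolding adj by (intro orth malg.mult malg_transpose[OF a Gt] Z)
    finally show "ip (\<lambda>w u. mm I a Y w u - mm I a (P Y) w u) Z = 0" .
  qed
  have P_one: "P (mat_one I) = mat_one I"
    by (rule uniq) (auto simp: malg.one ip_def)
  define E :: "'i \<Rightarrow> 'i \<Rightarrow> 'i \<Rightarrow> 'i \<Rightarrow> 'k" where "E = (\<lambda>i k w u. of_bool (w = i \<and> u = k))"
  \<comment> \<open>The matrix space is a sum of copies of the column space, and
    \<open>Q j k\<close> is the block of \<open>P\<close> from column \<open>k\<close> to column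
    \<open>j\<close>. Linearity of \<open>P\<close> over left multiplication by the algebra says
    that every block commutes with the algebra.\<close>
  define Q where "Q = (\<lambda>j k w u. if w \<in> I \<and> u \<in> I then P (E u k) w j else 0)"
  have expand: "(\<lambda>w u. \<Sum>i\<in>I. \<Sum>k\<in>I. Y i k * E i k w u) = Y" if Y: "on_square I Y" for Y
  proof (intro ext)
    fix w u
    have "(\<Sum>k\<in>I. Y i k * E i k w u) = (\<Sum>k\<in>I. if k = u then if i = w then Y i u else 0 else 0)" for i
      by (intro sum.cong) (auto simp: E_def)
    then have "(\<Sum>i\<in>I. \<Sum>k\<in>I. Y i k * E i k w u) = (\<Sum>i\<in>I. if i = w then if u \<in> I then Y i u else 0 else 0)"
      using I by (intro sum.cong) simp_all
    then show "(\<Sum>i\<in>I. \<Sum>k\<in>I. Y i k * E i k w u) = Y w u" using I Y by (auto simp: on_square_def)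
  qed
  have expand_col: "mm I a (E l k) = (\<lambda>w u. \<Sum>i\<in>I. a i l * E i k w u)" if "on_square I a" "l \<in> I" for a l k
  proof (intro ext)
    fix w u
    have "mm I a (E l k) w u = (\<Sum>v\<in>I. if v = l then a w l * of_bool (u = k) else 0)"
      unfolding mm_def by (intro sum.cong) (auto simp: E_def)
    moreover have "(\<Sum>i\<in>I. a i l * E i k w u) = (\<Sum>i\<in>I. if i = w then a w l * of_bool (u = k) else 0)"
      by (intro sum.cong) (auto simp: E_def)
    ultimately show "mm I a (E l k) w u = (\<Sum>i\<in>I. a i l * E i k w u)"
      using I that by (auto simp: on_square_def)
  qed
  have Q: "Q j k \<in> mat_commutant I (malg I G)" if "j \<in> I" "k \<in> I" for j k
    unfolding mat_commutant_def
  proof (intro CollectI conjI ballI)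
    show Qs: "on_square I (Q j k)" by (auto simp: on_square_def Q_def)
    fix a assume a: "a \<in> malg I G"
    show "mm I (Q j k) a = mm I a (Q j k)"
    proof (rule mat_eqI)
      fix i l assume il: "i \<in> I" "l \<in> I"
      note E = expand_col[OF sq[OF a] il(2), of k]
      have "mm I (Q j k) a i l = (\<Sum>i'\<in>I. a i' l * P (E i' k) i j)"
        using il by (simp add: mm_def Q_def mult.commute)
      also have "\<dots> = P (mm I a (E l k)) i j"
        unfolding E P_sum ..
      also have "\<dots> = mm I a (Q j k) i l"
        using il by (simp add: P_mult[OF a] mm_def Q_def)
      finally show "mm I (Q j k) a i l = mm I a (Q j k) i l" .
    qed (use Qs sq[OF a] in auto)
  qed
  have Xs: "on_square I X" using X by (simp add: mat_commutant_def)
  have "P X = X"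
  proof (rule mat_eqI)
    fix i j assume ij: "i \<in> I" "j \<in> I"
    have ps: "P (\<lambda>w u. \<Sum>i\<in>I. \<Sum>k\<in>I. Y i k * E i k w u) = (\<lambda>w u. \<Sum>i\<in>I. \<Sum>k\<in>I. Y i k * P (E i k) w u)" for Y
      using P_sum[where S = I and c = "\<lambda>_. 1" and Y = "\<lambda>i w u. \<Sum>k\<in>I. Y i k * E i k w u"] by (simp add: P_sum)
    have "P X i j = (\<Sum>i'\<in>I. \<Sum>k\<in>I. X i' k * P (E i' k) i j)"
      using ps[of X] expand[OF Xs] by metis
    also have "\<dots> = (\<Sum>k\<in>I. mm I (Q j k) X i k)"
      unfolding mm_def by (subst sum.swap) (use ij in \<open>simp add: Q_def mult.commute\<close>)
    also have "\<dots> = (\<Sum>k\<in>I. mm I X (Q j k) i k)"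
      using Q ij X by (intro sum.cong refl) (auto simp: mat_commutant_def)
    also have "\<dots> = (\<Sum>l\<in>I. X i l * (\<Sum>k\<in>I. P (E k k) l j))"
      unfolding mm_def sum_distrib_left by (subst sum.swap) (simp add: Q_def)
    also have "\<dots> = (\<Sum>l\<in>I. X i l * P (mat_one I) l j)"
    proof -
      have "mat_one I = (\<lambda>w u. \<Sum>k\<in>I. 1 * E k k w u)"
      proof (intro ext)
        fix w u
        have "(\<Sum>k\<in>I. 1 * E k k w u) = (\<Sum>k\<in>I. if k = w then of_bool (u = w) else 0)"
          by (intro sum.cong) (auto simp: E_def)
        then show "mat_one I w u = (\<Sum>k\<in>I. 1 * E k k w u)" using I by (auto simp: mat_one_def)
      qed
      then have "P (mat_one I) = (\<lambda>w u. \<Sum>k\<in>I. 1 * P (E k k) w u)" by (simp only: P_sum)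
      then show ?thesis by simp
    qed
    also have "\<dots> = X i j" using mm_one(1)[OF I Xs] by (simp add: P_one mm_def fun_eq_iff)
    finally show "P X i j = X i j" .
  qed (use sq[OF P] Xs in auto)
  then show ?thesis using P[of X] by simp
qed

section \<open>Values of rational functions at \<open>q = 1\<close>\<close>

text \<open>A relation, because a rational function may have a pole at 1; the functions that have a
  value form the local ring at q = 1. Any fraction with denominator nonzero at 1 will do, reduced or
  not.\<close>

definition value_at_1 :: "ratfun \<Rightarrow> rat \<Rightarrow> bool" where
  "value_at_1 x c \<longleftrightarrow> (\<exists>p d. poly d 1 \<noteq> 0 \<and> x = Fract p d \<and> c = poly p 1 / poly d 1)"

lemma value_at_1_unique:
  assumes "value_at_1 x c" "value_at_1 x c'"
  shows "c = c'"
proof -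
  obtain p d p' d' where *: "poly d 1 \<noteq> 0" "x = Fract p d" "c = poly p 1 / poly d 1"
    "poly d' 1 \<noteq> 0" "x = Fract p' d'" "c' = poly p' 1 / poly d' 1"
    using assms unfolding value_at_1_def by blast
  then have "d \<noteq> 0" "d' \<noteq> 0" by auto
  then have "p * d' = p' * d" using * by (simp add: eq_fract)
  then have "poly p 1 * poly d' 1 = poly p' 1 * poly d 1" by (metis poly_mult)
  then show ?thesis unfolding *(3,6) using *(1,4) by (simp add: frac_eq_eq)
qed

lemma value_at_1_Fract: "poly d 1 \<noteq> 0 \<Longrightarrow> value_at_1 (Fract p d) (poly p 1 / poly d 1)"
  by (auto simp: value_at_1_def)

lemma value_at_1_add:
  assumes "value_at_1 x c" "value_at_1 y d"
  shows "value_at_1 (x + y) (c + d)"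
proof -
  obtain p e p' e' where *: "poly e 1 \<noteq> 0" "x = Fract p e" "c = poly p 1 / poly e 1"
    "poly e' 1 \<noteq> 0" "y = Fract p' e'" "d = poly p' 1 / poly e' 1"
    using assms unfolding value_at_1_def by blast
  then have "e \<noteq> 0" "e' \<noteq> 0" by auto
  with * have "x + y = Fract (p * e' + p' * e) (e * e')" by simp
  then show ?thesis using value_at_1_Fract[of "e * e'" "p * e' + p' * e"] * by (simp add: add_frac_eq)
qed

lemma value_at_1_mult:
  assumes "value_at_1 x c" "value_at_1 y d"
  shows "value_at_1 (x * y) (c * d)"
proof -
  obtain p e p' e' where *: "poly e 1 \<noteq> 0" "x = Fract p e" "c = poly p 1 / poly e 1"
    "poly e' 1 \<noteq> 0" "y = Fract p' e'" "d = poly p' 1 / poly e' 1"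
    using assms unfolding value_at_1_def by blast
  then have "x * y = Fract (p * p') (e * e')" by simp
  then show ?thesis using value_at_1_Fract[of "e * e'" "p * p'"] * by simp
qed

lemma value_at_1_inverse:
  assumes "value_at_1 x c" "c \<noteq> 0"
  shows "value_at_1 (inverse x) (inverse c)"
proof -
  obtain p e where *: "poly e 1 \<noteq> 0" "x = Fract p e" "c = poly p 1 / poly e 1"
    using assms unfolding value_at_1_def by blast
  then show ?thesis using value_at_1_Fract[of p e] assms(2) by auto
qed

lemma value_at_1_0: "value_at_1 0 0"
  using value_at_1_Fract[of 1 0] by (simp add: Zero_fract_def)

lemma value_at_1_1: "value_at_1 1 1"
  using value_at_1_Fract[of 1 1] by (simp add: One_fract_def)

lemma value_at_1_rat: "\<exists>x. value_at_1 x c"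
  using value_at_1_Fract[of 1 "[:c:]"] by auto

lemma value_at_1_qvar: "value_at_1 qvar 1"
  using value_at_1_Fract[of 1 "[:0, 1:]"] by (simp add: qvar_def)

lemma value_at_1_uminus: "value_at_1 x c \<Longrightarrow> value_at_1 (- x) (- c)"
proof -
  assume "value_at_1 x c"
  moreover have "value_at_1 (- 1) (- 1)"
    using value_at_1_Fract[of 1 "- 1"] by (simp add: One_fract_def)
  ultimately show ?thesis using value_at_1_mult by fastforce
qed

lemma value_at_1_diff: "value_at_1 x c \<Longrightarrow> value_at_1 y d \<Longrightarrow> value_at_1 (x - y) (c - d)"
  using value_at_1_add[OF _ value_at_1_uminus] by fastforce

lemma value_at_1_sum:
  "(\<And>s. s \<in> S \<Longrightarrow> value_at_1 (f s) (g s)) \<Longrightarrow> value_at_1 (sum f S) (sum g S)"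
  by (induction S rule: infinite_finite_induct) (auto intro: value_at_1_add value_at_1_0)

lemma value_at_1_prod:
  "(\<And>s. s \<in> S \<Longrightarrow> value_at_1 (f s) (g s)) \<Longrightarrow> value_at_1 (prod f S) (prod g S)"
  by (induction S rule: infinite_finite_induct) (auto intro: value_at_1_mult value_at_1_1)

lemma value_at_1_power: "value_at_1 x c \<Longrightarrow> value_at_1 (x ^ k) (c ^ k)"
  by (induction k) (auto intro: value_at_1_mult value_at_1_1)

lemma value_at_1_q_powi: "value_at_1 (qvar powi k) 1"
proof (cases "k \<ge> 0")
  case True
  then show ?thesis using value_at_1_power[OF value_at_1_qvar, of "nat k"] by (simp add: power_int_def)
next
  case False
  then show ?thesis
    using value_at_1_power[OF value_at_1_inverse[OF value_at_1_qvar], of "nat (- k)"]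
    by (simp add: power_int_def)
qed

lemma value_at_1_sign: "value_at_1 ((- 1) ^ k) ((- 1) ^ k)"
  by (intro value_at_1_power value_at_1_uminus value_at_1_1)

lemma value_at_1_of_bool: "value_at_1 (of_bool P) (of_bool P)"
  by (cases P) (auto intro: value_at_1_0 value_at_1_1)

lemma qvar_neq_0: "qvar \<noteq> 0"
  using value_at_1_unique[OF value_at_1_qvar, of 0] value_at_1_0 by auto

lemma qvar_neq_1: "qvar \<noteq> 1"
  by (simp add: qvar_def One_fract_def eq_fract one_pCons)

text \<open>This is the quantum integer 1 + q + ... + q^(k-1). It recovers the multiplicity
  \<open>k\<close> of a letter from an eigenvalue q^k, although q^k itself tends to 1.\<close>

lemma value_at_1_quantum_integer: "value_at_1 ((qvar ^ k - 1) / (qvar - 1)) (of_nat k)"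
proof -
  have "(qvar ^ k - 1) / (qvar - 1) = (\<Sum>i<k. qvar ^ i)"
    using qvar_neq_1 by (simp add: power_diff_1_eq)
  moreover have "value_at_1 (\<Sum>i<k. qvar ^ i) (\<Sum>i<k. 1 ^ i)"
    by (intro value_at_1_sum value_at_1_power value_at_1_qvar)
  ultimately show ?thesis by simp
qed

text \<open>The local ring at q = 1 is a valuation ring: once the powers of q - 1 are split off
  numerator and denominator, the surplus power lies on one side.\<close>

lemma value_at_1_total:
  assumes "x \<noteq> 0"
  shows "(\<exists>c. value_at_1 x c) \<or> (\<exists>c. value_at_1 (inverse x) c)"
proof -
  obtain p d where pd: "x = Fract p d" "d \<noteq> 0" by (cases x) auto
  have p: "p \<noteq> 0" using assms pd by (auto simp: Zero_fract_def eq_fract)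
  define t where "t = [:- 1, 1 :: rat:]"
  obtain a where a: "p = t ^ Polynomial.order 1 p * a" "\<not> t dvd a"
    using order_decomp[OF p, of 1] by (auto simp: t_def)
  obtain b where b: "d = t ^ Polynomial.order 1 d * b" "\<not> t dvd b"
    using order_decomp[OF pd(2), of 1] by (auto simp: t_def)
  have t0: "t \<noteq> 0" by (simp add: t_def)
  have ab: "poly a 1 \<noteq> 0" "poly b 1 \<noteq> 0"
    using a(2) b(2) by (simp_all add: t_def poly_eq_0_iff_dvd)
  then have ab0: "a \<noteq> 0" "b \<noteq> 0" by auto
  have inv: "inverse x = Fract d p" using pd by simp
  show ?thesis
  proof (cases "Polynomial.order 1 d \<le> Polynomial.order 1 p")
    case True
    then have "p * b = t ^ (Polynomial.order 1 p - Polynomial.order 1 d) * a * d"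
      by (subst a(1), subst (2) b(1)) (simp add: power_add[symmetric] mult_ac)
    then have "x = Fract (t ^ (Polynomial.order 1 p - Polynomial.order 1 d) * a) b"
      using pd ab0 by (simp add: eq_fract)
    then show ?thesis using value_at_1_Fract[OF ab(2)] by blast
  next
    case False
    then have "d * a = t ^ (Polynomial.order 1 d - Polynomial.order 1 p) * b * p"
      by (subst b(1), subst (2) a(1)) (simp add: power_add[symmetric] mult_ac)
    then have "inverse x = Fract (t ^ (Polynomial.order 1 d - Polynomial.order 1 p) * b) a"
      using inv p ab0 by (simp add: eq_fract)
    then show ?thesis using value_at_1_Fract[OF ab(1)] by metis
  qed
qed

text \<open>The pivot \<open>f s0\<close> is an entry of least order at q = 1. Dividing by it clears
  all poles and makes the pivot entry itself 1, so the limit cannot vanish.\<close>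

lemma normalize_at_1:
  assumes "finite S" "\<exists>s\<in>S. f s \<noteq> 0"
  shows "\<exists>s0\<in>S. f s0 \<noteq> 0 \<and> (\<forall>s\<in>S. \<exists>c. value_at_1 (f s / f s0) c)"
  using assms
proof (induction S rule: finite_induct)
  case (insert s S)
  have self: "value_at_1 (f s / f s) 1" if "f s \<noteq> 0" using that value_at_1_1 by simp
  show ?case
  proof (cases "\<exists>t\<in>S. f t \<noteq> 0")
    case False
    then show ?thesis using insert.prems value_at_1_0 self by (intro bexI[of _ s]) auto
  next
    case True
    then obtain s0 where s0: "s0 \<in> S" "f s0 \<noteq> 0" "\<forall>t\<in>S. \<exists>c. value_at_1 (f t / f s0) c"
      using insert.IH by blast
    show ?thesis
    proof (cases "\<exists>c. value_at_1 (f s / f s0) c")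
      case True
      then show ?thesis using s0(1,2,3) by (intro bexI[of _ s0]) auto
    next
      case False
      \<comment> \<open>A pole of \<open>f s / f s0\<close> means that \<open>f s\<close> has
        smaller order than the old pivot, so \<open>s\<close> becomes the new one.\<close>
      then have fs: "f s \<noteq> 0" using value_at_1_0 by auto
      then obtain c where c: "value_at_1 (f s0 / f s) c"
        using value_at_1_total[of "f s / f s0"] False s0(2) by auto
      have "\<exists>e. value_at_1 (f t / f s) e" if t: "t \<in> S" for t
      proof -
        obtain e where "value_at_1 (f t / f s0) e" using s0(3) t by blast
        from value_at_1_mult[OF this c] show ?thesis using s0(2) by auto
      qed
      then show ?thesis using fs self by auto
    qed
  qed
qed auto

text \<open>Divided by the square of an entry of least order, the relation specializes to a
  vanishing sum of rational squares in which one summand is 1.\<close>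

lemma sum_squares_ratfun:
  fixes f :: "'j \<Rightarrow> ratfun"
  assumes J: "finite J" and sum: "(\<Sum>j\<in>J. f j * f j) = 0"
  shows "\<forall>j\<in>J. f j = 0"
proof (rule ccontr)
  assume "\<not> ?thesis"
  then obtain j0 where j0: "j0 \<in> J" "f j0 \<noteq> 0" "\<forall>j\<in>J. \<exists>c. value_at_1 (f j / f j0) c"
    using normalize_at_1[OF J, of f] by blast
  then obtain g where g: "\<And>j. j \<in> J \<Longrightarrow> value_at_1 (f j / f j0) (g j)" by metis
  have "value_at_1 (\<Sum>j\<in>J. f j / f j0 * (f j / f j0)) (\<Sum>j\<in>J. g j * g j)"
    by (intro value_at_1_sum value_at_1_mult g)
  moreover have "(\<Sum>j\<in>J. f j / f j0 * (f j / f j0)) = (\<Sum>j\<in>J. f j * f j) / (f j0 * f j0)"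
    by (simp add: sum_divide_distrib)
  ultimately have "(\<Sum>j\<in>J. g j * g j) = 0"
    using sum value_at_1_0 value_at_1_unique by auto
  then have "g j0 * g j0 = 0" using J j0(1) by (subst (asm) sum_nonneg_eq_0_iff) auto
  moreover have "g j0 = 1" using g[OF j0(1)] j0(2) value_at_1_1 value_at_1_unique by auto
  ultimately show False by simp
qed

section \<open>The classical limit\<close>

lemma finite_tensor_index [simp]: "finite (tensor_index N r)"
proof -
  have "tensor_index N r = {w. set w \<subseteq> {1..N} \<and> length w = r}" by (auto simp: tensor_index_def)
  then show ?thesis by (simp add: finite_lists_length_eq)
qed

lemma tensor_index_length: "w \<in> tensor_index N r \<Longrightarrow> length w = r"
  by (simp add: tensor_index_def)

lemma tensor_index_nth: "w \<in> tensor_index N r \<Longrightarrow> k < r \<Longrightarrow> w ! k \<in> {1..N}"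
  using nth_mem[of k w] unfolding tensor_index_def by blast

lemma tensor_index_update: "w \<in> tensor_index N r \<Longrightarrow> b \<in> {1..N} \<Longrightarrow> w[k := b] \<in> tensor_index N r"
  using set_update_subset_insert[of w k b] by (auto simp: tensor_index_def)

section \<open>Monomial matrices and placements of matrix units on tensor factors\<close>

text \<open>Placements and signed swaps have at most one nonzero entry in each row, so their
  products amount to composing maps and multiplying coefficients. Where \<open>c w\<close> is 0 the
  target \<open>g w\<close> may lie outside \<open>I\<close>, hence the guarded assumptions
  below.\<close>

definition mono_mat :: "'i set \<Rightarrow> ('i \<Rightarrow> 'k::comm_ring_1) \<Rightarrow> ('i \<Rightarrow> 'i) \<Rightarrow> 'i \<Rightarrow> 'i \<Rightarrow> 'k" where
  "mono_mat I c g w u = (if w \<in> I \<and> u = g w then c w else 0)"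

lemma on_square_mono: "(\<And>w. w \<in> I \<Longrightarrow> c w \<noteq> 0 \<Longrightarrow> g w \<in> I) \<Longrightarrow> on_square I (mono_mat I c g)"
  by (auto simp: on_square_def mono_mat_def)

lemma mm_mono:
  assumes "finite I" "\<And>w. w \<in> I \<Longrightarrow> c w \<noteq> 0 \<Longrightarrow> g w \<in> I"
  shows "mm I (mono_mat I c g) (mono_mat I d h) = mono_mat I (\<lambda>w. c w * d (g w)) (\<lambda>w. h (g w))"
proof (intro ext)
  fix w u
  have "mm I (mono_mat I c g) (mono_mat I d h) w u
      = (\<Sum>v\<in>I. if v = g w then if w \<in> I \<and> u = h (g w) then c w * d (g w) else 0 else 0)"
    unfolding mm_def by (intro sum.cong) (auto simp: mono_mat_def)
  then show "mm I (mono_mat I c g) (mono_mat I d h) w u = mono_mat I (\<lambda>w. c w * d (g w)) (\<lambda>w. h (g w)) w u"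
    using assms by (cases "c w = 0") (auto simp: mono_mat_def)
qed

lemma mono_mat_cong:
  assumes "\<And>w. w \<in> I \<Longrightarrow> c w = d w" "\<And>w. w \<in> I \<Longrightarrow> c w \<noteq> 0 \<Longrightarrow> g w = h w"
  shows "mono_mat I c g = mono_mat I d h"
  using assms unfolding mono_mat_def by (intro ext) metis

text \<open>The matrix unit \<open>v_a \<mapsto> v_b\<close> on tensor factor \<open>k\<close> (counted from \<open>0\<close>), with the grading operator to
  the power of its parity on the factors to its left; with these signs, placements on different factors
  supercommute.\<close>

definition place :: "nat \<Rightarrow> nat \<Rightarrow> nat \<Rightarrow> nat \<Rightarrow> nat \<Rightarrow> nat \<Rightarrow> nat list \<Rightarrow> nat list \<Rightarrow> rat" where
  "place m N r a b k = mono_mat (tensor_index N r)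
     (\<lambda>w. if w ! k = a then (- 1) ^ ((vpar m a + vpar m b) * (\<Sum>j<k. vpar m (w ! j))) else 0)
     (\<lambda>w. w[k := b])"

lemma on_square_place [simp]: "b \<in> {1..N} \<Longrightarrow> on_square (tensor_index N r) (place m N r a b k)"
  unfolding place_def by (intro on_square_mono tensor_index_update)

lemma minus_one_power_cong: "even (a + b) \<Longrightarrow> (- 1 :: 'a::ring_1) ^ a = (- 1) ^ b"
  by (auto simp: minus_one_power_iff)

text \<open>Both signs read the same prefix, and in the sum of their exponents
  \<open>vpar m b\<close> is counted twice, so the sign of the merged unit remains.\<close>

lemma place_mult_same:
  assumes "b \<in> {1..N}" "d \<in> {1..N}" "k < r"
  shows "mm (tensor_index N r) (place m N r a b k) (place m N r b' d k)
    = (if b = b' then place m N r a d k else (\<lambda>w u. 0))"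
proof -
  have P: "(\<Sum>j<k. vpar m (w[k := b] ! j)) = (\<Sum>j<k. vpar m (w ! j))" for w
    by (intro sum.cong) auto
  have "mm (tensor_index N r) (place m N r a b k) (place m N r b' d k)
     = mono_mat (tensor_index N r) (\<lambda>w. if b = b' \<and> w ! k = a then
         (- 1) ^ ((vpar m a + vpar m d) * (\<Sum>j<k. vpar m (w ! j))) else 0) (\<lambda>w. w[k := d])"
    unfolding place_def
    by (subst mm_mono) (use assms in \<open>auto simp: tensor_index_update P tensor_index_length
      simp flip: power_add intro!: mono_mat_cong minus_one_power_cong\<close>)
  also have "\<dots> = (if b = b' then place m N r a d k else (\<lambda>w u. 0))"
    by (auto simp: place_def mono_mat_def fun_eq_iff)
  finally show ?thesis .
qed

lemma place_commute_less:
  assumes "b \<in> {1..N}" "d \<in> {1..N}" "k < r" "l < r" "k < l"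
  shows "mm (tensor_index N r) (place m N r a b k) (place m N r c d l)
    = (\<lambda>w u. (- 1) ^ ((vpar m a + vpar m b) * (vpar m c + vpar m d)) *
        mm (tensor_index N r) (place m N r c d l) (place m N r a b k) w u)"
proof -
  have P: "(\<Sum>j<k. vpar m (w[l := d] ! j)) = (\<Sum>j<k. vpar m (w ! j))" for w
    using assms by (intro sum.cong) auto
  \<comment> \<open>Only the placement on the right factor \<open>l\<close> sees the other one: the
    letter \<open>a\<close> at \<open>k\<close> in its prefix has become \<open>b\<close>. This
    change of the prefix parity produces the Koszul sign.\<close>
  have Q: "even ((\<Sum>j<l. vpar m (w[k := b] ! j)) + (\<Sum>j<l. vpar m (w ! j)) + (vpar m a + vpar m b))"
    if w: "w \<in> tensor_index N r" "w ! k = a" for w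
  proof -
    have split: "{..<l} = insert k ({..<l} - {k})" using assms by auto
    have s1: "(\<Sum>j<l. vpar m (w[k := b] ! j)) = vpar m b + (\<Sum>j\<in>{..<l} - {k}. vpar m (w ! j))"
      using w assms tensor_index_length[OF w(1)] by (subst split, subst sum.insert) (auto intro!: sum.cong)
    have s2: "(\<Sum>j<l. vpar m (w ! j)) = vpar m a + (\<Sum>j\<in>{..<l} - {k}. vpar m (w ! j))"
      using w assms by (subst split, subst sum.insert) auto
    have "\<And>x y z :: nat. even ((x + z) + (y + z) + (y + x))" by presburger
    then show ?thesis unfolding s1 s2 .
  qed
  have sgn: "(- 1 :: rat) ^ ((vpar m c + vpar m d) * (\<Sum>j<l. vpar m (w[k := b] ! j)))
    = (- 1) ^ ((vpar m a + vpar m b) * (vpar m c + vpar m d)) * (- 1) ^ ((vpar m c + vpar m d) * (\<Sum>j<l. vpar m (w ! j)))"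
    if w: "w \<in> tensor_index N r" "w ! k = a" for w
    unfolding power_add[symmetric] by (rule minus_one_power_cong) (use Q[OF w] in auto)
  have "mm (tensor_index N r) (place m N r a b k) (place m N r c d l)
     = mono_mat (tensor_index N r) (\<lambda>w. if w ! k = a \<and> w ! l = c then
          (- 1) ^ ((vpar m a + vpar m b) * (\<Sum>j<k. vpar m (w ! j))) *
          (- 1) ^ ((vpar m c + vpar m d) * (\<Sum>j<l. vpar m (w[k := b] ! j))) else 0) (\<lambda>w. w[k := b, l := d])"
    unfolding place_def
    by (subst mm_mono) (use assms in \<open>auto simp: tensor_index_update tensor_index_length intro!: mono_mat_cong\<close>)
  also have "\<dots> = mono_mat (tensor_index N r) (\<lambda>w. (- 1) ^ ((vpar m a + vpar m b) * (vpar m c + vpar m d)) *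
        (if w ! l = c \<and> w ! k = a then
          (- 1) ^ ((vpar m c + vpar m d) * (\<Sum>j<l. vpar m (w ! j))) *
          (- 1) ^ ((vpar m a + vpar m b) * (\<Sum>j<k. vpar m (w[l := d] ! j))) else 0)) (\<lambda>w. w[l := d, k := b])"
    by (rule mono_mat_cong) (use assms in \<open>auto simp: P sgn list_update_swap\<close>)
  also have "\<dots> = (\<lambda>w u. (- 1) ^ ((vpar m a + vpar m b) * (vpar m c + vpar m d)) *
        mm (tensor_index N r) (place m N r c d l) (place m N r a b k) w u)"
    unfolding place_def
    by (subst mm_mono) (use assms in \<open>auto simp: tensor_index_update tensor_index_length mono_mat_def fun_eq_iff\<close>)
  finally show ?thesis .
qed

lemma place_commute:
  assumes "b \<in> {1..N}" "d \<in> {1..N}" "k < r" "l < r" "k \<noteq> l"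
  shows "mm (tensor_index N r) (place m N r a b k) (place m N r c d l)
    = (\<lambda>w u. (- 1) ^ ((vpar m a + vpar m b) * (vpar m c + vpar m d)) *
        mm (tensor_index N r) (place m N r c d l) (place m N r a b k) w u)"
proof (cases "k < l")
  case True
  then show ?thesis by (rule place_commute_less[OF assms(1-4)])
next
  case False
  then have "l < k" using assms by simp
  note * = place_commute_less[OF assms(2,1,4,3) this, of m c a]
  have "((- 1) ^ ((vpar m a + vpar m b) * (vpar m c + vpar m d)) :: rat) *
      (- 1) ^ ((vpar m c + vpar m d) * (vpar m a + vpar m b)) = 1"
    by (simp add: mult.commute flip: power_add)
  then show ?thesis unfolding * mult.assoc[symmetric] by simp
qed

text \<open>The action of the matrix unit v_a -> v_b of gl(m|n) on the tensor power, given by the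
  graded Leibniz rule.\<close>

definition total_place :: "nat \<Rightarrow> nat \<Rightarrow> nat \<Rightarrow> nat \<Rightarrow> nat \<Rightarrow> nat list \<Rightarrow> nat list \<Rightarrow> rat" where
  "total_place m N r a b = (\<lambda>w u. \<Sum>k<r. place m N r a b k w u)"

text \<open>Placements on different factors supercommute and cancel, so only equal factors
  contribute; there the reversed product vanishes because \<open>a\<close> differs from
  \<open>c\<close>.\<close>

lemma total_place_commutator:
  assumes "b \<in> {1..N}" "c \<in> {1..N}" "a \<noteq> c"
  shows "total_place m N r a c = (\<lambda>w u.
      mm (tensor_index N r) (total_place m N r a b) (total_place m N r b c) w u
      - (- 1) ^ ((vpar m a + vpar m b) * (vpar m b + vpar m c)) *
        mm (tensor_index N r) (total_place m N r b c) (total_place m N r a b) w u)"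
proof (intro ext)
  fix w u
  let ?s = "(- 1 :: rat) ^ ((vpar m a + vpar m b) * (vpar m b + vpar m c))"
  let ?p = "place m N r a b" and ?p' = "place m N r b c"
  have "mm (tensor_index N r) (?p k) (?p' l) w u - ?s * mm (tensor_index N r) (?p' l) (?p k) w u
      = (if l = k then place m N r a c k w u else 0)" if "k < r" "l < r" for k l
  proof (cases "k = l")
    case True
    then show ?thesis using that assms by (simp add: place_mult_same)
  next
    case False
    then show ?thesis using place_commute[OF assms(1,2) that, of m a b] by simp
  qed
  then have "(\<Sum>k<r. \<Sum>l<r. mm (tensor_index N r) (?p k) (?p' l) w u
      - ?s * mm (tensor_index N r) (?p' l) (?p k) w u) = (\<Sum>k<r. \<Sum>l<r. if l = k then place m N r a c k w u else 0)"
    by (intro sum.cong refl) auto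
  also have "\<dots> = total_place m N r a c w u"
    by (simp add: total_place_def)
  finally show "total_place m N r a c w u = mm (tensor_index N r) (total_place m N r a b) (total_place m N r b c) w u
      - ?s * mm (tensor_index N r) (total_place m N r b c) (total_place m N r a b) w u"
    unfolding total_place_def mm_sum sum_subtractf sum_distrib_left
    by (subst (asm) (2) sum.swap) (simp add: sum_distrib_left)
qed

section \<open>Symmetrized products of placements\<close>

fun place_prod :: "nat \<Rightarrow> nat \<Rightarrow> nat \<Rightarrow> (nat \<times> nat) list \<Rightarrow> nat list \<Rightarrow> nat list \<Rightarrow> nat list \<Rightarrow> rat" where
  "place_prod m N r (X # Xs) (k # f) =
     mm (tensor_index N r) (place m N r (fst X) (snd X) k) (place_prod m N r Xs f)"
| "place_prod m N r _ _ = mat_one (tensor_index N r)"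

lemma on_square_place_prod: "snd ` set Xs \<subseteq> {1..N} \<Longrightarrow> on_square (tensor_index N r) (place_prod m N r Xs f)"
  by (induction m N r Xs f rule: place_prod.induct) auto

definition arrangements :: "nat \<Rightarrow> nat \<Rightarrow> nat list set" where
  "arrangements r s = {f. length f = s \<and> distinct f \<and> set f \<subseteq> {..<r}}"

text \<open>The graded analogue of a symmetrized tensor: the units of \<open>Xs\<close> are put on
  distinct factors in all ways, and the order of multiplication carries the Koszul signs. A list of
  length \<open>r\<close> fills every factor.\<close>

definition sym_prod :: "nat \<Rightarrow> nat \<Rightarrow> nat \<Rightarrow> (nat \<times> nat) list \<Rightarrow> nat list \<Rightarrow> nat list \<Rightarrow> rat" where
  "sym_prod m N r Xs = (\<lambda>w u. \<Sum>f\<in>arrangements r (length Xs). place_prod m N r Xs f w u)"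

lemma finite_arrangements [simp]: "finite (arrangements r s)"
  by (rule finite_subset[OF _ finite_lists_length_eq[of "{..<r}" s]]) (auto simp: arrangements_def)

text \<open>A unit placed on an occupied factor is moved past the earlier placements at the price of
  Koszul signs and then merges with the unit found there, or kills the product. Neither outcome
  depends on which factors \<open>f\<close> names, so one constant \<open>c\<close> serves all
  arrangements and can leave the sum over \<open>f\<close>.\<close>

lemma place_place_prod:
  assumes "b \<in> {1..N}" "snd ` set Xs \<subseteq> {1..N}" "i < length Xs"
  shows "\<exists>c. \<forall>f\<in>arrangements r (length Xs).
    mm (tensor_index N r) (place m N r a b (f ! i)) (place_prod m N r Xs f)
      = (\<lambda>w u. c * place_prod m N r (Xs[i := (a, snd (Xs ! i))]) f w u)"
  using assms(2,3)
proof (induction Xs arbitrary: i)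
  case (Cons X Xs)
  have tl: "f \<in> arrangements r (length Xs)" "k < r" "k \<notin> set f" if "k # f \<in> arrangements r (length (X # Xs))" for k f
    using that by (auto simp: arrangements_def)
  have hd: "\<exists>k g. f = k # g" if "f \<in> arrangements r (length (X # Xs))" for f
    using that by (cases f) (auto simp: arrangements_def)
  have X: "snd X \<in> {1..N}" using Cons.prems by auto
  show ?case
  proof (cases i)
    case 0
    have "mm (tensor_index N r) (place m N r a b k) (place_prod m N r (X # Xs) (k # f))
      = (\<lambda>w u. of_bool (b = fst X) * place_prod m N r ((a, snd X) # Xs) (k # f) w u)"
      if "k # f \<in> arrangements r (length (X # Xs))" for k f
      using tl[OF that] assms(1) X
      by (auto simp: mm_assoc[symmetric] place_mult_same) (simp add: mm_def fun_eq_iff)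
    then show ?thesis using 0 hd
      by (intro exI[of _ "of_bool (b = fst X)"] ballI) (metis list_update_code(2) nth_Cons_0)
  next
    case (Suc j)
    obtain c where c: "\<And>f. f\<in>arrangements r (length Xs) \<Longrightarrow>
      mm (tensor_index N r) (place m N r a b (f ! j)) (place_prod m N r Xs f)
      = (\<lambda>w u. c * place_prod m N r (Xs[j := (a, snd (Xs ! j))]) f w u)"
      using Cons.IH[of j] Cons.prems Suc by auto
    define s where "s = (- 1 :: rat) ^ ((vpar m a + vpar m b) * (vpar m (fst X) + vpar m (snd X)))"
    have "mm (tensor_index N r) (place m N r a b (f ! j)) (place_prod m N r (X # Xs) (k # f))
      = (\<lambda>w u. (s * c) * place_prod m N r (X # Xs[j := (a, snd (Xs ! j))]) (k # f) w u)"
      if f: "k # f \<in> arrangements r (length (X # Xs))" for k f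
    proof -
      have "f ! j \<in> set f" using f Suc Cons.prems by (auto simp: arrangements_def)
      then have *: "f ! j < r" "f ! j \<noteq> k" using f by (auto simp: arrangements_def)
      have "mm (tensor_index N r) (place m N r a b (f ! j)) (place_prod m N r (X # Xs) (k # f))
          = mm (tensor_index N r) (\<lambda>w u. s * mm (tensor_index N r) (place m N r (fst X) (snd X) k) (place m N r a b (f ! j)) w u)
              (place_prod m N r Xs f)"
        using place_commute[OF assms(1) X *(1) tl(2)[OF f] *(2), of m a "fst X"]
        by (simp add: mm_assoc[symmetric] s_def)
      also have "\<dots> = (\<lambda>w u. s * mm (tensor_index N r) (place m N r (fst X) (snd X) k)
          (mm (tensor_index N r) (place m N r a b (f ! j)) (place_prod m N r Xs f)) w u)"
        by (simp only: mm_scale mm_assoc)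
      also have "\<dots> = (\<lambda>w u. (s * c) * place_prod m N r (X # Xs[j := (a, snd (Xs ! j))]) (k # f) w u)"
        by (simp add: c[OF tl(1)[OF f]] mm_scale mult.assoc)
      finally show ?thesis .
    qed
    then show ?thesis using Suc hd
      by (intro exI[of _ "s * c"] ballI) (metis list_update_code(3) nth_Cons_Suc)
  qed
qed simp

lemma sum_arrangements_Suc:
  "(\<Sum>f\<in>arrangements r (Suc s). g f) = (\<Sum>f\<in>arrangements r s. \<Sum>k\<in>{..<r} - set f. g (k # f))"
  for g :: "nat list \<Rightarrow> 'a::comm_monoid_add"
proof -
  have "(\<Sum>f\<in>arrangements r s. \<Sum>k\<in>{..<r} - set f. g (k # f))
      = (\<Sum>p\<in>(SIGMA f:arrangements r s. {..<r} - set f). g (snd p # fst p))"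
    by (subst sum.Sigma) (auto simp: split_beta)
  also have "\<dots> = (\<Sum>f\<in>arrangements r (Suc s). g f)"
  proof (rule sum.reindex_bij_witness[of _ "\<lambda>f. (tl f, hd f)" "\<lambda>p. snd p # fst p"])
    fix f assume "f \<in> arrangements r (Suc s)"
    then show "snd (tl f, hd f) # fst (tl f, hd f) = f" "(tl f, hd f) \<in> (SIGMA f:arrangements r s. {..<r} - set f)"
      by (cases f; auto simp: arrangements_def)+
  qed (auto simp: arrangements_def)
  finally show ?thesis by simp
qed

text \<open>Multiplying \<open>sym_prod Xs\<close> by \<open>total_place\<close> of a new matrix unit either puts the unit on an
  unused tensor factor or merges it with one of the units of \<open>Xs\<close>.\<close>

lemma sym_prod_in_malg:
  assumes G: "\<And>a b. a \<in> {1..N} \<Longrightarrow> b \<in> {1..N} \<Longrightarrow> total_place m N r a b \<in> malg (tensor_index N r) G"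
    and "set Xs \<subseteq> {1..N} \<times> {1..N}"
  shows "sym_prod m N r Xs \<in> malg (tensor_index N r) G"
  using assms(2)
\<comment> \<open>Induction on the length, since merging yields lists as long as the tail of
  \<open>Xs\<close> but with changed entries.\<close>
proof (induction "length Xs" arbitrary: Xs)
  case 0
  then have "arrangements r (length Xs) = {[]}" by (auto simp: arrangements_def)
  then have "sym_prod m N r Xs = mat_one (tensor_index N r)" using 0 by (simp add: sym_prod_def)
  then show ?case by (simp add: malg.one)
next
  case (Suc s)
  then obtain a b Ys where Xs: "Xs = (a, b) # Ys" by (cases Xs) auto
  have s: "s = length Ys" and ab: "a \<in> {1..N}" "b \<in> {1..N}" and Ys: "set Ys \<subseteq> {1..N} \<times> {1..N}"
    using Suc Xs by auto
  have "\<forall>i\<in>{..<s}. \<exists>c. \<forall>f\<in>arrangements r (length Ys).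
    mm (tensor_index N r) (place m N r a b (f ! i)) (place_prod m N r Ys f)
      = (\<lambda>w u. c * place_prod m N r (Ys[i := (a, snd (Ys ! i))]) f w u)"
  proof
    fix i assume "i \<in> {..<s}"
    moreover have "snd ` set Ys \<subseteq> {1..N}" using Ys by auto
    ultimately show "\<exists>c. \<forall>f\<in>arrangements r (length Ys).
        mm (tensor_index N r) (place m N r a b (f ! i)) (place_prod m N r Ys f)
          = (\<lambda>w u. c * place_prod m N r (Ys[i := (a, snd (Ys ! i))]) f w u)"
      using place_place_prod[OF ab(2)] s by auto
  qed
  then obtain c where c: "\<And>i f. i < s \<Longrightarrow> f \<in> arrangements r s \<Longrightarrow>
      mm (tensor_index N r) (place m N r a b (f ! i)) (place_prod m N r Ys f)
      = (\<lambda>w u. c i * place_prod m N r (Ys[i := (a, snd (Ys ! i))]) f w u)"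
    unfolding bchoice_iff s by auto
  let ?P = "\<lambda>k f w u. mm (tensor_index N r) (place m N r a b k) (place_prod m N r Ys f) w u"
  have "mm (tensor_index N r) (total_place m N r a b) (sym_prod m N r Ys) w u
     = sym_prod m N r Xs w u + (\<Sum>i<s. c i * sym_prod m N r (Ys[i := (a, snd (Ys ! i))]) w u)" for w u
  proof -
    have split: "(\<Sum>k<r. ?P k f w u) = (\<Sum>k\<in>{..<r} - set f. ?P k f w u)
        + (\<Sum>i<s. c i * place_prod m N r (Ys[i := (a, snd (Ys ! i))]) f w u)"
      if f: "f \<in> arrangements r s" for f
    proof -
      have "(\<Sum>k<r. ?P k f w u) = (\<Sum>k\<in>{..<r} - set f. ?P k f w u) + (\<Sum>k\<in>set f. ?P k f w u)"
        using f by (intro sum.subset_diff) (auto simp: arrangements_def)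
      also have "(\<Sum>k\<in>set f. ?P k f w u) = (\<Sum>i<s. ?P (f ! i) f w u)"
        using f by (intro sum.reindex_bij_betw[symmetric] bij_betw_nth) (auto simp: arrangements_def)
      finally show ?thesis using c[OF _ f] by simp
    qed
    have "mm (tensor_index N r) (total_place m N r a b) (sym_prod m N r Ys) w u
        = (\<Sum>f\<in>arrangements r s. \<Sum>k<r. ?P k f w u)"
      unfolding total_place_def sym_prod_def mm_sum s by (rule sum.swap)
    also have "\<dots> = (\<Sum>f\<in>arrangements r s. \<Sum>k\<in>{..<r} - set f. ?P k f w u)
        + (\<Sum>f\<in>arrangements r s. \<Sum>i<s. c i * place_prod m N r (Ys[i := (a, snd (Ys ! i))]) f w u)"
      by (simp add: split sum.distrib)
    also have "(\<Sum>f\<in>arrangements r s. \<Sum>k\<in>{..<r} - set f. ?P k f w u) = sym_prod m N r Xs w u"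
      using sum_arrangements_Suc[of "\<lambda>f. place_prod m N r Xs f w u" r s] by (simp add: sym_prod_def Xs s)
    also have "(\<Sum>f\<in>arrangements r s. \<Sum>i<s. c i * place_prod m N r (Ys[i := (a, snd (Ys ! i))]) f w u)
        = (\<Sum>i<s. c i * sym_prod m N r (Ys[i := (a, snd (Ys ! i))]) w u)"
      unfolding sym_prod_def sum_distrib_left by (subst sum.swap) (simp add: s)
    finally show ?thesis .
  qed
  \<comment> \<open>Solved for the longest product: everything on the right involves only lists of
    length \<open>s\<close>.\<close>
  then have "sym_prod m N r Xs = (\<lambda>w u. mm (tensor_index N r) (total_place m N r a b) (sym_prod m N r Ys) w u
      - (\<Sum>i<s. c i * sym_prod m N r (Ys[i := (a, snd (Ys ! i))]) w u))"
    by (simp add: fun_eq_iff)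
  moreover have "sym_prod m N r (Ys[i := (a, snd (Ys ! i))]) \<in> malg (tensor_index N r) G" if "i < s" for i
  proof (rule Suc.hyps(1))
    have "Ys ! i \<in> {1..N} \<times> {1..N}" using that Ys s by auto
    then show "set (Ys[i := (a, snd (Ys ! i))]) \<subseteq> {1..N} \<times> {1..N}"
      using Ys ab set_update_subset_insert[of Ys i "(a, snd (Ys ! i))"] by auto
  qed (simp add: s)
  moreover have "sym_prod m N r Ys \<in> malg (tensor_index N r) G"
    using Suc.hyps(1)[OF s Ys] .
  ultimately show ?case
    by (auto intro!: malg_diff malg_sum malg.scale malg.mult G ab)
qed


text \<open>Placements on the factors from \<open>k\<close> on test the tail of a word against
  \<open>w\<close> and overwrite it by that of \<open>u\<close>; their signs depend on the untouched
  prefix, whence the function \<epsilon>. At \<open>k = 0\<close> a nonzero multiple of a matrix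
  unit is left, so products of placements span all matrices.\<close>

lemma place_prod_unit:
  assumes w: "w \<in> tensor_index N r" and u: "u \<in> tensor_index N r" and "k \<le> r"
  shows "\<exists>\<epsilon>. (\<forall>v. \<epsilon> v \<noteq> 0) \<and> place_prod m N r (zip (drop k w) (drop k u)) [k..<r]
    = mono_mat (tensor_index N r) (\<lambda>v. if drop k v = drop k w then \<epsilon> v else 0) (\<lambda>v. take k v @ drop k u)"
  using assms(3)
proof (induction rule: inc_induct)
  case base
  show ?case
    by (intro exI[of _ "\<lambda>_. 1"])
      (use w u in \<open>auto simp: tensor_index_length mono_mat_def mat_one_def fun_eq_iff\<close>)
next
  case (step k)
  let ?I = "tensor_index N r"
  obtain \<epsilon> where \<epsilon>: "\<forall>v. \<epsilon> v \<noteq> 0"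
    and eq: "place_prod m N r (zip (drop (Suc k) w) (drop (Suc k) u)) [Suc k..<r]
    = mono_mat ?I (\<lambda>v. if drop (Suc k) v = drop (Suc k) w then \<epsilon> v else 0) (\<lambda>v. take (Suc k) v @ drop (Suc k) u)"
    using step.IH by blast
  have dw: "drop k v = v ! k # drop (Suc k) v" if "v \<in> ?I" for v
    using step that by (simp add: tensor_index_length Cons_nth_drop_Suc)
  have "place_prod m N r (zip (drop k w) (drop k u)) [k..<r]
    = mm ?I (place m N r (w ! k) (u ! k) k) (place_prod m N r (zip (drop (Suc k) w) (drop (Suc k) u)) [Suc k..<r])"
    using step w u by (simp add: dw upt_conv_Cons)
  also have "\<dots> = mono_mat ?I (\<lambda>v. if drop k v = drop k w then
      (- 1) ^ ((vpar m (w ! k) + vpar m (u ! k)) * (\<Sum>j<k. vpar m (v ! j))) * \<epsilon> (v[k := u ! k]) else 0)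
      (\<lambda>v. take k v @ drop k u)"
    unfolding eq place_def
    by (subst mm_mono) (use step w u tensor_index_nth[OF u] in \<open>auto simp: tensor_index_update tensor_index_length dw
      take_Suc_conv_app_nth intro!: mono_mat_cong\<close>)
  finally show ?case using \<epsilon>
    by (intro exI[of _ "\<lambda>v. (- 1) ^ ((vpar m (w ! k) + vpar m (u ! k)) * (\<Sum>j<k. vpar m (v ! j))) * \<epsilon> (v[k := u ! k])"]) auto
qed

section \<open>Signed swaps and permutations of the tensor factors\<close>

definition swap_ix :: "nat \<Rightarrow> nat list \<Rightarrow> nat list" where
  "swap_ix i w = w[i - 1 := w ! i, i := w ! (i - 1)]"

text \<open>The value of T_i at q = 1; on two equal odd letters it acts by -1.\<close>

definition sign_swap :: "nat \<Rightarrow> nat \<Rightarrow> nat \<Rightarrow> nat \<Rightarrow> nat list \<Rightarrow> nat list \<Rightarrow> rat" where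
  "sign_swap m N r i = mono_mat (tensor_index N r)
     (\<lambda>w. (- 1) ^ (vpar m (w ! (i - 1)) * vpar m (w ! i))) (swap_ix i)"

lemma tensor_index_swap: "w \<in> tensor_index N r \<Longrightarrow> i \<in> {1..<r} \<Longrightarrow> swap_ix i w \<in> tensor_index N r"
  unfolding swap_ix_def by (intro tensor_index_update tensor_index_nth) auto

lemma swap_ix_nth:
  assumes "w \<in> tensor_index N r" "i \<in> {1..<r}" "j < r"
  shows "swap_ix i w ! j = w ! (Transposition.transpose (i - 1) i j)"
  using assms by (auto simp: swap_ix_def nth_list_update Transposition.transpose_def tensor_index_length)

lemma sign_swap_square:
  assumes "i \<in> {1..<r}"
  shows "mm (tensor_index N r) (sign_swap m N r i) (sign_swap m N r i) = mat_one (tensor_index N r)"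
proof -
  have "swap_ix i (swap_ix i w) = w" if "w \<in> tensor_index N r" for w
    using that assms by (intro nth_equalityI) (auto simp: tensor_index_swap tensor_index_length swap_ix_def nth_list_update)
  moreover have "swap_ix i w ! (i - 1) = w ! i" "swap_ix i w ! i = w ! (i - 1)" if "w \<in> tensor_index N r" for w
    using that assms by (auto simp: swap_ix_nth)
  ultimately have "mm (tensor_index N r) (sign_swap m N r i) (sign_swap m N r i)
    = mono_mat (tensor_index N r) (\<lambda>_. 1) (\<lambda>w. w)"
    unfolding sign_swap_def using assms
    by (subst mm_mono) (auto intro!: mono_mat_cong simp: tensor_index_swap mult.commute simp flip: power_add)
  also have "\<dots> = mat_one (tensor_index N r)" by (auto simp: mono_mat_def mat_one_def fun_eq_iff)
  finally show ?thesis .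
qed

lemma on_square_sign_swap: "i \<in> {1..<r} \<Longrightarrow> on_square (tensor_index N r) (sign_swap m N r i)"
  unfolding sign_swap_def by (intro on_square_mono tensor_index_swap)

text \<open>Exchanging two adjacent factors leaves the prefix of \<open>k\<close> alone or permutes
  it, unless \<open>k\<close> is one of the two; then the extra letter in the longer prefix is
  compensated by the changed sign of the swap itself.\<close>

lemma sign_swap_place:
  assumes i: "i \<in> {1..<r}" and b: "b \<in> {1..N}" and k: "k < r"
  shows "mm (tensor_index N r) (sign_swap m N r i) (place m N r a b k)
    = mm (tensor_index N r) (place m N r a b (Transposition.transpose (i - 1) i k)) (sign_swap m N r i)"
proof -
  let ?t = "Transposition.transpose (i - 1) i" and ?I = "tensor_index N r"
  have t: "?t k < r" using i k by (auto simp: Transposition.transpose_def)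
  have lists: "(swap_ix i w)[k := b] = swap_ix i (w[?t k := b])" if "w \<in> ?I" for w
    using that i k by (intro nth_equalityI)
      (auto simp: swap_ix_nth tensor_index_update tensor_index_length swap_ix_def nth_list_update Transposition.transpose_def)
  have sgn: "even ((vpar m (w ! (i - 1)) * vpar m (w ! i) + (vpar m a + vpar m b) * (\<Sum>j<k. vpar m (swap_ix i w ! j)))
     + ((vpar m a + vpar m b) * (\<Sum>j<?t k. vpar m (w ! j)) +
        vpar m (w[?t k := b] ! (i - 1)) * vpar m (w[?t k := b] ! i)))" if w: "w \<in> ?I" "w ! ?t k = a" for w
  proof -
    have len: "length w = r" using w by (simp add: tensor_index_length)
    consider "k < i - 1" | "k = i - 1" | "k = i" | "k > i" by linarith
    then show ?thesis
    proof cases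
      case 1
      then have tk: "?t k = k" by (auto simp: Transposition.transpose_def)
      have "(\<Sum>j<k. vpar m (swap_ix i w ! j)) = (\<Sum>j<k. vpar m (w ! j))"
        using 1 w k i by (intro sum.cong) (auto simp: swap_ix_nth[OF w(1)] Transposition.transpose_def)
      moreover have "w[k := b] ! (i - 1) = w ! (i - 1)" "w[k := b] ! i = w ! i" using 1 by auto
      ultimately show ?thesis unfolding tk by (metis add.commute even_add)
    next
      case 2
      then have tk: "?t k = i" and k': "i = Suc k" using i by (auto simp: Transposition.transpose_def)
      have "(\<Sum>j<k. vpar m (swap_ix i w ! j)) = (\<Sum>j<k. vpar m (w ! j))"
        using 2 w k i by (intro sum.cong) (auto simp: swap_ix_nth[OF w(1)] Transposition.transpose_def)
      then show ?thesis using w(2) len i unfolding tk k' by (simp add: algebra_simps)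
    next
      case 3
      then have tk: "?t k = i - 1" and k': "i = Suc (i - 1)" using i by (auto simp: Transposition.transpose_def)
      have "(\<Sum>j<i - 1. vpar m (swap_ix i w ! j)) = (\<Sum>j<i - 1. vpar m (w ! j))"
        using 3 w k i by (intro sum.cong) (auto simp: swap_ix_nth[OF w(1)] Transposition.transpose_def)
      moreover have "(\<Sum>j<i. vpar m (swap_ix i w ! j)) = (\<Sum>j<i - 1. vpar m (swap_ix i w ! j)) + vpar m (w ! i)"
        using sum.lessThan_Suc[of "\<lambda>j. vpar m (swap_ix i w ! j)" "i - 1"] k' swap_ix_nth[OF w(1) i, of "i - 1"] i
        by (metis (no_types, lifting) atLeastLessThan_iff less_imp_diff_less transpose_apply_first)
      moreover have "w[i - 1 := b] ! (i - 1) = b" "w[i - 1 := b] ! i = w ! i" using len i by auto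
      ultimately show ?thesis using w(2) len i unfolding tk 3 by (simp add: algebra_simps)
    next
      case 4
      then have tk: "?t k = k" by (auto simp: Transposition.transpose_def)
      have "(\<Sum>j<k. vpar m (swap_ix i w ! j)) = (\<Sum>j<k. vpar m (w ! ?t j))"
        using 4 w k i by (intro sum.cong) (auto simp: swap_ix_nth[OF w(1)])
      \<comment> \<open>The prefix contains both swapped positions, so its letters are merely
        permuted.\<close>
      also have "\<dots> = (\<Sum>j<k. vpar m (w ! j))"
        by (rule sum.permute[OF permutes_swap_id, unfolded comp_def, symmetric]) (use 4 in auto)
      finally have "(\<Sum>j<k. vpar m (swap_ix i w ! j)) = (\<Sum>j<k. vpar m (w ! j))" .
      moreover have "w[k := b] ! (i - 1) = w ! (i - 1)" "w[k := b] ! i = w ! i" using 4 by auto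
      ultimately show ?thesis unfolding tk by (metis add.commute even_add)
    qed
  qed
  have "mm ?I (sign_swap m N r i) (place m N r a b k) = mono_mat ?I
    (\<lambda>w. (- 1) ^ (vpar m (w ! (i - 1)) * vpar m (w ! i)) * (if swap_ix i w ! k = a then
       (- 1) ^ ((vpar m a + vpar m b) * (\<Sum>j<k. vpar m (swap_ix i w ! j))) else 0)) (\<lambda>w. (swap_ix i w)[k := b])"
    unfolding sign_swap_def place_def by (subst mm_mono) (auto simp: tensor_index_swap[OF _ i])
  also have "\<dots> = mono_mat ?I (\<lambda>w. (if w ! ?t k = a then
       (- 1) ^ ((vpar m a + vpar m b) * (\<Sum>j<?t k. vpar m (w ! j))) else 0)
       * (- 1) ^ (vpar m (w[?t k := b] ! (i - 1)) * vpar m (w[?t k := b] ! i))) (\<lambda>w. swap_ix i (w[?t k := b]))"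
  proof (rule mono_mat_cong)
    fix w assume w: "w \<in> ?I"
    show "(- 1 :: rat) ^ (vpar m (w ! (i - 1)) * vpar m (w ! i)) * (if swap_ix i w ! k = a then
       (- 1) ^ ((vpar m a + vpar m b) * (\<Sum>j<k. vpar m (swap_ix i w ! j))) else 0)
      = (if w ! ?t k = a then (- 1) ^ ((vpar m a + vpar m b) * (\<Sum>j<?t k. vpar m (w ! j))) else 0)
       * (- 1) ^ (vpar m (w[?t k := b] ! (i - 1)) * vpar m (w[?t k := b] ! i))"
    proof (cases "w ! ?t k = a")
      case True
      then show ?thesis
        using minus_one_power_cong[OF sgn[OF w True]] by (simp only: swap_ix_nth[OF w i k] power_add simp_thms if_True)
    next
      case False
      then show ?thesis by (simp only: swap_ix_nth[OF w i k] if_False mult_zero_left mult_zero_right)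
    qed
  qed (rule lists)
  also have "\<dots> = mm ?I (place m N r a b (?t k)) (sign_swap m N r i)"
    unfolding sign_swap_def place_def by (subst mm_mono) (auto simp: tensor_index_update[OF _ b])
  finally show ?thesis .
qed

lemma sign_swap_place_prod:
  assumes i: "i \<in> {1..<r}" and "length f = length Xs" "set f \<subseteq> {..<r}" "snd ` set Xs \<subseteq> {1..N}"
  shows "mm (tensor_index N r) (sign_swap m N r i) (place_prod m N r Xs f)
    = mm (tensor_index N r) (place_prod m N r Xs (map (Transposition.transpose (i - 1) i) f)) (sign_swap m N r i)"
  using assms(2-)
proof (induction f Xs rule: list_induct2)
  case Nil
  then show ?case using on_square_sign_swap[OF i, of N m] by simp
next
  case (Cons k f X Xs)
  have IH: "mm (tensor_index N r) (sign_swap m N r i) (place_prod m N r Xs f)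
    = mm (tensor_index N r) (place_prod m N r Xs (map (Transposition.transpose (i - 1) i) f)) (sign_swap m N r i)"
    using Cons by auto
  have X: "snd X \<in> {1..N}" "k < r" using Cons.prems by auto
  show ?case
    by (simp only: place_prod.simps list.map mm_assoc IH[symmetric])
      (simp only: mm_assoc[symmetric] sign_swap_place[OF i X])
qed

text \<open>The transposition (a b) is the conjugate of (a b-1) by the adjacent transposition (b-1
  b), and \<open>Q\<close> survives each of these three left factors.\<close>

lemma transposition_from_adjacent:
  fixes Q :: "(nat \<Rightarrow> nat) \<Rightarrow> bool"
  assumes adj: "\<And>i p. i \<in> {1..<r} \<Longrightarrow> Q p \<Longrightarrow> Q (Transposition.transpose (i - 1) i \<circ> p)"
    and "a < b" "b < r" "Q p"
  shows "Q (Transposition.transpose a b \<circ> p)"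
  using assms(2-4)
proof (induction b arbitrary: p rule: less_induct)
  case (less b)
  show ?case
  proof (cases "a = b - 1")
    case True
    have "b \<in> {1..<r}" using less.prems by auto
    from adj[OF this less.prems(3)] show ?thesis by (simp only: True)
  next
    case False
    let ?t = "Transposition.transpose (b - 1) b"
    have "Q (?t \<circ> (Transposition.transpose a (b - 1) \<circ> (?t \<circ> p)))"
      using less False by (intro adj less.IH) auto
    also have "?t \<circ> (Transposition.transpose a (b - 1) \<circ> (?t \<circ> p)) = Transposition.transpose a b \<circ> p"
      using less.prems False by (auto simp: fun_eq_iff Transposition.transpose_def)
    finally show ?thesis .
  qed
qed

lemma permutes_from_adjacent:
  fixes r :: nat and Q :: "(nat \<Rightarrow> nat) \<Rightarrow> bool"
  assumes p: "p permutes {..<r}" and id: "Q id"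
    and adj: "\<And>i p. i \<in> {1..<r} \<Longrightarrow> Q p \<Longrightarrow> Q (Transposition.transpose (i - 1) i \<circ> p)"
  shows "Q p"
  using p finite_lessThan
proof (induction rule: permutes_induct)
  case (swap a b p)
  show ?case
  proof (cases "a < b")
    case True
    then show ?thesis using transposition_from_adjacent[of r Q, OF adj True _ swap(5)] swap(2) by blast
  next
    case False
    then have "b < a" using swap(3) by simp
    then have "Q (Transposition.transpose b a \<circ> p)"
      using transposition_from_adjacent[of r Q, OF adj _ _ swap(5)] swap(1) by blast
    then show ?thesis by (simp only: transpose_commute)
  qed
qed (rule id)

lemma arrangement_permutes:
  assumes "f \<in> arrangements r r"
  shows "\<exists>p. p permutes {..<r} \<and> f = map p [0..<r]"
proof (intro exI conjI)
  have f: "length f = r" "distinct f" "set f \<subseteq> {..<r}" using assms by (auto simp: arrangements_def)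
  then have "set f = {..<r}" by (intro card_subset_eq) (auto simp: distinct_card)
  then have bij: "bij_betw (\<lambda>k. f ! k) {..<r} {..<r}" using f by (intro bij_betw_nth) auto
  show "(\<lambda>k. if k < r then f ! k else k) permutes {..<r}"
  proof (rule bij_imp_permutes)
    show "bij_betw (\<lambda>k. if k < r then f ! k else k) {..<r} {..<r}"
      using bij by (rule bij_betw_cong[THEN iffD1, rotated]) simp
  qed simp
  show "f = map (\<lambda>k. if k < r then f ! k else k) [0..<r]"
    using f by (intro nth_equalityI) auto
qed

text \<open>Conjugation by signed swaps permutes the tensor factors of the \<open>place_prod\<close> expansion of an
  invariant matrix, so averaging the expansion over all permutations gives the \<open>sym_prod\<close>.\<close>

theorem signed_symmetric_in_malg:
  fixes m N r :: nat and G :: "(nat list \<Rightarrow> nat list \<Rightarrow> rat) set"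
  defines "I \<equiv> tensor_index N r"
  assumes G: "\<And>a b. a \<in> {1..N} \<Longrightarrow> b \<in> {1..N} \<Longrightarrow> total_place m N r a b \<in> malg I G"
    and x: "on_square I x" and comm: "\<And>i. i \<in> {1..<r} \<Longrightarrow> mm I x (sign_swap m N r i) = mm I (sign_swap m N r i) x"
  shows "x \<in> malg I G"
proof -
  have "\<exists>\<epsilon>. \<epsilon> \<noteq> 0 \<and> place_prod m N r (zip w u) [0..<r] = (\<lambda>v v'. if v = w \<and> v' = u then \<epsilon> else 0)"
    if wu: "w \<in> I" "u \<in> I" for w u
  proof -
    obtain \<epsilon> where "\<forall>v. \<epsilon> v \<noteq> 0" "place_prod m N r (zip (drop 0 w) (drop 0 u)) [0..<r]
      = mono_mat I (\<lambda>v. if drop 0 v = drop 0 w then \<epsilon> v else 0) (\<lambda>v. take 0 v @ drop 0 u)"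
      using place_prod_unit[of w N r u 0 m] wu by (auto simp: I_def)
    then show ?thesis using wu by (intro exI[of _ "\<epsilon> w"]) (auto simp: mono_mat_def fun_eq_iff)
  qed
  then obtain \<epsilon> where \<epsilon>: "\<And>w u. w \<in> I \<Longrightarrow> u \<in> I \<Longrightarrow> \<epsilon> w u \<noteq> 0"
    and unit: "\<And>w u. w \<in> I \<Longrightarrow> u \<in> I \<Longrightarrow>
      place_prod m N r (zip w u) [0..<r] = (\<lambda>v v'. if v = w \<and> v' = u then \<epsilon> w u else 0)"
    by metis
  \<comment> \<open>The expansion of \<open>x\<close> in matrix units, each written as a scaled
    product of placements. The list \<open>f\<close> redistributes the placements over the factors,
    and \<open>[0..<r]\<close> gives back \<open>x\<close>.\<close>
  define Y where "Y f = (\<lambda>v v'. \<Sum>w\<in>I. \<Sum>u\<in>I. (x w u / \<epsilon> w u) * place_prod m N r (zip w u) f v v')" for f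
  have fin: "finite I" by (simp add: I_def)
  have Y_mm: "mm I Z (Y f) = (\<lambda>v v'. \<Sum>w\<in>I. \<Sum>u\<in>I. (x w u / \<epsilon> w u) * mm I Z (place_prod m N r (zip w u) f) v v')"
    "mm I (Y f) Z = (\<lambda>v v'. \<Sum>w\<in>I. \<Sum>u\<in>I. (x w u / \<epsilon> w u) * mm I (place_prod m N r (zip w u) f) Z v v')" for Z f
    unfolding Y_def by (simp_all only: mm_sum mm_scale)
  have Y0: "Y [0..<r] = x"
  proof (intro ext)
    fix v v'
    have "Y [0..<r] v v' = (\<Sum>w\<in>I. \<Sum>u\<in>I. if u = v' then if w = v then x v v' else 0 else 0)"
      unfolding Y_def by (intro sum.cong refl) (use unit \<epsilon> in auto)
    also have "\<dots> = (\<Sum>w\<in>I. if w = v then if v' \<in> I then x v v' else 0 else 0)"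
      using fin by (intro sum.cong) auto
    also have "\<dots> = x v v'" using x fin by (auto simp: on_square_def)
    finally show "Y [0..<r] v v' = x v v'" .
  qed
  have zip: "length (zip w u) = r" "snd ` set (zip w u) \<subseteq> {1..N}" "set (zip w u) \<subseteq> {1..N} \<times> {1..N}"
    if "w \<in> I" "u \<in> I" for w u
    using that by (auto simp: I_def tensor_index_def dest: set_zip_leftD set_zip_rightD)
  have "p permutes {..<r} \<Longrightarrow> length (map p [0..<r]) = r \<and> set (map p [0..<r]) \<subseteq> {..<r} \<and> Y (map p [0..<r]) = x" for p :: "nat \<Rightarrow> nat"
  proof (erule permutes_from_adjacent)
    fix i and p :: "nat \<Rightarrow> nat"
    let ?f = "map p [0..<r]" and ?t = "Transposition.transpose (i - 1) i" and ?s = "sign_swap m N r i"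
    assume i: "i \<in> {1..<r}" and p: "length ?f = r \<and> set ?f \<subseteq> {..<r} \<and> Y ?f = x"
    have set: "set (map (?t \<circ> p) [0..<r]) \<subseteq> {..<r}"
      using p i by (auto simp: Transposition.transpose_def image_subset_iff)
    have "mm I ?s (Y ?f) = mm I (Y (map ?t ?f)) ?s"
      unfolding Y_mm
    proof (intro ext sum.cong refl)
      fix v v' w u assume wu: "w \<in> I" "u \<in> I"
      have "mm I ?s (place_prod m N r (zip w u) ?f) = mm I (place_prod m N r (zip w u) (map ?t ?f)) ?s"
        unfolding I_def by (rule sign_swap_place_prod[OF i]) (use zip[OF wu] p in simp_all)
      then show "x w u / \<epsilon> w u * mm I ?s (place_prod m N r (zip w u) ?f) v v'
          = x w u / \<epsilon> w u * mm I (place_prod m N r (zip w u) (map ?t ?f)) ?s v v'" by simp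
    qed
    \<comment> \<open>Multiplying by \<open>?s\<close> once more cancels it, as its square is the
      identity, and \<open>Y (map ?t ?f) = x\<close> remains.\<close>
    then have "mm I (mm I (Y (map ?t ?f)) ?s) ?s = mm I (mm I x ?s) ?s"
      using p comm[OF i] by simp
    moreover have "on_square I (Y (map ?t ?f))"
      unfolding Y_def on_square_def
      using on_squareD[OF on_square_place_prod] zip(2) by (auto simp: I_def intro!: sum.neutral)
    ultimately have "Y (map ?t ?f) = x"
      using x fin sign_swap_square[OF i, of N m] by (simp add: mm_assoc I_def)
    then show "length (map (?t \<circ> p) [0..<r]) = r \<and> set (map (?t \<circ> p) [0..<r]) \<subseteq> {..<r} \<and> Y (map (?t \<circ> p) [0..<r]) = x"
      using set by simp
  qed (use Y0 in auto)
  then have Y: "Y f = x" if "f \<in> arrangements r r" for f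
    using arrangement_permutes[OF that] by blast
  \<comment> \<open>The number of arrangements of all \<open>r\<close> factors, a nonzero rational;
    each of them contributes \<open>x\<close> to the sum.\<close>
  define c where "c = (of_nat (card (arrangements r r)) :: rat)"
  have "[0..<r] \<in> arrangements r r" by (auto simp: arrangements_def)
  then have c: "c \<noteq> 0" by (auto simp: c_def)
  have "x = (\<lambda>v v'. 1 / c * (\<Sum>f\<in>arrangements r r. Y f v v'))"
    using c by (simp add: Y c_def)
  also have "\<dots> = (\<lambda>v v'. 1 / c * (\<Sum>w\<in>I. \<Sum>u\<in>I. (x w u / \<epsilon> w u) * sym_prod m N r (zip w u) v v'))"
  proof (intro ext arg_cong2[of _ _ _ _ "(*)"] refl)
    fix v v'
    have "(\<Sum>f\<in>arrangements r r. Y f v v')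
      = (\<Sum>w\<in>I. \<Sum>f\<in>arrangements r r. \<Sum>u\<in>I. (x w u / \<epsilon> w u) * place_prod m N r (zip w u) f v v')"
      unfolding Y_def by (rule sum.swap)
    also have "\<dots> = (\<Sum>w\<in>I. \<Sum>u\<in>I. \<Sum>f\<in>arrangements r r. (x w u / \<epsilon> w u) * place_prod m N r (zip w u) f v v')"
      by (intro sum.cong refl sum.swap)
    also have "\<dots> = (\<Sum>w\<in>I. \<Sum>u\<in>I. (x w u / \<epsilon> w u) * sym_prod m N r (zip w u) v v')"
      using zip by (intro sum.cong refl) (simp add: sym_prod_def sum_distrib_left)
    finally show "(\<Sum>f\<in>arrangements r r. Y f v v') = \<dots>" .
  qed
  also have "\<dots> \<in> malg I G"
    by (intro malg.scale malg_sum) (use sym_prod_in_malg[OF G[unfolded I_def]] zip in \<open>auto simp: I_def\<close>)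
  finally show ?thesis .
qed


text \<open>Root vectors are iterated supercommutators of simple ones, built up from one fixed end.
  The commutator formula requires distinct ends, so the diagonal elements are supplied
  separately.\<close>

lemma total_place_in_malg:
  assumes diag: "\<And>a. a \<in> {1..N} \<Longrightarrow> total_place m N r a a \<in> malg (tensor_index N r) G"
    and simple: "\<And>i. i \<in> {1..<N} \<Longrightarrow> total_place m N r (i + 1) i \<in> malg (tensor_index N r) G"
      "\<And>i. i \<in> {1..<N} \<Longrightarrow> total_place m N r i (i + 1) \<in> malg (tensor_index N r) G"
    and ab: "a \<in> {1..N}" "b \<in> {1..N}"
  shows "total_place m N r a b \<in> malg (tensor_index N r) G"
proof -
  have up: "a < b \<Longrightarrow> b \<le> N \<Longrightarrow> total_place m N r a b \<in> malg (tensor_index N r) G" for b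
  proof (induction b)
    case (Suc b)
    show ?case
    proof (cases "a = b")
      case True
      then show ?thesis using simple(2)[of a] Suc.prems ab by auto
    next
      case False
      then show ?thesis using Suc simple(2)[of b] ab
        by (subst total_place_commutator[where b = b]) (auto intro!: malg_diff malg.scale malg.mult)
    qed
  qed simp
  have down: "b < a \<Longrightarrow> a \<le> N \<Longrightarrow> total_place m N r a b \<in> malg (tensor_index N r) G" for a
  proof (induction a)
    case (Suc a)
    show ?case
    proof (cases "a = b")
      case True
      then show ?thesis using simple(1)[of b] Suc.prems ab by auto
    next
      case False
      then show ?thesis using Suc simple(1)[of a] ab
        by (subst total_place_commutator[where b = a]) (auto intro!: malg_diff malg.scale malg.mult)
    qed
  qed simp
  show ?thesis using diag up down ab by (cases a b rule: linorder_cases) auto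
qed

section \<open>The Hecke generators commute with the quantum superalgebra\<close>

lemma tensor_index_nth_adjacent:
  "w \<in> tensor_index N r \<Longrightarrow> i \<in> {1..<r} \<Longrightarrow> w ! (i - 1) \<in> {1..N}"
  "w \<in> tensor_index N r \<Longrightarrow> i \<in> {1..<r} \<Longrightarrow> w ! i \<in> {1..N}"
  by (rule tensor_index_nth; simp; linarith)+

text \<open>Since \<open>ell m i\<close> squares to 1, this is \<open>alpha i\<close> carried to the
  dual lattice by the form. At \<open>i = m\<close> both entries are 1, because the form changes
  sign between \<open>i\<close> and \<open>i + 1\<close>.\<close>

lemma coroot_values:
  assumes "i \<in> {1..<m + n}"
  shows "ell m i * coroot m n i b =
    (if b = i then if b \<le> m then 1 else - 1 else if b = i + 1 then if b \<le> m then - 1 else 1 else 0)"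
proof (cases "b \<in> {1..m + n}")
  case True
  have "ell m i * coroot m n i b = wform m n (alpha i) (eps b)"
    using True by (simp add: coroot_eq ell_def)
  also have "\<dots> = (\<Sum>c\<in>{1..m + n}. if c = b then (if b \<le> m then 1 else - 1) * alpha i b else 0)"
    unfolding wform_def by (intro sum.cong) (auto simp: eps_def)
  also have "\<dots> = (if b \<le> m then 1 else - 1) * alpha i b"
    using True by simp
  finally show ?thesis by (auto simp: alpha_def eps_def)
next
  case False
  then show ?thesis using assms by (auto simp: coroot_eq)
qed

section \<open>Commutation on two adjacent tensor factors\<close>

definition T_scalar :: "nat \<Rightarrow> nat \<Rightarrow> nat \<Rightarrow> ratfun" where
  "T_scalar m k l = (if k = l then ((-1) ^ vpar m k * (qvar + inverse qvar) + qvar - inverse qvar) / 2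
    else if k < l then qvar - inverse qvar else 0)"

text \<open>On equal letters keeping and exchanging coincide; that case is counted in
  \<open>T_scalar\<close> alone.\<close>

definition T_swap :: "nat \<Rightarrow> nat \<Rightarrow> nat \<Rightarrow> ratfun" where
  "T_swap m k l = (if k = l then 0 else (-1) ^ (vpar m k * vpar m l))"

lemma T_coeff_eq:
  "T_coeff m k l k' l' = T_scalar m k l * of_bool (k' = k \<and> l' = l) + T_swap m k l * of_bool (k' = l \<and> l' = k)"
  by (auto simp: T_coeff_def T_scalar_def T_swap_def)

lemma T_coeff_eq':
  "T_coeff m k l k' l' = of_bool (k = k' \<and> l = l') * T_scalar m k l + of_bool (k = l' \<and> l = k') * T_swap m k l"
  unfolding T_coeff_eq by (simp only: mult.commute eq_commute[of k'] eq_commute[of l'] conj_commute)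

lemma sum_two_deltas:
  fixes g :: "nat \<Rightarrow> nat \<Rightarrow> 'a::comm_semiring_1"
  assumes "k \<in> {1..N}" "l \<in> {1..N}"
  shows "(\<Sum>a\<in>{1..N}. \<Sum>b\<in>{1..N}. of_bool (a = k \<and> b = l) * g a b) = g k l"
proof -
  have "(\<Sum>b\<in>{1..N}. of_bool (a = k \<and> b = l) * g a b) = (if a = k then g k l else 0)" for a
  proof -
    have "(\<Sum>b\<in>{1..N}. of_bool (a = k \<and> b = l) * g a b) = (\<Sum>b\<in>{1..N}. if b = l then if a = k then g k l else 0 else 0)"
      by (intro sum.cong) auto
    then show ?thesis using assms by simp
  qed
  then show ?thesis using assms by simp
qed

definition pair_commutes :: "nat \<Rightarrow> nat \<Rightarrow> (nat \<Rightarrow> nat \<Rightarrow> nat \<Rightarrow> nat \<Rightarrow> ratfun) \<Rightarrow> bool" where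
  "pair_commutes m N X \<longleftrightarrow> (\<forall>k\<in>{1..N}. \<forall>l\<in>{1..N}. \<forall>k'\<in>{1..N}. \<forall>l'\<in>{1..N}.
    (\<Sum>a\<in>{1..N}. \<Sum>b\<in>{1..N}. T_coeff m k l a b * X a b k' l')
      = (\<Sum>a\<in>{1..N}. \<Sum>b\<in>{1..N}. X k l a b * T_coeff m a b k' l'))"

text \<open>A row or column of T meets only a pair of letters and its exchange, so each double sum
  collapses to two terms.\<close>

lemma pair_commutesI:
  assumes "\<And>k l k' l'. k \<in> {1..N} \<Longrightarrow> l \<in> {1..N} \<Longrightarrow> k' \<in> {1..N} \<Longrightarrow> l' \<in> {1..N} \<Longrightarrow>
    T_scalar m k l * X k l k' l' + T_swap m k l * X l k k' l'
      = X k l k' l' * T_scalar m k' l' + X k l l' k' * T_swap m k' l'"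
  shows "pair_commutes m N X"
  unfolding pair_commutes_def
proof (intro ballI)
  fix k l k' l' assume *: "k \<in> {1..N}" "l \<in> {1..N}" "k' \<in> {1..N}" "l' \<in> {1..N}"
  have "(\<Sum>a\<in>{1..N}. \<Sum>b\<in>{1..N}. T_coeff m k l a b * X a b k' l')
    = (\<Sum>a\<in>{1..N}. \<Sum>b\<in>{1..N}. of_bool (a = k \<and> b = l) * (T_scalar m k l * X a b k' l'))
    + (\<Sum>a\<in>{1..N}. \<Sum>b\<in>{1..N}. of_bool (a = l \<and> b = k) * (T_swap m k l * X a b k' l'))"
    unfolding sum.distrib[symmetric] by (intro sum.cong refl) (simp add: T_coeff_eq algebra_simps)
  also have "\<dots> = T_scalar m k l * X k l k' l' + T_swap m k l * X l k k' l'"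
    using * by (simp only: sum_two_deltas)
  also have "\<dots> = X k l k' l' * T_scalar m k' l' + X k l l' k' * T_swap m k' l'" by (rule assms) fact+
  also have "\<dots> = (\<Sum>a\<in>{1..N}. \<Sum>b\<in>{1..N}. of_bool (a = k' \<and> b = l') * (X k l a b * T_scalar m a b))
    + (\<Sum>a\<in>{1..N}. \<Sum>b\<in>{1..N}. of_bool (a = l' \<and> b = k') * (X k l a b * T_swap m a b))"
    using * by (simp only: sum_two_deltas) (simp add: T_swap_def mult.commute)
  also have "\<dots> = (\<Sum>a\<in>{1..N}. \<Sum>b\<in>{1..N}. X k l a b * T_coeff m a b k' l')"
    unfolding sum.distrib[symmetric]
    by (intro sum.cong refl) (simp only: T_coeff_eq' distrib_left mult.left_commute)
  finally show "(\<Sum>a\<in>{1..N}. \<Sum>b\<in>{1..N}. T_coeff m k l a b * X a b k' l')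
      = (\<Sum>a\<in>{1..N}. \<Sum>b\<in>{1..N}. X k l a b * T_coeff m a b k' l')" .
qed

lemma pair_commutes_diag:
  assumes "\<And>k l. k \<noteq> l \<Longrightarrow> D k l = 0"
  shows "pair_commutes m N (\<lambda>k l k' l'. D k k' * D l l')"
  by (rule pair_commutesI)
    (metis (no_types, opaque_lifting) assms mult.commute mult_eq_0_iff T_swap_def add.commute)

lemma T_scalar_values:
  "k < l \<Longrightarrow> T_scalar m k l = qvar - inverse qvar"
  "l < k \<Longrightarrow> T_scalar m k l = 0"
  "k \<le> m \<Longrightarrow> T_scalar m k k = qvar"
  "k > m \<Longrightarrow> T_scalar m k k = - inverse qvar"
  by (auto simp: T_scalar_def vpar_def field_simps)

text \<open>The common form of e_i and f_i on two factors is E (x) L + S (x) E with E sending v_j to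
  v_j' and with \<open>S\<close>, \<open>L\<close> diagonal. The assumptions \<open>generic\<close>
  treat a second letter \<open>x\<close> outside the pair, the assumptions \<open>edge\<close> the
  words in \<open>j\<close> and \<open>j'\<close> alone.\<close>

lemma pair_commutes_root:
  assumes j: "j' = j + 1 \<or> j = j' + 1"
    and generic: "\<And>x. x \<noteq> j \<Longrightarrow> x \<noteq> j' \<Longrightarrow> S x * T_swap m j x = L x * T_swap m x j'"
      "\<And>x. x \<noteq> j \<Longrightarrow> x \<noteq> j' \<Longrightarrow> L x * T_swap m x j = S x * T_swap m j' x"
    and edge: "T_scalar m j j' * L j' + T_swap m j j' * S j' = L j' * T_scalar m j' j'"
      "T_scalar m j' j * S j' + T_swap m j j' * L j' = S j' * T_scalar m j' j'"
      "T_scalar m j j * L j = L j * T_scalar m j' j + S j * T_swap m j j'"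
      "T_scalar m j j * S j = S j * T_scalar m j j' + L j * T_swap m j j'"
  shows "pair_commutes m N (\<lambda>k l k' l'.
     of_bool (k = j \<and> k' = j') * (of_bool (l' = l) * L l) + (of_bool (k' = k) * S k) * of_bool (l = j \<and> l' = j'))"
    (is "pair_commutes _ _ ?X")
proof (rule pair_commutesI)
  have sym: "T_swap m a b = T_swap m b a" for a b by (simp add: T_swap_def mult.commute)
  \<comment> \<open>The letters \<open>j\<close> and \<open>j'\<close> are consecutive, so any other
    \<open>x\<close> lies on the same side of both.\<close>
  have scal: "T_scalar m j x = T_scalar m j' x" "T_scalar m x j = T_scalar m x j'" if "x \<noteq> j" "x \<noteq> j'" for x
    using j that by (auto simp: T_scalar_def)
  have jj: "j \<noteq> j'" using j by auto
  have diag: "T_swap m a a = 0" for a by (simp add: T_swap_def)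
  fix k l k' l'
  show "T_scalar m k l * ?X k l k' l' + T_swap m k l * ?X l k k' l'
      = ?X k l k' l' * T_scalar m k' l' + ?X k l l' k' * T_swap m k' l'"
  proof (cases "k = j"; cases "l = j")
    assume "k = j" "l = j"
    then show ?thesis using jj edge(3,4) by (auto simp: diag sym[of j' j] algebra_simps)
  next
    assume "k = j" "l \<noteq> j"
    then show ?thesis using jj edge(1) generic[of l] scal[of l] sym[of l j'] sym[of j' j]
      by (cases "l = j'") (auto simp: diag mult.commute)
  next
    assume "k \<noteq> j" "l = j"
    then show ?thesis using jj edge(2) generic[of k] generic(2)[of k] scal[of k] sym[of k j'] sym[of j' j] sym[of k j]
      by (cases "k = j'") (auto simp: diag mult.commute)
  qed auto
qed

lemma pair_commutes_e:
  assumes i: "i \<in> {1..<m + n}"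
  shows "pair_commutes m N (\<lambda>k l k' l'.
     e_coeff i k k' * sq_coeff m 0 (\<lambda>b. - (ell m i * coroot m n i b)) l l'
     + sq_coeff m (gpar m i) (\<lambda>b. 0) k k' * e_coeff i l l')"
proof -
  define L where "L l = qvar powi (- (ell m i * coroot m n i l))" for l
  define S where "S k = (((- 1) ^ vpar m k) ^ gpar m i :: ratfun)" for k
  have L: "L x = 1" if "x \<noteq> i" "x \<noteq> i + 1" for x using that by (simp add: L_def coroot_values[OF i])
  have Lv: "L i = (if i \<le> m then inverse qvar else qvar)" "L (i + 1) = (if i < m then qvar else inverse qvar)"
    by (simp_all add: L_def coroot_values[OF i] power_int_minus)
  have "pair_commutes m N (\<lambda>k l k' l'.
     of_bool (k = i + 1 \<and> k' = i) * (of_bool (l' = l) * L l)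
     + (of_bool (k' = k) * S k) * of_bool (l = i + 1 \<and> l' = i))"
  proof (rule pair_commutes_root)
    fix x assume "x \<noteq> i + 1" "x \<noteq> i"
    then show "S x * T_swap m (i + 1) x = L x * T_swap m x i" "L x * T_swap m x (i + 1) = S x * T_swap m i x"
      by (auto simp: L S_def T_swap_def vpar_def gpar_def)
  qed (unfold Lv, use qvar_neq_0 in \<open>auto simp: S_def T_swap_def T_scalar_values vpar_def gpar_def left_diff_distrib right_diff_distrib split: if_splits\<close>)
  moreover have "(\<lambda>k l k' l'. e_coeff i k k' * sq_coeff m 0 (\<lambda>b. - (ell m i * coroot m n i b)) l l'
     + sq_coeff m (gpar m i) (\<lambda>b. 0) k k' * e_coeff i l l') = (\<lambda>k l k' l'.
     of_bool (k = i + 1 \<and> k' = i) * (of_bool (l' = l) * L l)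
     + (of_bool (k' = k) * S k) * of_bool (l = i + 1 \<and> l' = i))"
    by (intro ext) (simp add: L_def S_def e_coeff_def sq_coeff_def)
  ultimately show ?thesis by (simp only:)
qed

lemma pair_commutes_f:
  assumes i: "i \<in> {1..<m + n}"
  shows "pair_commutes m N (\<lambda>k l k' l'. f_coeff i k k' * id_coeff l l'
     + sq_coeff m (gpar m i) (\<lambda>b. ell m i * coroot m n i b) k k' * f_coeff i l l')"
proof -
  define S where "S k = (((- 1) ^ vpar m k) ^ gpar m i :: ratfun) * qvar powi (ell m i * coroot m n i k)" for k
  have S: "S x = ((- 1) ^ vpar m x) ^ gpar m i" if "x \<noteq> i" "x \<noteq> i + 1" for x
    using that by (simp add: S_def coroot_values[OF i])
  \<comment> \<open>At \<open>i = m\<close> the letter \<open>i + 1\<close> is odd, and the grading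
    operator contributes the extra sign.\<close>
  have Sv: "S i = (if i \<le> m then qvar else inverse qvar)"
    "S (i + 1) = (if i < m then inverse qvar else if i = m then - qvar else qvar)"
    by (auto simp: S_def coroot_values[OF i] power_int_minus vpar_def gpar_def)
  have "pair_commutes m N (\<lambda>k l k' l'.
     of_bool (k = i \<and> k' = i + 1) * (of_bool (l' = l) * 1)
     + (of_bool (k' = k) * S k) * of_bool (l = i \<and> l' = i + 1))"
  proof (rule pair_commutes_root)
    fix x assume "x \<noteq> i" "x \<noteq> i + 1"
    then show "S x * T_swap m i x = 1 * T_swap m x (i + 1)" "1 * T_swap m x i = S x * T_swap m (i + 1) x"
      by (auto simp: S T_swap_def vpar_def gpar_def)
  qed (unfold Sv, use qvar_neq_0 in \<open>auto simp: T_swap_def T_scalar_values vpar_def gpar_def left_diff_distrib right_diff_distrib split: if_splits\<close>)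
  moreover have "(\<lambda>k l k' l'. f_coeff i k k' * id_coeff l l'
     + sq_coeff m (gpar m i) (\<lambda>b. ell m i * coroot m n i b) k k' * f_coeff i l l') = (\<lambda>k l k' l'.
     of_bool (k = i \<and> k' = i + 1) * (of_bool (l' = l) * 1)
     + (of_bool (k' = k) * S k) * of_bool (l = i \<and> l' = i + 1))"
    by (intro ext) (simp add: S_def f_coeff_def id_coeff_def sq_coeff_def)
  ultimately show ?thesis by (simp only:)
qed

section \<open>From two adjacent factors to the whole tensor power\<close>

lemma sum_tensor_index_pair:
  fixes g :: "nat list \<Rightarrow> 'a::comm_monoid_add"
  assumes i: "i \<in> {1..<r}" and w: "w \<in> tensor_index N r"
    and zero: "\<And>v. v \<in> tensor_index N r \<Longrightarrow> \<exists>j\<in>{..<r} - {i - 1, i}. v ! j \<noteq> w ! j \<Longrightarrow> g v = 0"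
  shows "(\<Sum>v\<in>tensor_index N r. g v) = (\<Sum>a\<in>{1..N}. \<Sum>b\<in>{1..N}. g (w[i - 1 := a, i := b]))"
proof -
  let ?h = "\<lambda>(a, b). w[i - 1 := a, i := b]"
  have len: "length w = r" using w by (simp add: tensor_index_length)
  have inj: "inj_on ?h ({1..N} \<times> {1..N})"
  proof (rule inj_onI, clarify)
    fix a b a' b' assume eq: "w[i - 1 := a, i := b] = w[i - 1 := a', i := b']"
    have "w[i - 1 := a, i := b] ! i = w[i - 1 := a', i := b'] ! i"
      "w[i - 1 := a, i := b] ! (i - 1) = w[i - 1 := a', i := b'] ! (i - 1)" by (simp_all only: eq)
    then show "a = a' \<and> b = b'" using i len by auto
  qed
  have "(\<Sum>v\<in>tensor_index N r. g v) = (\<Sum>v\<in>?h ` ({1..N} \<times> {1..N}). g v)"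
  proof (rule sum.mono_neutral_right)
    show "?h ` ({1..N} \<times> {1..N}) \<subseteq> tensor_index N r"
      using w by (auto intro!: tensor_index_update)
    show "\<forall>v\<in>tensor_index N r - ?h ` ({1..N} \<times> {1..N}). g v = 0"
    proof
      fix v assume v: "v \<in> tensor_index N r - ?h ` ({1..N} \<times> {1..N})"
      then have "v \<in> tensor_index N r" by simp
      then show "g v = 0"
      proof (rule zero, intro ccontr[of "\<exists>j\<in>_. _ j"])
        assume *: "\<not> (\<exists>j\<in>{..<r} - {i - 1, i}. v ! j \<noteq> w ! j)"
        have "v = w[i - 1 := v ! (i - 1), i := v ! i]"
          using v * i len by (intro nth_equalityI) (auto simp: tensor_index_length nth_list_update)
        moreover have "v ! (i - 1) \<in> {1..N}" "v ! i \<in> {1..N}"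
          using v tensor_index_nth_adjacent[OF _ i, of v N] by simp_all
        ultimately have "v \<in> ?h ` ({1..N} \<times> {1..N})"
          by (intro image_eqI[of _ _ "(v ! (i - 1), v ! i)"]) auto
        then show False using v by blast
      qed
    qed
  qed simp
  also have "\<dots> = (\<Sum>p\<in>{1..N} \<times> {1..N}. g (?h p))" by (rule sum.reindex_cong[OF inj]) auto
  also have "\<dots> = (\<Sum>a\<in>{1..N}. \<Sum>b\<in>{1..N}. g (w[i - 1 := a, i := b]))"
    by (simp add: sum.cartesian_product split_beta)
  finally show ?thesis .
qed

definition restr :: "'i set \<Rightarrow> ('i \<Rightarrow> 'i \<Rightarrow> 'k::zero) \<Rightarrow> 'i \<Rightarrow> 'i \<Rightarrow> 'k" where
  "restr I X w u = (if w \<in> I \<and> u \<in> I then X w u else 0)"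

lemma on_square_restr [simp]: "on_square I (restr I X)"
  by (auto simp: on_square_def restr_def)

definition T_mat :: "nat \<Rightarrow> nat \<Rightarrow> nat \<Rightarrow> nat \<Rightarrow> nat list \<Rightarrow> nat list \<Rightarrow> ratfun" where
  "T_mat m N r i = restr (tensor_index N r) (\<lambda>w u.
     T_coeff m (w ! (i - 1)) (w ! i) (u ! (i - 1)) (u ! i)
       * (\<Prod>j\<in>{..<r} - {i - 1, i}. of_bool (u ! j = w ! j)))"

lemma tensor_coeff_split:
  assumes "i \<in> {1..<length As}"
  shows "tensor_coeff As w u = (As ! (i - 1)) (w ! (i - 1)) (u ! (i - 1)) * (As ! i) (w ! i) (u ! i)
    * (\<Prod>j\<in>{..<length As} - {i - 1, i}. (As ! j) (w ! j) (u ! j))"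
proof -
  have "{..<length As} = insert (i - 1) (insert i ({..<length As} - {i - 1, i}))" using assms by auto
  then have "tensor_coeff As w u
    = (\<Prod>j\<in>insert (i - 1) (insert i ({..<length As} - {i - 1, i})). (As ! j) (w ! j) (u ! j))"
    unfolding tensor_coeff_def by simp
  also have "\<dots> = (As ! (i - 1)) (w ! (i - 1)) (u ! (i - 1)) * (As ! i) (w ! i) (u ! i)
    * (\<Prod>j\<in>{..<length As} - {i - 1, i}. (As ! j) (w ! j) (u ! j))"
    using assms by (subst prod.insert, simp, simp, force, subst prod.insert) (auto simp: mult.assoc)
  finally show ?thesis .
qed

text \<open>T touches two positions only, so the sum over words reduces to the two letters there,
  and the remaining factors of the pure tensor come out as a common product.\<close>

lemma T_mat_mult_tensor:
  assumes i: "i \<in> {1..<r}" and len: "length As = r" and w: "w \<in> tensor_index N r" and u: "u \<in> tensor_index N r"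
  shows "mm (tensor_index N r) (T_mat m N r i) (restr (tensor_index N r) (tensor_coeff As)) w u
    = (\<Sum>a\<in>{1..N}. \<Sum>b\<in>{1..N}. T_coeff m (w ! (i - 1)) (w ! i) a b *
        ((As ! (i - 1)) a (u ! (i - 1)) * (As ! i) b (u ! i)))
      * (\<Prod>j\<in>{..<r} - {i - 1, i}. (As ! j) (w ! j) (u ! j))"
    (is ?left)
  and "mm (tensor_index N r) (restr (tensor_index N r) (tensor_coeff As)) (T_mat m N r i) w u
    = (\<Sum>a\<in>{1..N}. \<Sum>b\<in>{1..N}. (As ! (i - 1)) (w ! (i - 1)) a * (As ! i) (w ! i) b *
        T_coeff m a b (u ! (i - 1)) (u ! i))
      * (\<Prod>j\<in>{..<r} - {i - 1, i}. (As ! j) (w ! j) (u ! j))"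
    (is ?right)
proof -
  let ?I = "tensor_index N r" and ?J = "{..<r} - {i - 1, i}"
  have lw: "length w = r" and lu: "length u = r" using w u by (simp_all add: tensor_index_length)
  have upd: "x[i - 1 := a, i := b] \<in> ?I" if "x \<in> ?I" "a \<in> {1..N}" "b \<in> {1..N}" for x a b
    using that by (intro tensor_index_update)
  have upd_nth: "x[i - 1 := a, i := b] ! (i - 1) = a" "x[i - 1 := a, i := b] ! i = b" if "length x = r" for x a b
    using i that by auto
  have "mm ?I (T_mat m N r i) (restr ?I (tensor_coeff As)) w u
    = (\<Sum>a\<in>{1..N}. \<Sum>b\<in>{1..N}. T_mat m N r i w (w[i - 1 := a, i := b])
        * restr ?I (tensor_coeff As) (w[i - 1 := a, i := b]) u)"
    unfolding mm_def by (rule sum_tensor_index_pair[OF i w]) (auto simp: T_mat_def restr_def)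
  also have "\<dots> = (\<Sum>a\<in>{1..N}. \<Sum>b\<in>{1..N}. T_coeff m (w ! (i - 1)) (w ! i) a b *
        ((As ! (i - 1)) a (u ! (i - 1)) * (As ! i) b (u ! i)) * (\<Prod>j\<in>?J. (As ! j) (w ! j) (u ! j)))"
  proof (intro sum.cong refl)
    fix a b assume ab: "a \<in> {1..N}" "b \<in> {1..N}"
    have "(\<Prod>j\<in>?J. (As ! j) (w[i - 1 := a, i := b] ! j) (u ! j)) = (\<Prod>j\<in>?J. (As ! j) (w ! j) (u ! j))"
      by (intro prod.cong) auto
    moreover have "(\<Prod>j\<in>?J. of_bool (w[i - 1 := a, i := b] ! j = w ! j)) = (1 :: ratfun)"
      by (intro prod.neutral) auto
    ultimately show "T_mat m N r i w (w[i - 1 := a, i := b]) * restr ?I (tensor_coeff As) (w[i - 1 := a, i := b]) u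
      = T_coeff m (w ! (i - 1)) (w ! i) a b * ((As ! (i - 1)) a (u ! (i - 1)) * (As ! i) b (u ! i))
        * (\<Prod>j\<in>?J. (As ! j) (w ! j) (u ! j))"
      using w u upd[OF w ab] i lw len tensor_coeff_split[of i As "w[i - 1 := a, i := b]" u] upd_nth[of w a b]
      by (simp add: T_mat_def restr_def mult.assoc)
  qed
  finally show ?left by (simp add: sum_distrib_right)
  have "mm ?I (restr ?I (tensor_coeff As)) (T_mat m N r i) w u
    = (\<Sum>a\<in>{1..N}. \<Sum>b\<in>{1..N}. restr ?I (tensor_coeff As) w (u[i - 1 := a, i := b])
        * T_mat m N r i (u[i - 1 := a, i := b]) u)"
    unfolding mm_def by (rule sum_tensor_index_pair[OF i u]) (auto simp: T_mat_def restr_def)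
  also have "\<dots> = (\<Sum>a\<in>{1..N}. \<Sum>b\<in>{1..N}. (As ! (i - 1)) (w ! (i - 1)) a * (As ! i) (w ! i) b *
        T_coeff m a b (u ! (i - 1)) (u ! i) * (\<Prod>j\<in>?J. (As ! j) (w ! j) (u ! j)))"
  proof (intro sum.cong refl)
    fix a b assume ab: "a \<in> {1..N}" "b \<in> {1..N}"
    have "(\<Prod>j\<in>?J. (As ! j) (w ! j) (u[i - 1 := a, i := b] ! j)) = (\<Prod>j\<in>?J. (As ! j) (w ! j) (u ! j))"
      by (intro prod.cong) auto
    moreover have "(\<Prod>j\<in>?J. of_bool (u ! j = u[i - 1 := a, i := b] ! j)) = (1 :: ratfun)"
      by (intro prod.neutral) auto
    ultimately show "restr ?I (tensor_coeff As) w (u[i - 1 := a, i := b]) * T_mat m N r i (u[i - 1 := a, i := b]) u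
      = (As ! (i - 1)) (w ! (i - 1)) a * (As ! i) (w ! i) b *
        T_coeff m a b (u ! (i - 1)) (u ! i) * (\<Prod>j\<in>?J. (As ! j) (w ! j) (u ! j))"
      using w u upd[OF u ab] i lu len tensor_coeff_split[of i As w "u[i - 1 := a, i := b]"] upd_nth[of u a b]
      by (simp add: T_mat_def restr_def mult_ac)
  qed
  finally show ?right by (simp add: sum_distrib_right)
qed

lemma T_mat_commutes_diag:
  assumes i: "i \<in> {1..<r}" and D: "\<And>k l. k \<noteq> l \<Longrightarrow> D k l = 0"
  shows "mm (tensor_index N r) (T_mat m N r i) (restr (tensor_index N r) (tensor_coeff (replicate r D)))
    = mm (tensor_index N r) (restr (tensor_index N r) (tensor_coeff (replicate r D))) (T_mat m N r i)"
proof (rule mat_eqI)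
  fix w u assume wu: "w \<in> tensor_index N r" "u \<in> tensor_index N r"
  have wi: "w ! (i - 1) \<in> {1..N}" "w ! i \<in> {1..N}" "u ! (i - 1) \<in> {1..N}" "u ! i \<in> {1..N}"
    using tensor_index_nth_adjacent[OF wu(1) i] tensor_index_nth_adjacent[OF wu(2) i] by simp_all
  have ir: "i - 1 < r" "i < r" using i by auto
  show "mm (tensor_index N r) (T_mat m N r i) (restr (tensor_index N r) (tensor_coeff (replicate r D))) w u
    = mm (tensor_index N r) (restr (tensor_index N r) (tensor_coeff (replicate r D))) (T_mat m N r i) w u"
    using pair_commutes_diag[of D m N, OF D] wi
    unfolding pair_commutes_def T_mat_mult_tensor[OF i length_replicate wu] List.nth_replicate[OF ir(1)] List.nth_replicate[OF ir(2)]
    by simp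
qed (auto simp: T_mat_def)

text \<open>In each summand \<open>E\<close> sits on factor \<open>k\<close>, with \<open>S\<close>
  to its left and \<open>L\<close> to its right. If neither factor touched by T is \<open>k\<close>,
  both carry the same diagonal operator and the summand commutes with T; the two remaining summands
  combine to the two-factor coproduct.\<close>

lemma T_mat_commutes_coproduct:
  assumes i: "i \<in> {1..<r}"
    and S: "\<And>k l. k \<noteq> l \<Longrightarrow> S k l = 0" and L: "\<And>k l. k \<noteq> l \<Longrightarrow> L k l = 0"
    and E: "pair_commutes m N (\<lambda>k l k' l'. E k k' * L l l' + S k k' * E l l')"
  defines "Z \<equiv> restr (tensor_index N r) (\<lambda>w u. \<Sum>k\<in>{1..r}.
     tensor_coeff (replicate (k - 1) S @ [E] @ replicate (r - k) L) w u)"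
  shows "mm (tensor_index N r) (T_mat m N r i) Z = mm (tensor_index N r) Z (T_mat m N r i)"
proof (rule mat_eqI)
  let ?I = "tensor_index N r" and ?J = "{..<r} - {i - 1, i}"
  define As where "As k = replicate (k - 1) S @ [E] @ replicate (r - k) L" for k
  have len: "length (As k) = r" if "k \<in> {1..r}" for k using that by (auto simp: As_def)
  have nth: "As k ! j = (if j < k - 1 then S else if j = k - 1 then E else L)" if "k \<in> {1..r}" "j < r" for k j
    using that by (auto simp: As_def nth_append nth_Cons')
  have Z: "Z = (\<lambda>w u. \<Sum>k\<in>{1..r}. restr ?I (tensor_coeff (As k)) w u)"
    by (auto simp: Z_def restr_def As_def fun_eq_iff)
  fix w u assume wu: "w \<in> ?I" "u \<in> ?I"
  have wi: "w ! (i - 1) \<in> {1..N}" "w ! i \<in> {1..N}" "u ! (i - 1) \<in> {1..N}" "u ! i \<in> {1..N}"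
    using tensor_index_nth_adjacent[OF wu(1) i] tensor_index_nth_adjacent[OF wu(2) i] by simp_all
  \<comment> \<open>The local part of the commutator of T with X (x) Y; \<open>R k\<close> collects
    the other factors.\<close>
  define \<Delta> where "\<Delta> X Y = (\<Sum>a\<in>{1..N}. \<Sum>b\<in>{1..N}. T_coeff m (w ! (i - 1)) (w ! i) a b *
        (X a (u ! (i - 1)) * Y b (u ! i)))
    - (\<Sum>a\<in>{1..N}. \<Sum>b\<in>{1..N}. X (w ! (i - 1)) a * Y (w ! i) b *
        T_coeff m a b (u ! (i - 1)) (u ! i))" for X Y :: "nat \<Rightarrow> nat \<Rightarrow> ratfun"
  define R where "R k = (\<Prod>j\<in>?J. (As k ! j) (w ! j) (u ! j))" for k
  have \<Delta>_diag: "\<Delta> D D = 0" if "\<And>k l. k \<noteq> l \<Longrightarrow> D k l = 0" for D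
    using pair_commutes_diag[of D m N, OF that] wi by (simp add: pair_commutes_def \<Delta>_def)
  have "(\<Sum>a\<in>{1..N}. \<Sum>b\<in>{1..N}. T_coeff m (w ! (i - 1)) (w ! i) a b *
        (E a (u ! (i - 1)) * L b (u ! i) + S a (u ! (i - 1)) * E b (u ! i)))
    = (\<Sum>a\<in>{1..N}. \<Sum>b\<in>{1..N}. (E (w ! (i - 1)) a * L (w ! i) b + S (w ! (i - 1)) a * E (w ! i) b) *
        T_coeff m a b (u ! (i - 1)) (u ! i))"
    using E wi unfolding pair_commutes_def by blast
  moreover have "\<And>x y x' y' :: ratfun. x + x' = y + y' \<Longrightarrow> (x - y) + (x' - y') = 0"
    by (simp add: algebra_simps)
  ultimately have \<Delta>_E: "\<Delta> E L + \<Delta> S E = 0"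
    unfolding \<Delta>_def distrib_left distrib_right sum.distrib by blast
  \<comment> \<open>Factor \<open>i\<close> is list position \<open>i - 1\<close>, so the summands
    for \<open>i\<close> and \<open>i + 1\<close> differ only at the two positions that
    \<open>R\<close> leaves out.\<close>
  have R: "R (i + 1) = R i"
    unfolding R_def by (intro prod.cong refl) (use i in \<open>auto simp: nth\<close>)
  have "mm ?I (T_mat m N r i) Z w u - mm ?I Z (T_mat m N r i) w u
    = (\<Sum>k\<in>{1..r}. \<Delta> (As k ! (i - 1)) (As k ! i) * R k)"
    unfolding Z mm_sum sum_subtractf[symmetric]
    by (intro sum.cong refl)
      (simp add: T_mat_mult_tensor[OF i len wu] \<Delta>_def R_def left_diff_distrib)
  also have "\<dots> = (\<Sum>k\<in>{i, i + 1}. \<Delta> (As k ! (i - 1)) (As k ! i) * R k)"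
  proof (rule sum.mono_neutral_right)
    show "\<forall>k\<in>{1..r} - {i, i + 1}. \<Delta> (As k ! (i - 1)) (As k ! i) * R k = 0"
      using i \<Delta>_diag[of S, OF S] \<Delta>_diag[of L, OF L] by (auto simp: nth)
  qed (use i in auto)
  also have "\<dots> = (\<Delta> E L + \<Delta> S E) * R i"
  proof -
    have "As i ! (i - 1) = E" "As i ! i = L" "As (i + 1) ! (i - 1) = S" "As (i + 1) ! i = E"
      using i by (auto simp: nth)
    moreover have "(\<Sum>k\<in>{i, i + 1}. g k) = g i + g (i + 1)" for g :: "nat \<Rightarrow> ratfun" by simp
    ultimately show ?thesis by (simp only: R distrib_right)
  qed
  also have "\<dots> = 0" by (simp add: \<Delta>_E)
  finally show "mm ?I (T_mat m N r i) Z w u = mm ?I Z (T_mat m N r i) w u" by simp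
qed (auto simp: T_mat_def Z_def)

section \<open>Duality for matrix algebras\<close>

definition hecke_gens :: "nat \<Rightarrow> nat \<Rightarrow> nat \<Rightarrow> (nat list \<Rightarrow> nat list \<Rightarrow> ratfun) set" where
  "hecke_gens m N r = T_mat m N r ` {1..<r}"

definition e_mat :: "nat \<Rightarrow> nat \<Rightarrow> nat \<Rightarrow> nat \<Rightarrow> nat list \<Rightarrow> nat list \<Rightarrow> ratfun" where
  "e_mat m n r i = restr (tensor_index (m + n) r) (\<lambda>w u. \<Sum>k\<in>{1..r}.
     tensor_coeff
       (replicate (k - 1) (sq_coeff m (gpar m i) (\<lambda>b. 0)) @ [e_coeff i] @
        replicate (r - k) (sq_coeff m 0 (\<lambda>b. - (ell m i * coroot m n i b)))) w u)"

definition f_mat :: "nat \<Rightarrow> nat \<Rightarrow> nat \<Rightarrow> nat \<Rightarrow> nat list \<Rightarrow> nat list \<Rightarrow> ratfun" where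
  "f_mat m n r i = restr (tensor_index (m + n) r) (\<lambda>w u. \<Sum>k\<in>{1..r}.
     tensor_coeff
       (replicate (k - 1) (sq_coeff m (gpar m i) (\<lambda>b. ell m i * coroot m n i b)) @ [f_coeff i] @
        replicate (r - k) id_coeff) w u)"

definition sq_mat :: "nat \<Rightarrow> nat \<Rightarrow> nat \<Rightarrow> nat \<Rightarrow> (nat \<Rightarrow> int) \<Rightarrow> nat list \<Rightarrow> nat list \<Rightarrow> ratfun" where
  "sq_mat m n r s h = restr (tensor_index (m + n) r) (tensor_coeff (replicate r (sq_coeff m s h)))"

definition uq_mat_gens :: "nat \<Rightarrow> nat \<Rightarrow> nat \<Rightarrow> (nat list \<Rightarrow> nat list \<Rightarrow> ratfun) set" where
  "uq_mat_gens m n r = insert (sq_mat m n r 1 (\<lambda>b. 0))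
     (sq_mat m n r 0 ` lattice m n \<union> e_mat m n r ` simple_ix m n \<union> f_mat m n r ` simple_ix m n)"

lemma on_square_hecke_gens: "X \<in> hecke_gens m N r \<Longrightarrow> on_square (tensor_index N r) X"
  by (auto simp: hecke_gens_def T_mat_def)

lemma on_square_uq_gens: "X \<in> uq_mat_gens m n r \<Longrightarrow> on_square (tensor_index (m + n) r) X"
  by (auto simp: uq_mat_gens_def sq_mat_def e_mat_def f_mat_def)

lemma gens_commute:
  assumes X: "X \<in> hecke_gens m (m + n) r" and Y: "Y \<in> uq_mat_gens m n r"
  shows "mm (tensor_index (m + n) r) X Y = mm (tensor_index (m + n) r) Y X"
proof -
  obtain i where i: "i \<in> {1..<r}" "X = T_mat m (m + n) r i" using X by (auto simp: hecke_gens_def)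
  have diag: "sq_coeff m s h k l = 0" "id_coeff k l = 0" if "k \<noteq> l" for s h k l
    using that by (simp_all add: sq_coeff_def id_coeff_def)
  consider s h where "Y = sq_mat m n r s h" | j where "j \<in> simple_ix m n" "Y = e_mat m n r j"
    | j where "j \<in> simple_ix m n" "Y = f_mat m n r j"
    using Y by (auto simp: uq_mat_gens_def)
  then show ?thesis
  proof cases
    case 1
    show ?thesis unfolding 1 i(2) sq_mat_def by (rule T_mat_commutes_diag[OF i(1)]) (rule diag)
  next
    case 2
    show ?thesis unfolding 2 i(2) e_mat_def
      by (rule T_mat_commutes_coproduct[OF i(1) _ _ pair_commutes_e])
        (use 2 in \<open>auto simp: simple_ix_def diag\<close>)
  next
    case 3
    show ?thesis unfolding 3 i(2) f_mat_def
      by (rule T_mat_commutes_coproduct[OF i(1) _ _ pair_commutes_f])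
        (use 3 in \<open>auto simp: simple_ix_def diag\<close>)
  qed
qed

text \<open>The scalar part of T is diagonal, and the exchange part has coefficients symmetric in
  the two letters. This provides the closure under transposition that \<open>bicommutant\<close>
  asks for.\<close>

lemma T_mat_transpose: "(\<lambda>w u. T_mat m N r i u w) = T_mat m N r i"
proof -
  have T: "T_coeff m k l k' l' = T_coeff m k' l' k l" for k l k' l'
  proof -
    have *: "x * of_bool Q = of_bool Q * y" if "Q \<Longrightarrow> x = y" for Q and x y :: ratfun
      using that by (cases Q) simp_all
    have "T_swap m k l = T_swap m l k" unfolding T_swap_def by (simp only: mult.commute eq_commute)
    then show ?thesis
      unfolding T_coeff_eq[of m k l] T_coeff_eq'[of m k' l'] by (intro arg_cong2[of _ _ _ _ "(+)"] *) simp_all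
  qed
  show ?thesis
  proof (intro ext)
    fix w u
    show "T_mat m N r i u w = T_mat m N r i w u"
    proof (cases "w \<in> tensor_index N r \<and> u \<in> tensor_index N r")
      case True
      have "(\<Prod>j\<in>J. of_bool (u ! j = w ! j) :: ratfun) = (\<Prod>j\<in>J. of_bool (w ! j = u ! j))" for J
        by (rule prod.cong) (simp_all only: eq_commute)
      then show ?thesis
        using True T[of "u ! (i - 1)" "u ! i" "w ! (i - 1)" "w ! i"] by (simp only: T_mat_def restr_def simp_thms if_True)
    qed (simp only: T_mat_def restr_def conj_commute if_False)
  qed
qed

section \<open>Specialization of the generators at q = 1\<close>

text \<open>The coefficient q - 1/q tends to 0, and the diagonal values q and -1/q tend to 1 and -1,
  the sign of exchanging two equal letters.\<close>

lemma value_at_1_T_coeff: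
  "value_at_1 (T_coeff m k l k' l') (of_bool (k' = l \<and> l' = k) * (- 1) ^ (vpar m k * vpar m l))"
proof -
  have q: "value_at_1 (qvar - inverse qvar) 0"
    using value_at_1_diff[OF value_at_1_qvar value_at_1_inverse[OF value_at_1_qvar]] by simp
  have "value_at_1 (T_scalar m k l) (of_bool (k = l) * (- 1) ^ (vpar m k * vpar m l))"
    using value_at_1_qvar value_at_1_uminus[OF value_at_1_inverse[OF value_at_1_qvar]] q value_at_1_0
    by (cases k l rule: linorder_cases; cases "l \<le> m") (auto simp: T_scalar_values vpar_def)
  from value_at_1_mult[OF this value_at_1_of_bool]
  have 1: "value_at_1 (T_scalar m k l * of_bool (k' = k \<and> l' = l))
    (of_bool (k = l) * (- 1) ^ (vpar m k * vpar m l) * of_bool (k' = k \<and> l' = l))" .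
  have "value_at_1 (T_swap m k l) (of_bool (k \<noteq> l) * (- 1) ^ (vpar m k * vpar m l))"
    using value_at_1_sign value_at_1_0 by (auto simp: T_swap_def)
  from value_at_1_add[OF 1 value_at_1_mult[OF this value_at_1_of_bool]]
  have "value_at_1 (T_coeff m k l k' l') (of_bool (k = l) * (- 1) ^ (vpar m k * vpar m l) * of_bool (k' = k \<and> l' = l)
    + of_bool (k \<noteq> l) * (- 1) ^ (vpar m k * vpar m l) * of_bool (k' = l \<and> l' = k))"
    unfolding T_coeff_eq .
  also have "of_bool (k = l) * (- 1) ^ (vpar m k * vpar m l) * of_bool (k' = k \<and> l' = l)
    + of_bool (k \<noteq> l) * (- 1) ^ (vpar m k * vpar m l) * of_bool (k' = l \<and> l' = k)
    = (of_bool (k' = l \<and> l' = k) * (- 1) ^ (vpar m k * vpar m l) :: rat)"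
    by (cases "k = l") simp_all
  finally show ?thesis .
qed

lemma value_at_1_T_mat:
  assumes i: "i \<in> {1..<r}" and w: "w \<in> tensor_index N r" and u: "u \<in> tensor_index N r"
  shows "value_at_1 (T_mat m N r i w u) (sign_swap m N r i w u)"
proof -
  let ?J = "{..<r} - {i - 1, i}"
  have "value_at_1 (T_mat m N r i w u)
    (of_bool (u ! (i - 1) = w ! i \<and> u ! i = w ! (i - 1)) * (- 1) ^ (vpar m (w ! (i - 1)) * vpar m (w ! i))
      * (\<Prod>j\<in>?J. of_bool (u ! j = w ! j)))"
    unfolding T_mat_def restr_def
    by (simp only: w u simp_thms if_True) (intro value_at_1_mult[OF value_at_1_T_coeff value_at_1_prod] value_at_1_of_bool)
  also have "of_bool (u ! (i - 1) = w ! i \<and> u ! i = w ! (i - 1)) * (- 1) ^ (vpar m (w ! (i - 1)) * vpar m (w ! i))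
      * (\<Prod>j\<in>?J. of_bool (u ! j = w ! j)) = sign_swap m N r i w u"
  proof (cases "u = swap_ix i w")
    case True
    then have "(\<Prod>j\<in>?J. of_bool (u ! j = w ! j)) = (1 :: rat)"
      by (intro prod.neutral) (auto simp: swap_ix_def)
    moreover have "u ! (i - 1) = w ! i" "u ! i = w ! (i - 1)"
      using True i w by (auto simp: swap_ix_nth)
    ultimately show ?thesis using True w by (simp add: sign_swap_def mono_mat_def)
  next
    case False
    then obtain j where j: "j < r" "u ! j \<noteq> swap_ix i w ! j"
      using w u i nth_equalityI[of u "swap_ix i w"] by (auto simp: tensor_index_length swap_ix_def)
    have "(\<Prod>j\<in>?J. of_bool (u ! j = w ! j)) = (0 :: rat)" if "j \<noteq> i - 1" "j \<noteq> i"
      using j that by (intro prod_zero) (auto simp: swap_ix_def)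
    moreover have "\<not> (u ! (i - 1) = w ! i \<and> u ! i = w ! (i - 1))" if "j = i - 1 \<or> j = i"
      using j that i w by (auto simp: swap_ix_nth)
    ultimately show ?thesis using False by (cases "j = i - 1 \<or> j = i") (auto simp: sign_swap_def mono_mat_def)
  qed
  finally show ?thesis .
qed

text \<open>At q = 1 the torus operators disappear and only the grading operator to the power
  \<open>p\<close> survives on the left factors; the parity assumption identifies it with the Koszul
  sign of \<open>place\<close>.\<close>

lemma value_at_1_coproduct_term:
  assumes k: "k < r" and w: "w \<in> tensor_index N r" and u: "u \<in> tensor_index N r"
    and S: "\<And>x y. value_at_1 (S x y) (of_bool (y = x) * ((- 1) ^ vpar m x) ^ p)"
    and E: "\<And>x y. value_at_1 (E x y) (of_bool (x = a \<and> y = b))"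
    and L: "\<And>x y. value_at_1 (L x y) (of_bool (y = x))"
    and p: "even (p + (vpar m a + vpar m b))"
  shows "value_at_1 (tensor_coeff (replicate k S @ [E] @ replicate (r - Suc k) L) w u) (place m N r a b k w u)"
proof -
  define h :: "nat \<Rightarrow> rat" where "h j = (if j < k then of_bool (u ! j = w ! j) * ((- 1) ^ vpar m (w ! j)) ^ p
    else if j = k then of_bool (w ! j = a \<and> u ! j = b) else of_bool (u ! j = w ! j))" for j
  let ?As = "replicate k S @ [E] @ replicate (r - Suc k) L"
  have "value_at_1 (\<Prod>j<length ?As. (?As ! j) (w ! j) (u ! j)) (\<Prod>j<length ?As. h j)"
    by (rule value_at_1_prod) (use S E L in \<open>auto simp: h_def nth_append nth_Cons' split: if_splits\<close>)
  moreover have "(\<Prod>j<length ?As. h j) = place m N r a b k w u"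
  proof (cases "w ! k = a \<and> u = w[k := b]")
    case True
    have "(\<Prod>j<length ?As. h j) = (\<Prod>j<k. h j)"
      by (rule prod.mono_neutral_right) (use True k w in \<open>auto simp: h_def tensor_index_length\<close>)
    also have "\<dots> = (\<Prod>j<k. (- 1) ^ (p * vpar m (w ! j)))"
      using True by (intro prod.cong) (auto simp: h_def mult.commute simp flip: power_mult)
    also have "\<dots> = (- 1) ^ (p * (\<Sum>j<k. vpar m (w ! j)))"
      by (simp add: power_sum sum_distrib_left)
    also have "\<dots> = (- 1) ^ ((vpar m a + vpar m b) * (\<Sum>j<k. vpar m (w ! j)))"
      by (rule minus_one_power_cong) (use p in auto)
    finally show ?thesis using True w by (simp add: place_def mono_mat_def)
  next
    case False
    have "\<exists>j<r. h j = 0"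
    proof (rule ccontr)
      assume "\<not> ?thesis"
      then have nz: "h j \<noteq> 0" if "j < r" for j using that by auto
      have "u ! j = w[k := b] ! j" if "j < r" for j
        using nz[OF that] that w by (auto simp: h_def tensor_index_length nth_list_update split: if_splits)
      then have "u = w[k := b]" using w u by (intro nth_equalityI) (auto simp: tensor_index_length)
      moreover have "w ! k = a" using nz[OF k] by (auto simp: h_def split: if_splits)
      ultimately show False using False by simp
    qed
    moreover have "length ?As = r" using k by simp
    ultimately have "(\<Prod>j<length ?As. h j) = 0" by (intro prod_zero) auto
    then show ?thesis using False by (simp add: place_def mono_mat_def)
  qed
  ultimately show ?thesis unfolding tensor_coeff_def by simp
qed

lemma value_at_1_sq_coeff: "value_at_1 (sq_coeff m s h x y) (of_bool (y = x) * ((- 1) ^ vpar m x) ^ s)"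
  using value_at_1_mult[OF value_at_1_power[OF value_at_1_sign, of "vpar m x" s] value_at_1_q_powi] value_at_1_0
  by (auto simp: sq_coeff_def)

lemma value_at_1_coproduct:
  assumes w: "w \<in> tensor_index N r" and u: "u \<in> tensor_index N r"
    and "\<And>x y. value_at_1 (S x y) (of_bool (y = x) * ((- 1) ^ vpar m x) ^ p)"
    and "\<And>x y. value_at_1 (E x y) (of_bool (x = a \<and> y = b))"
    and "\<And>x y. value_at_1 (L x y) (of_bool (y = x))"
    and "even (p + (vpar m a + vpar m b))"
  shows "value_at_1 (\<Sum>k\<in>{1..r}. tensor_coeff (replicate (k - 1) S @ [E] @ replicate (r - k) L) w u)
    (total_place m N r a b w u)"
proof -
  have "(\<Sum>k\<in>{1..r}. tensor_coeff (replicate (k - 1) S @ [E] @ replicate (r - k) L) w u)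
    = (\<Sum>k<r. tensor_coeff (replicate k S @ [E] @ replicate (r - Suc k) L) w u)"
    by (rule sum.reindex_bij_witness[of _ Suc "\<lambda>k. k - 1"]) auto
  then show ?thesis unfolding total_place_def
    by (simp only:, intro value_at_1_sum value_at_1_coproduct_term[OF _ assms]) simp
qed

lemma simple_parity: "even (gpar m i + (vpar m i + vpar m (i + 1)))" if "1 \<le> i" for i
  using that by (auto simp: gpar_def vpar_def)

lemma sum_of_bool_lessThan:
  fixes r :: nat
  shows "(\<Sum>k<r. of_bool (P k) :: 'a::semiring_1) = of_nat (card {k. k < r \<and> P k})"
proof -
  have "(\<Sum>k<r. of_bool (P k) :: 'a) = (\<Sum>k\<in>{k \<in> {..<r}. P k}. 1)"
    unfolding of_bool_def by (rule sum.inter_filter[symmetric]) simp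
  then show ?thesis by simp
qed

text \<open>The parity \<open>vpar m a\<close> occurs twice in the exponent, so the sign is trivial
  and each factor carrying \<open>a\<close> contributes 1.\<close>

lemma total_place_diag:
  assumes "w \<in> tensor_index N r" "u \<in> tensor_index N r"
  shows "total_place m N r a a w u = (if u = w then of_nat (card {k. k < r \<and> w ! k = a}) else 0)"
proof -
  have "place m N r a a k w u = (if u = w then of_bool (w ! k = a) else 0)" if "k < r" for k
    using assms by (auto simp: place_def mono_mat_def list_update_same_conv tensor_index_length that)
  then have "total_place m N r a a w u = (\<Sum>k<r. if u = w then of_bool (w ! k = a) else 0)"
    unfolding total_place_def by (intro sum.cong) auto
  also have "\<dots> = (if u = w then of_nat (card {k. k < r \<and> w ! k = a}) else 0)"
    using sum_of_bool_lessThan[of "\<lambda>k. w ! k = a" r, where ?'a = rat] by (cases "u = w") simp_all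
  finally show ?thesis .
qed

lemma sq_mat_eps:
  assumes "w \<in> tensor_index (m + n) r" "u \<in> tensor_index (m + n) r"
  shows "sq_mat m n r 0 (eps a) w u = (if u = w then qvar ^ card {k. k < r \<and> w ! k = a} else 0)"
proof (cases "u = w")
  case True
  have "sq_mat m n r 0 (eps a) w w = (\<Prod>k<r. qvar ^ (of_bool (w ! k = a)))"
    using assms(1) by (auto simp: sq_mat_def restr_def tensor_coeff_def sq_coeff_def eps_def intro!: prod.cong)
  also have "\<dots> = qvar ^ (\<Sum>k<r. of_bool (w ! k = a))" by (rule power_sum[symmetric])
  also have "(\<Sum>k<r. of_bool (w ! k = a)) = card {k. k < r \<and> w ! k = a}"
    using sum_of_bool_lessThan[of "\<lambda>k. w ! k = a" r, where ?'a = nat] by simp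
  finally show ?thesis using True by simp
next
  case False
  then obtain k where "k < r" "u ! k \<noteq> w ! k"
    using assms nth_equalityI[of u w] by (auto simp: tensor_index_length)
  then have "tensor_coeff (replicate r (sq_coeff m 0 (eps a))) w u = 0"
    unfolding tensor_coeff_def by (intro prod_zero) (auto simp: sq_coeff_def)
  then show ?thesis using False by (simp add: sq_mat_def restr_def)
qed

text \<open>The diagonal placements are the values at \<open>q = 1\<close> of \<open>(q^h - 1) / (q - 1)\<close>.\<close>

lemma malg_specialization:
  fixes m n r :: nat
  defines "I \<equiv> tensor_index (m + n) r"
  assumes "M \<in> malg I {total_place m (m + n) r a b | a b. a \<in> {1..m + n} \<and> (b = a \<or> b \<in> {1..m + n} \<and> (b = a + 1 \<or> a = b + 1))}"
  shows "\<exists>b\<in>malg I (uq_mat_gens m n r). \<forall>w\<in>I. \<forall>u\<in>I. value_at_1 (b w u) (M w u)"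
  using assms(2)
proof induction
  case (gen X)
  then obtain a b where X: "X = total_place m (m + n) r a b" and a: "a \<in> {1..m + n}"
    and ab: "b = a \<or> b \<in> {1..m + n} \<and> (b = a + 1 \<or> a = b + 1)" by blast
  consider "b = a" | "b \<in> simple_ix m n" "a = b + 1" | "a \<in> simple_ix m n" "b = a + 1"
    using a ab by (auto simp: simple_ix_def)
  then show ?case
  proof cases
    case 1
    let ?b = "\<lambda>w u. (1 / (qvar - 1)) * (sq_mat m n r 0 (eps a) w u - mat_one I w u)"
    have "eps a \<in> lattice m n" using a by (auto simp: lattice_def eps_def)
    then have B: "?b \<in> malg I (uq_mat_gens m n r)"
      by (intro malg.scale malg_diff malg.one malg.gen) (auto simp: uq_mat_gens_def)
    have V: "value_at_1 (?b w u) (X w u)" if wu: "w \<in> I" "u \<in> I" for w u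
      using wu value_at_1_quantum_integer value_at_1_0
      by (auto simp: X 1 total_place_diag sq_mat_eps mat_one_def I_def)
    show ?thesis by (rule bexI[OF _ B]) (intro ballI V)
  next
    case 2
    have V: "value_at_1 (e_mat m n r b w u) (X w u)" if wu: "w \<in> I" "u \<in> I" for w u
    proof -
      have "value_at_1 (e_coeff b x y) (of_bool (x = b + 1 \<and> y = b))"
        "value_at_1 (sq_coeff m 0 h x y) (of_bool (y = x))" for h x y
        using value_at_1_sq_coeff[of m 0 h x y] unfolding e_coeff_def by (simp_all add: value_at_1_of_bool)
      moreover have "even (gpar m b + (vpar m (b + 1) + vpar m b))"
        using simple_parity[of b m] 2(1) by (simp add: simple_ix_def add.commute)
      ultimately show ?thesis
        using value_at_1_coproduct[OF wu[unfolded I_def] value_at_1_sq_coeff] wu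
        unfolding e_mat_def restr_def X 2(2) by (simp only: I_def simp_thms if_True)
    qed
    have B: "e_mat m n r b \<in> malg I (uq_mat_gens m n r)"
      using 2(1) by (intro malg.gen) (auto simp: uq_mat_gens_def)
    show ?thesis by (rule bexI[OF _ B]) (intro ballI V)
  next
    case 3
    have V: "value_at_1 (f_mat m n r a w u) (X w u)" if wu: "w \<in> I" "u \<in> I" for w u
    proof -
      have "value_at_1 (f_coeff a x y) (of_bool (x = a \<and> y = a + 1))"
        "value_at_1 (id_coeff x y) (of_bool (y = x))" for x y
        unfolding f_coeff_def id_coeff_def by (simp_all only: value_at_1_of_bool)
      moreover have "even (gpar m a + (vpar m a + vpar m (a + 1)))"
        using simple_parity[of a m] 3(1) by (simp add: simple_ix_def)
      ultimately show ?thesis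
        using value_at_1_coproduct[OF wu[unfolded I_def] value_at_1_sq_coeff] wu
        unfolding f_mat_def restr_def X 3(2) by (simp only: I_def simp_thms if_True)
    qed
    have B: "f_mat m n r a \<in> malg I (uq_mat_gens m n r)"
      using 3(1) by (intro malg.gen) (auto simp: uq_mat_gens_def)
    show ?thesis by (rule bexI[OF _ B]) (intro ballI V)
  qed
next
  case one
  then show ?case by (intro bexI[of _ "mat_one I"]) (auto simp: mat_one_def malg.one value_at_1_of_bool)
next
  case (add X Y)
  then obtain b c where "b \<in> malg I (uq_mat_gens m n r)" "\<forall>w\<in>I. \<forall>u\<in>I. value_at_1 (b w u) (X w u)"
    "c \<in> malg I (uq_mat_gens m n r)" "\<forall>w\<in>I. \<forall>u\<in>I. value_at_1 (c w u) (Y w u)" by blast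
  then show ?case by (intro bexI[of _ "\<lambda>w u. b w u + c w u"]) (auto intro: malg.add value_at_1_add)
next
  case (scale X c)
  then obtain b where "b \<in> malg I (uq_mat_gens m n r)" "\<forall>w\<in>I. \<forall>u\<in>I. value_at_1 (b w u) (X w u)" by blast
  moreover obtain x where "value_at_1 x c" using value_at_1_rat by blast
  ultimately show ?case by (intro bexI[of _ "\<lambda>w u. x * b w u"]) (auto intro: malg.scale value_at_1_mult)
next
  case (mult X Y)
  then obtain b c where "b \<in> malg I (uq_mat_gens m n r)" "\<forall>w\<in>I. \<forall>u\<in>I. value_at_1 (b w u) (X w u)"
    "c \<in> malg I (uq_mat_gens m n r)" "\<forall>w\<in>I. \<forall>u\<in>I. value_at_1 (c w u) (Y w u)" by blast
  then show ?case
    by (intro bexI[of _ "mm I b c"]) (auto simp: mm_def intro: malg.mult intro!: value_at_1_sum value_at_1_mult)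
qed

section \<open>The commutant of the Hecke algebra\<close>

lemma hecke_commutant_subset:
  fixes m n r :: nat
  defines "I \<equiv> tensor_index (m + n) r"
  shows "mat_commutant I (malg I (hecke_gens m (m + n) r)) \<subseteq> malg I (uq_mat_gens m n r)"
proof
  fix x assume x: "x \<in> mat_commutant I (malg I (hecke_gens m (m + n) r))"
  have fin: "finite I" by (simp add: I_def)
  have sq: "\<And>Y. Y \<in> uq_mat_gens m n r \<Longrightarrow> on_square I Y" "\<And>Y. Y \<in> hecke_gens m (m + n) r \<Longrightarrow> on_square I Y"
    by (simp_all add: I_def on_square_uq_gens on_square_hecke_gens)
  have gc: "mm I X Y = mm I Y X" if "X \<in> uq_mat_gens m n r" "Y \<in> hecke_gens m (m + n) r" for X Y
    using gens_commute[OF that(2,1)] by (simp add: I_def)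
  have "\<exists>P\<in>malg I (uq_mat_gens m n r). \<forall>Y\<in>malg I (uq_mat_gens m n r). (\<Sum>w\<in>I. \<Sum>u\<in>I. (x w u - P w u) * Y w u) = 0"
    by (rule malg_projection[OF fin sq(1)], assumption) (rule sum_squares_ratfun, use fin in auto)
  then obtain P where P: "P \<in> malg I (uq_mat_gens m n r)"
    and orth: "\<And>Y. Y \<in> malg I (uq_mat_gens m n r) \<Longrightarrow> (\<Sum>w\<in>I. \<Sum>u\<in>I. (x w u - P w u) * Y w u) = 0"
    by blast
  define y where "y = (\<lambda>w u. x w u - P w u)"
  \<comment> \<open>The quantum generators commute with the Hecke generators, so \<open>P\<close>
    lies in the commutant, and with it the difference \<open>y\<close>, which is orthogonal to the
    quantum algebra.\<close>
  have "P \<in> mat_commutant I (malg I (hecke_gens m (m + n) r))"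
    using malg_subset_commutant[OF fin gc sq] P by blast
  then have comm: "mm I y X = mm I X y" if "X \<in> hecke_gens m (m + n) r" for X
    using x malg.gen[OF that, of I] by (simp add: y_def mm_diff mat_commutant_def)
  have y0: "\<forall>p\<in>I \<times> I. case_prod y p = 0"
  proof (rule ccontr)
    assume "\<not> ?thesis"
    then obtain p0 where p0: "p0 \<in> I \<times> I" "case_prod y p0 \<noteq> 0"
      and "\<forall>p\<in>I \<times> I. \<exists>c. value_at_1 (case_prod y p / case_prod y p0) c"
      using normalize_at_1[of "I \<times> I" "case_prod y"] fin by blast
    then obtain g where g: "\<And>p. p \<in> I \<times> I \<Longrightarrow> value_at_1 (case_prod y p / case_prod y p0) (g p)" by metis
    define c where "c = 1 / case_prod y p0"
    \<comment> \<open>The values at q = 1 after division by the entry at \<open>p0\<close>, so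
      \<open>M\<close> has entry 1 there.\<close>
    define M where "M = (\<lambda>w u. if w \<in> I \<and> u \<in> I then g (w, u) else 0)"
    have M: "value_at_1 (c * y w u) (M w u)" if "w \<in> I" "u \<in> I" for w u
      using g[of "(w, u)"] that by (simp add: M_def c_def)
    have Msq: "on_square I M" by (auto simp: on_square_def M_def)
    have "mm I M (sign_swap m (m + n) r i) = mm I (sign_swap m (m + n) r i) M" if i: "i \<in> {1..<r}" for i
    proof (rule mat_eqI)
      fix w u assume wu: "w \<in> I" "u \<in> I"
      note T = value_at_1_T_mat[OF i, where N = "m + n" and m = m, folded I_def]
      \<comment> \<open>Both sides of the commutation relation with T_i are specialized; T_i becomes
        the signed swap, and uniqueness of values transfers the relation to
        \<open>M\<close>.\<close>
      have "value_at_1 (mm I (\<lambda>w u. c * y w u) (T_mat m (m + n) r i) w u) (mm I M (sign_swap m (m + n) r i) w u)"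
        unfolding mm_def by (intro value_at_1_sum value_at_1_mult M T wu)
      moreover have "value_at_1 (mm I (T_mat m (m + n) r i) (\<lambda>w u. c * y w u) w u) (mm I (sign_swap m (m + n) r i) M w u)"
        unfolding mm_def by (intro value_at_1_sum value_at_1_mult M T wu)
      moreover have "T_mat m (m + n) r i \<in> hecke_gens m (m + n) r" using i by (auto simp: hecke_gens_def)
      ultimately show "mm I M (sign_swap m (m + n) r i) w u = mm I (sign_swap m (m + n) r i) M w u"
        using comm value_at_1_unique by (auto simp: mm_scale)
    qed (use Msq on_square_sign_swap[OF i, of "m + n" m] in \<open>auto simp: I_def\<close>)
    note swap_comm = this
    \<comment> \<open>Only units between equal or neighbouring letters occur here, those that
      \<open>malg_specialization\<close> lifts directly.\<close>
    let ?G = "{total_place m (m + n) r a b | a b. a \<in> {1..m + n} \<and> (b = a \<or> b \<in> {1..m + n} \<and> (b = a + 1 \<or> a = b + 1))}"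
    have "total_place m (m + n) r a b \<in> malg I ?G" if "a \<in> {1..m + n}" "b \<in> {1..m + n}" for a b
      unfolding I_def
    proof (rule total_place_in_malg[OF _ _ _ that])
      fix i assume "i \<in> {1..<m + n}"
      then have "i \<in> {1..m + n}" "i + 1 \<in> {1..m + n}" by auto
      then show "total_place m (m + n) r (i + 1) i \<in> malg (tensor_index (m + n) r) ?G"
        "total_place m (m + n) r i (i + 1) \<in> malg (tensor_index (m + n) r) ?G"
        by (intro malg.gen; blast)+
    qed (intro malg.gen; blast)
    from signed_symmetric_in_malg[OF this[unfolded I_def] Msq[unfolded I_def] swap_comm[unfolded I_def], folded I_def]
    have "M \<in> malg I ?G" .
    from malg_specialization[OF this[unfolded I_def], folded I_def]
    obtain b where b: "b \<in> malg I (uq_mat_gens m n r)" "\<And>w u. w \<in> I \<Longrightarrow> u \<in> I \<Longrightarrow> value_at_1 (b w u) (M w u)"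
      by blast
    have "value_at_1 (\<Sum>w\<in>I. \<Sum>u\<in>I. c * y w u * b w u) (\<Sum>w\<in>I. \<Sum>u\<in>I. M w u * M w u)"
      by (intro value_at_1_sum value_at_1_mult M b)
    moreover have "(\<Sum>w\<in>I. \<Sum>u\<in>I. c * y w u * b w u) = c * (\<Sum>w\<in>I. \<Sum>u\<in>I. y w u * b w u)"
      by (simp add: sum_distrib_left mult.assoc)
    ultimately have "(\<Sum>w\<in>I. \<Sum>u\<in>I. M w u * M w u) = 0"
      using orth[OF b(1)] value_at_1_unique[OF _ value_at_1_0] by (simp add: y_def)
    then have "(\<Sum>p\<in>I \<times> I. case_prod M p * case_prod M p) = 0"
      by (simp add: sum.cartesian_product split_beta)
    then have "case_prod M p0 * case_prod M p0 = 0"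
      using p0(1) fin by (subst (asm) sum_nonneg_eq_0_iff) auto
    moreover have "case_prod M p0 = g p0" using p0(1) by (auto simp: M_def)
    moreover have "g p0 = 1" using g[OF p0(1)] p0(2) value_at_1_unique[OF _ value_at_1_1] by simp
    ultimately show False by simp
  qed
  have "x = P"
    by (rule mat_eqI[OF _ malg_on_square[OF P sq(1)]]) (use x y0 in \<open>auto simp: mat_commutant_def y_def\<close>)
  then show "x \<in> malg I (uq_mat_gens m n r)" using P by simp
qed

theorem matrix_duality:
  fixes m n r :: nat
  defines "I \<equiv> tensor_index (m + n) r"
  shows "mat_commutant I (malg I (uq_mat_gens m n r)) = malg I (hecke_gens m (m + n) r)"
    and "mat_commutant I (malg I (hecke_gens m (m + n) r)) = malg I (uq_mat_gens m n r)"
proof -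
  have fin: "finite I" by (simp add: I_def)
  have sq: "\<And>Y. Y \<in> uq_mat_gens m n r \<Longrightarrow> on_square I Y" "\<And>Y. Y \<in> hecke_gens m (m + n) r \<Longrightarrow> on_square I Y"
    by (simp_all add: I_def on_square_uq_gens on_square_hecke_gens)
  have gc: "mm I X Y = mm I Y X" if "X \<in> uq_mat_gens m n r" "Y \<in> hecke_gens m (m + n) r" for X Y
    using gens_commute[OF that(2,1)] by (simp add: I_def)
  show 2: "mat_commutant I (malg I (hecke_gens m (m + n) r)) = malg I (uq_mat_gens m n r)"
    using hecke_commutant_subset[of m n r, folded I_def]
      malg_subset_commutant[OF fin gc sq] by blast
  show "mat_commutant I (malg I (uq_mat_gens m n r)) = malg I (hecke_gens m (m + n) r)"
  proof
    show "mat_commutant I (malg I (uq_mat_gens m n r)) \<subseteq> malg I (hecke_gens m (m + n) r)"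
    proof
      fix x assume "x \<in> mat_commutant I (malg I (uq_mat_gens m n r))"
      then have x: "x \<in> mat_commutant I (mat_commutant I (malg I (hecke_gens m (m + n) r)))" by (simp only: 2)
      show "x \<in> malg I (hecke_gens m (m + n) r)"
      proof (rule bicommutant[OF fin sq(2) _ _ x])
        fix Y assume Y: "Y \<in> hecke_gens m (m + n) r"
        then have "(\<lambda>w u. Y u w) = Y" unfolding hecke_gens_def by (elim imageE) (simp only: T_mat_transpose)
        then show "(\<lambda>w u. Y u w) \<in> malg I (hecke_gens m (m + n) r)"
          using malg.gen[OF Y] by (simp only:)
      qed (assumption, rule sum_squares_ratfun, use fin in auto)
    qed
    show "malg I (hecke_gens m (m + n) r) \<subseteq> mat_commutant I (malg I (uq_mat_gens m n r))"
      using malg_subset_commutant[OF fin gc[symmetric] sq(2,1)] by blast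
  qed
qed

section \<open>Operators on tensor space\<close>

lemma tensor_End_simps:
  "\<phi> \<otimes>\<^bsub>tensor_End N r\<^esub> \<psi> = (\<lambda>x\<in>tensor_space N r. \<phi> (\<psi> x))"
  "\<phi> \<oplus>\<^bsub>tensor_End N r\<^esub> \<psi> = (\<lambda>x\<in>tensor_space N r. \<lambda>u. \<phi> x u + \<psi> x u)"
  by (simp_all add: tensor_End_def Let_def)

lemma matrix_op_apply:
  "x \<in> tensor_space N r \<Longrightarrow>
    matrix_op N r A x u = (if u \<in> tensor_index N r then \<Sum>w\<in>tensor_index N r. x w * A w u else 0)"
  by (simp add: matrix_op_def)

lemma matrix_op_in_space: "x \<in> tensor_space N r \<Longrightarrow> matrix_op N r A x \<in> tensor_space N r"
  by (simp add: tensor_space_def matrix_op_def)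

lemma tensor_space_add: "x \<in> tensor_space N r \<Longrightarrow> y \<in> tensor_space N r \<Longrightarrow> (\<lambda>u. x u + y u) \<in> tensor_space N r"
  by (simp add: tensor_space_def)

lemma tensor_space_scale: "x \<in> tensor_space N r \<Longrightarrow> (\<lambda>u. c * x u) \<in> tensor_space N r"
  by (simp add: tensor_space_def)

lemma matrix_op_closed: "matrix_op N r A \<in> carrier (tensor_End N r)"
proof -
  have "matrix_op N r A (\<lambda>u. x u + y u) = (\<lambda>u. matrix_op N r A x u + matrix_op N r A y u)"
    if "x \<in> tensor_space N r" "y \<in> tensor_space N r" for x y
    using that tensor_space_add[OF that] by (simp add: matrix_op_apply fun_eq_iff distrib_right sum.distrib)
  moreover have "matrix_op N r A (\<lambda>u. c * x u) = (\<lambda>u. c * matrix_op N r A x u)"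
    if "x \<in> tensor_space N r" for x c
    using that tensor_space_scale[OF that] by (simp add: matrix_op_apply fun_eq_iff sum_distrib_left mult.assoc)
  moreover have "matrix_op N r A \<in> tensor_space N r \<rightarrow>\<^sub>E tensor_space N r"
    using matrix_op_in_space by (auto simp: PiE_def extensional_def) (simp add: matrix_op_def)
  ultimately show ?thesis by (simp add: tensor_End_def Let_def)
qed

lemma matrix_op_restr: "matrix_op N r (restr (tensor_index N r) A) = matrix_op N r A"
  by (auto simp: matrix_op_def restr_def restrict_def fun_eq_iff intro!: sum.cong)

text \<open>\<open>tensor_End\<close> composes from right to left, whereas \<open>mm\<close>
  multiplies row-vector matrices from left to right. Commutation is insensitive to this
  reversal.\<close>

lemma matrix_op_mult:
  "matrix_op N r A \<otimes>\<^bsub>tensor_End N r\<^esub> matrix_op N r B = matrix_op N r (mm (tensor_index N r) B A)"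
proof -
  have "(\<Sum>w\<in>tensor_index N r. (\<Sum>v\<in>tensor_index N r. x v * B v w) * A w u)
    = (\<Sum>v\<in>tensor_index N r. x v * mm (tensor_index N r) B A v u)" for x u
    unfolding mm_def sum_distrib_left sum_distrib_right mult.assoc by (rule sum.swap)
  then show ?thesis
    by (auto simp: tensor_End_simps fun_eq_iff restrict_def matrix_op_apply matrix_op_in_space) (simp_all add: matrix_op_def)
qed

lemma matrix_op_add:
  "matrix_op N r A \<oplus>\<^bsub>tensor_End N r\<^esub> matrix_op N r B = matrix_op N r (\<lambda>w u. A w u + B w u)"
  by (auto simp: tensor_End_simps matrix_op_def fun_eq_iff restrict_def distrib_left sum.distrib)

lemma scalar_op_matrix: "scalar_op N r c = matrix_op N r (\<lambda>w u. c * mat_one (tensor_index N r) w u)"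
proof -
  have "c * x u = (if u \<in> tensor_index N r then \<Sum>w\<in>tensor_index N r. x w * (c * mat_one (tensor_index N r) w u) else 0)"
    if "x \<in> tensor_space N r" for x u
  proof (cases "u \<in> tensor_index N r")
    case True
    have "(\<Sum>w\<in>tensor_index N r. x w * (c * mat_one (tensor_index N r) w u))
      = (\<Sum>w\<in>tensor_index N r. if w = u then c * x u else 0)"
      by (intro sum.cong) (auto simp: mat_one_def)
    then show ?thesis using True by simp
  next
    case False
    then show ?thesis using that by (simp add: tensor_space_def)
  qed
  then show ?thesis by (simp add: scalar_op_def matrix_op_def restrict_def fun_eq_iff)
qed

lemma scalar_op_mult:
  assumes "on_square (tensor_index N r) A"
  shows "scalar_op N r c \<otimes>\<^bsub>tensor_End N r\<^esub> matrix_op N r A = matrix_op N r (\<lambda>w u. c * A w u)"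
  using assms by (simp add: scalar_op_matrix matrix_op_mult mm_scale)

definition unit_tensor :: "nat list \<Rightarrow> nat list \<Rightarrow> ratfun" where
  "unit_tensor w u = of_bool (u = w)"

lemma unit_tensor_in_space: "w \<in> tensor_index N r \<Longrightarrow> unit_tensor w \<in> tensor_space N r"
  by (auto simp: unit_tensor_def tensor_space_def)

lemma matrix_op_unit:
  assumes "w \<in> tensor_index N r" "u \<in> tensor_index N r"
  shows "matrix_op N r A (unit_tensor w) u = A w u"
proof -
  have "(\<Sum>v\<in>tensor_index N r. unit_tensor w v * A v u) = (\<Sum>v\<in>tensor_index N r. if v = w then A w u else 0)"
    by (intro sum.cong) (auto simp: unit_tensor_def)
  then show ?thesis using assms by (simp add: matrix_op_apply unit_tensor_in_space)
qed

lemma matrix_op_inject: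
  assumes "matrix_op N r A = matrix_op N r B" "on_square (tensor_index N r) A" "on_square (tensor_index N r) B"
  shows "A = B"
  using assms(2,3) by (rule mat_eqI) (metis assms(1) matrix_op_unit)

lemma tensor_End_matrix:
  assumes \<phi>: "\<phi> \<in> carrier (tensor_End N r)"
  shows "\<exists>A. on_square (tensor_index N r) A \<and> \<phi> = matrix_op N r A"
proof -
  let ?I = "tensor_index N r" and ?W = "tensor_space N r"
  have W: "\<phi> \<in> ?W \<rightarrow>\<^sub>E ?W" and add: "\<And>x y. x \<in> ?W \<Longrightarrow> y \<in> ?W \<Longrightarrow> \<phi> (\<lambda>u. x u + y u) = (\<lambda>u. \<phi> x u + \<phi> y u)"
    and scale: "\<And>c x. x \<in> ?W \<Longrightarrow> \<phi> (\<lambda>u. c * x u) = (\<lambda>u. c * \<phi> x u)"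
    using \<phi> by (auto simp: tensor_End_def Let_def)
  define A where "A = restr ?I (\<lambda>w u. \<phi> (unit_tensor w) u)"
  have zero: "(\<lambda>u. 0) \<in> ?W" by (simp add: tensor_space_def)
  \<comment> \<open>Membership of the partial sums is carried through the induction, since
    additivity is available only for elements of \<open>tensor_space\<close>.\<close>
  have expand: "\<phi> (\<lambda>u. \<Sum>w\<in>S. x w * unit_tensor w u) = (\<lambda>u. \<Sum>w\<in>S. x w * \<phi> (unit_tensor w) u)
      \<and> (\<lambda>u. \<Sum>w\<in>S. x w * unit_tensor w u) \<in> ?W" if "finite S" "S \<subseteq> ?I" for S x
    using that
  proof (induction S rule: finite_induct)
    case empty
    then show ?case using scale[OF zero, of 0] zero by simp
  next
    case (insert w S)
    have "unit_tensor w \<in> ?W" using insert.prems by (simp add: unit_tensor_in_space)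
    note w = this tensor_space_scale[OF this, of "x w"]
    have S: "\<phi> (\<lambda>u. \<Sum>w\<in>S. x w * unit_tensor w u) = (\<lambda>u. \<Sum>w\<in>S. x w * \<phi> (unit_tensor w) u)"
      "(\<lambda>u. \<Sum>w\<in>S. x w * unit_tensor w u) \<in> ?W" using insert by auto
    show ?case
      using add[OF w(2) S(2)] tensor_space_add[OF w(2) S(2)] insert.hyps by (simp add: S(1) scale[OF w(1)])
  qed
  have "\<phi> x u = matrix_op N r A x u" if x: "x \<in> ?W" for x u
  proof (cases "u \<in> ?I")
    case True
    have "(\<lambda>u. \<Sum>w\<in>?I. x w * unit_tensor w u) = x"
    proof
      fix u
      have "(\<Sum>w\<in>?I. x w * unit_tensor w u) = (\<Sum>w\<in>?I. if w = u then x u else 0)"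
        by (intro sum.cong) (auto simp: unit_tensor_def)
      then show "(\<Sum>w\<in>?I. x w * unit_tensor w u) = x u" using x by (simp add: tensor_space_def)
    qed
    then have "\<phi> x u = (\<Sum>w\<in>?I. x w * \<phi> (unit_tensor w) u)"
      using expand[of ?I x] by simp
    also have "\<dots> = matrix_op N r A x u"
      using True x by (simp add: matrix_op_apply A_def restr_def)
    finally show ?thesis .
  next
    case False
    then show ?thesis using W x by (auto simp: matrix_op_apply tensor_space_def PiE_def Pi_def)
  qed
  then have "\<phi> = matrix_op N r A"
    using W by (auto simp: fun_eq_iff PiE_def extensional_def matrix_op_def)
  then show ?thesis by (intro exI[of _ A]) (simp add: A_def)
qed

lemma commutant_matrix_op:
  assumes S: "\<And>X. X \<in> S \<Longrightarrow> on_square (tensor_index N r) X"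
  shows "commutant (tensor_End N r) (matrix_op N r ` S) = matrix_op N r ` mat_commutant (tensor_index N r) S"
proof -
  have comm: "matrix_op N r A \<otimes>\<^bsub>tensor_End N r\<^esub> matrix_op N r X = matrix_op N r X \<otimes>\<^bsub>tensor_End N r\<^esub> matrix_op N r A
    \<longleftrightarrow> mm (tensor_index N r) A X = mm (tensor_index N r) X A"
    if "on_square (tensor_index N r) A" "X \<in> S" for A X
    using that S unfolding matrix_op_mult by (metis matrix_op_inject on_square_intros(6))
  show ?thesis
  proof
    show "commutant (tensor_End N r) (matrix_op N r ` S) \<subseteq> matrix_op N r ` mat_commutant (tensor_index N r) S"
    proof
      fix \<phi> assume \<phi>: "\<phi> \<in> commutant (tensor_End N r) (matrix_op N r ` S)"
      then obtain A where A: "on_square (tensor_index N r) A" "\<phi> = matrix_op N r A"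
        using tensor_End_matrix[of \<phi>] unfolding commutant_def by blast
      then have "A \<in> mat_commutant (tensor_index N r) S"
        using \<phi> comm[OF A(1)] by (auto simp: commutant_def mat_commutant_def)
      then show "\<phi> \<in> matrix_op N r ` mat_commutant (tensor_index N r) S" using A by blast
    qed
    show "matrix_op N r ` mat_commutant (tensor_index N r) S \<subseteq> commutant (tensor_End N r) (matrix_op N r ` S)"
      using comm by (auto simp: commutant_def mat_commutant_def matrix_op_closed)
  qed
qed

text \<open>\<open>T\<close> stands for the image of a representation, which is known to contain the
  scalars and to be closed under sums and products; scaling a matrix is recovered as multiplication
  by a scalar operator.\<close>

lemma matrix_op_malg_subset:
  assumes G: "\<And>X. X \<in> G \<Longrightarrow> matrix_op N r X \<in> T" "\<And>X. X \<in> G \<Longrightarrow> on_square (tensor_index N r) X"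
    and scalar: "\<And>c. scalar_op N r c \<in> T"
    and add: "\<And>x y. x \<in> T \<Longrightarrow> y \<in> T \<Longrightarrow> x \<oplus>\<^bsub>tensor_End N r\<^esub> y \<in> T"
    and mult: "\<And>x y. x \<in> T \<Longrightarrow> y \<in> T \<Longrightarrow> x \<otimes>\<^bsub>tensor_End N r\<^esub> y \<in> T"
  shows "matrix_op N r ` malg (tensor_index N r) G \<subseteq> T"
proof -
  have "matrix_op N r X \<in> T" if "X \<in> malg (tensor_index N r) G" for X
    using that
  proof induction
    case one
    then show ?case using scalar[of 1] by (simp add: scalar_op_matrix)
  next
    case (scale X c)
    then show ?case
      using mult[OF scalar scale.IH, of c] malg_on_square[OF scale.hyps G(2)] by (simp add: scalar_op_mult)
  next
    case (add X Y)
    then show ?case using assms(4)[OF add.IH] by (simp add: matrix_op_add)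
  next
    case (mult X Y)
    then show ?case using assms(5)[OF mult.IH(2,1)] by (simp add: matrix_op_mult)
  qed (rule G)
  then show ?thesis by blast
qed

text \<open>Multiplicative in either order, so that right representations are covered as well.\<close>

lemma free_algebra_image:
  fixes g :: "'g fpoly \<Rightarrow> operator"
  assumes add: "\<And>x y. x \<in> carrier (free_algebra S) \<Longrightarrow> y \<in> carrier (free_algebra S) \<Longrightarrow>
      g (x + y) = g x \<oplus>\<^bsub>tensor_End N r\<^esub> g y"
    and mult: "\<And>x y. x \<in> carrier (free_algebra S) \<Longrightarrow> y \<in> carrier (free_algebra S) \<Longrightarrow>
      g (x * y) = g x \<otimes>\<^bsub>tensor_End N r\<^esub> g y \<or> g (x * y) = g y \<otimes>\<^bsub>tensor_End N r\<^esub> g x"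
    and const: "\<And>c. g (fconst c) = scalar_op N r c"
    and gen: "\<And>t. t \<in> S \<Longrightarrow> g (fgen t) \<in> matrix_op N r ` G"
    and x: "x \<in> carrier (free_algebra S)"
  shows "g x \<in> matrix_op N r ` malg (tensor_index N r) G"
proof -
  let ?M = "matrix_op N r ` malg (tensor_index N r) G"
  have M_mult: "g (x * y) \<in> ?M"
    if xy: "x \<in> carrier (free_algebra S)" "y \<in> carrier (free_algebra S)" "g x \<in> ?M" "g y \<in> ?M" for x y
  proof -
    obtain X Y where "g x = matrix_op N r X" "g y = matrix_op N r Y"
      "X \<in> malg (tensor_index N r) G" "Y \<in> malg (tensor_index N r) G"
      using xy(3,4) by (elim imageE)
    then show ?thesis using mult[OF xy(1,2)] by (auto simp: matrix_op_mult intro: malg.mult)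
  qed
  have M_const: "g (fconst c) \<in> ?M" for c
    unfolding const scalar_op_matrix by (intro imageI malg.scale malg.one)
  \<comment> \<open>Words with coefficient 1 are governed by the generators alone; a coefficient is
    restored later as a factor \<open>fconst b\<close>.\<close>
  have word: "g (Poly_Mapping.single (Word l) 1) \<in> ?M" if "set l \<subseteq> S" for l
    using that
  proof (induction l)
    case Nil
    then show ?case using M_const[of 1] by (simp add: fconst_def zero_word_def)
  next
    case (Cons t l)
    have "Poly_Mapping.single (Word (t # l)) 1 = fgen t * Poly_Mapping.single (Word l) 1"
      by (simp add: fgen_def mult_single plus_word_def)
    moreover have "g (fgen t) \<in> ?M" using gen[of t] Cons.prems by (auto intro: malg.gen)
    ultimately show ?case
      using Cons by (auto intro!: M_mult free_algebra_gen_closed simp del: free_algebra_simps(1)) auto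
  qed
  show ?thesis
    using x
  proof (induction x rule: update_induct)
    case const
    then show ?case using M_const[of 0] by (simp add: fconst_def)
  next
    case (update f a b)
    \<comment> \<open>The word \<open>a\<close> lies outside the support of \<open>f\<close>, so the
      update amounts to adding a monomial.\<close>
    have eq: "Poly_Mapping.update a b f = fconst b * Poly_Mapping.single (Word (letters a)) 1 + f"
      using update(1) by (intro poly_mapping_eqI)
        (auto simp: fconst_def mult_single lookup_update lookup_add lookup_single in_keys_iff when_def)
    have keys: "Poly_Mapping.keys (Poly_Mapping.update a b f) = insert a (Poly_Mapping.keys f)"
      using update(2) by (auto simp: keys_update)
    have a: "set (letters a) \<subseteq> S" and f: "f \<in> carrier (free_algebra S)"
      using update.prems by (auto simp: keys)
    have sa: "Poly_Mapping.single (Word (letters a)) (1 :: ratfun) \<in> carrier (free_algebra S)" using a by auto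
    have "g (fconst b * Poly_Mapping.single (Word (letters a)) 1) \<in> ?M" (is "g ?s \<in> _")
      by (intro M_mult free_algebra_const_closed sa M_const word a)
    moreover have "?s \<in> carrier (free_algebra S)"
      by (intro free_algebra_mult_closed free_algebra_const_closed sa)
    moreover have "g f \<in> ?M" using update.IH f by simp
    ultimately show ?case
      unfolding eq by (auto simp: add[OF _ f] matrix_op_add intro: malg.add simp del: free_algebra_simps(1))
  qed
qed

section \<open>The images of the two representations\<close>

lemma T_op_matrix: "T_op m n r i = matrix_op (m + n) r (T_mat m (m + n) r i)"
  unfolding T_op_def T_mat_def matrix_op_restr ..

lemma hecke_relators_closed: "hecke_relators r \<subseteq> carrier (hecke_free r)"
  unfolding hecke_relators_def hecke_free_def
  by (auto simp del: free_algebra_simps(1) intro!: free_algebra_mult_closed free_algebra_diff_closed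
      free_algebra_add_closed free_algebra_one_closed free_algebra_const_closed free_algebra_gen_closed)

lemma hecke_image:
  assumes "is_sign_q_perm_rep m n r \<pi>"
  shows "\<pi> ` carrier (hecke r) = matrix_op (m + n) r ` malg (tensor_index (m + n) r) (hecke_gens m (m + n) r)"
proof -
  let ?E = "tensor_End (m + n) r"
  have \<pi>: "\<pi> \<in> ring_hom (hecke r) (opposite_ring ?E)"
    and const: "\<And>c. \<pi> (hecke_class r (fconst c)) = scalar_op (m + n) r c"
    and T: "\<And>i. i \<in> {1..<r} \<Longrightarrow> \<pi> (hecke_class r (fgen i)) = matrix_op (m + n) r (T_mat m (m + n) r i)"
    using assms by (simp_all add: is_sign_q_perm_rep_def T_op_matrix)
  interpret F: ring "hecke_free r" unfolding hecke_free_def by (rule ring_free_algebra)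
  have id: "ideal (hecke_ideal r) (hecke_free r)"
    unfolding hecke_ideal_def by (rule F.genideal_ideal[OF hecke_relators_closed])
  interpret I: ideal "hecke_ideal r" "hecke_free r" by (rule id)
  interpret p: ring_hom_ring "hecke_free r" "hecke r" "hecke_class r"
    using I.rcos_ring_hom_ring unfolding hecke_def hecke_class_def .
  have H: "carrier (hecke r) = hecke_class r ` carrier (hecke_free r)"
    by (auto simp: hecke_def hecke_class_def FactRing_def A_RCOSETS_def')
  \<comment> \<open>As a map into \<open>tensor_End\<close> the right representation reverses
    products; its image is nevertheless a subalgebra, which is why \<open>free_algebra_image\<close>
    admits both orders.\<close>
  have hom: "\<pi> (x \<oplus>\<^bsub>hecke r\<^esub> y) = \<pi> x \<oplus>\<^bsub>?E\<^esub> \<pi> y" "\<pi> (x \<otimes>\<^bsub>hecke r\<^esub> y) = \<pi> y \<otimes>\<^bsub>?E\<^esub> \<pi> x"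
    if "x \<in> carrier (hecke r)" "y \<in> carrier (hecke r)" for x y
    using ring_hom_add[OF \<pi> that] ring_hom_mult[OF \<pi> that] by (simp_all add: opposite_ring_def)
  show ?thesis
  proof
    show "\<pi> ` carrier (hecke r) \<subseteq> matrix_op (m + n) r ` malg (tensor_index (m + n) r) (hecke_gens m (m + n) r)"
    proof
      fix \<phi> assume "\<phi> \<in> \<pi> ` carrier (hecke r)"
      then obtain x where x: "x \<in> carrier (hecke_free r)" "\<phi> = \<pi> (hecke_class r x)" by (auto simp: H)
      show "\<phi> \<in> matrix_op (m + n) r ` malg (tensor_index (m + n) r) (hecke_gens m (m + n) r)"
        unfolding x(2)
      proof (rule free_algebra_image[where g = "\<lambda>x. \<pi> (hecke_class r x)" and S = "{1..<r}"])
        fix x y assume "x \<in> carrier (free_algebra {1..<r})" "y \<in> carrier (free_algebra {1..<r})"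
        then have xy: "x \<in> carrier (hecke_free r)" "y \<in> carrier (hecke_free r)" by (simp_all only: hecke_free_def)
        show "\<pi> (hecke_class r (x + y)) = \<pi> (hecke_class r x) \<oplus>\<^bsub>?E\<^esub> \<pi> (hecke_class r y)"
          using p.hom_add[OF xy] hom(1)[OF p.hom_closed p.hom_closed, OF xy] by (simp add: hecke_free_def)
        show "\<pi> (hecke_class r (x * y)) = \<pi> (hecke_class r x) \<otimes>\<^bsub>?E\<^esub> \<pi> (hecke_class r y) \<or>
          \<pi> (hecke_class r (x * y)) = \<pi> (hecke_class r y) \<otimes>\<^bsub>?E\<^esub> \<pi> (hecke_class r x)"
          using p.hom_mult[OF xy] hom(2)[OF p.hom_closed p.hom_closed, OF xy] by (simp add: hecke_free_def)
      qed (use const T x in \<open>auto simp: hecke_gens_def hecke_free_def simp del: free_algebra_simps(1)\<close>)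
    qed
    show "matrix_op (m + n) r ` malg (tensor_index (m + n) r) (hecke_gens m (m + n) r) \<subseteq> \<pi> ` carrier (hecke r)"
    proof (rule matrix_op_malg_subset)
      fix X assume "X \<in> hecke_gens m (m + n) r"
      then obtain i where i: "i \<in> {1..<r}" "X = T_mat m (m + n) r i" by (auto simp: hecke_gens_def)
      have "fgen i \<in> carrier (hecke_free r)" unfolding hecke_free_def by (rule free_algebra_gen_closed[OF i(1)])
      then show "matrix_op (m + n) r X \<in> \<pi> ` carrier (hecke r)"
        unfolding i(2) T[OF i(1), symmetric] by (intro imageI p.hom_closed)
    next
      fix c
      show "scalar_op (m + n) r c \<in> \<pi> ` carrier (hecke r)"
        unfolding const[symmetric] by (intro imageI p.hom_closed) (simp only: hecke_free_def free_algebra_const_closed)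
    next
      fix x y assume "x \<in> \<pi> ` carrier (hecke r)" "y \<in> \<pi> ` carrier (hecke r)"
      then show "x \<oplus>\<^bsub>?E\<^esub> y \<in> \<pi> ` carrier (hecke r)" "x \<otimes>\<^bsub>?E\<^esub> y \<in> \<pi> ` carrier (hecke r)"
        by (auto simp: hom[symmetric] simp del: p.hom_add p.hom_mult)
    qed (rule on_square_hecke_gens)
  qed
qed

fun uq_gen_mat :: "nat \<Rightarrow> nat \<Rightarrow> nat \<Rightarrow> uq_gen \<Rightarrow> nat list \<Rightarrow> nat list \<Rightarrow> ratfun" where
  "uq_gen_mat m n r (GenQ h) = sq_mat m n r 0 h"
| "uq_gen_mat m n r (GenE i) = e_mat m n r i"
| "uq_gen_mat m n r (GenF i) = f_mat m n r i"

lemma uq_mat_gens_eq: "uq_mat_gens m n r = insert (sq_mat m n r 1 (\<lambda>b. 0)) (uq_gen_mat m n r ` uq_gens m n)"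
  by (simp add: uq_mat_gens_def uq_gens_def image_Un image_image)

lemma uq_image:
  assumes "is_tensor_rep m n r \<rho>"
  shows "\<rho> ` carrier (Uq_sigma m n) = matrix_op (m + n) r ` malg (tensor_index (m + n) r) (uq_mat_gens m n r)"
proof -
  let ?E = "tensor_End (m + n) r" and ?U = "Uq m n" and ?S = "Uq_sigma m n"
  let ?M = "matrix_op (m + n) r ` malg (tensor_index (m + n) r) (uq_mat_gens m n r)"
  have \<rho>: "\<rho> \<in> ring_hom ?S ?E"
    and const: "\<And>c. \<rho> (uqs_elem m n (fconst c)) = scalar_op (m + n) r c"
    and \<sigma>: "\<rho> (uqs_sigma m n) = matrix_op (m + n) r (sq_mat m n r 1 (\<lambda>b. 0))"
    using assms by (simp_all add: is_tensor_rep_def sq_mat_def rho_sigma_def matrix_op_restr)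
  have gen: "\<rho> (uqs_elem m n (fgen t)) = matrix_op (m + n) r (uq_gen_mat m n r t)" if "t \<in> uq_gens m n" for t
    using assms that by (auto simp: is_tensor_rep_def uq_gens_def sq_mat_def e_mat_def f_mat_def
        rho_q_def rho_e_def rho_f_def matrix_op_restr)
  interpret F: ring "uq_free m n" unfolding uq_free_def by (rule ring_free_algebra)
  have id: "ideal (uq_ideal m n) (uq_free m n)"
    using uq_admissible_uq_ideal by (simp add: uq_admissible_def)
  interpret I: ideal "uq_ideal m n" "uq_free m n" by (rule id)
  interpret p: ring_hom_ring "uq_free m n" ?U "uq_class m n"
    using I.rcos_ring_hom_ring unfolding Uq_def uq_class_def .
  interpret U: ring ?U by (rule p.S.ring_axioms)
  have carrier_U: "carrier ?U = uq_class m n ` carrier (uq_free m n)"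
    by (auto simp: Uq_def uq_class_def FactRing_def A_RCOSETS_def')
  have sigma_closed: "uq_sigma m X \<in> carrier ?U" if "X \<in> carrier ?U" for X
    using that ring_hom_closed[OF sigma_free_hom[of m "uq_gens m n"]]
    by (auto simp: carrier_U uq_sigma_class uq_free_def simp del: free_algebra_simps(1))
  have zero_one: "uq_class m n 0 = \<zero>\<^bsub>?U\<^esub>" "uq_class m n 1 = \<one>\<^bsub>?U\<^esub>"
    using p.hom_zero p.hom_one by (simp_all add: uq_free_def)
  \<comment> \<open>With these values the twisted multiplication of pairs having a component 0 or 1
    reduces to multiplication in \<open>Uq\<close>.\<close>
  have sigma_zero_one: "uq_sigma m \<zero>\<^bsub>?U\<^esub> = \<zero>\<^bsub>?U\<^esub>" "uq_sigma m \<one>\<^bsub>?U\<^esub> = \<one>\<^bsub>?U\<^esub>"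
    using sigma_free_const[of m 1] by (simp_all add: zero_one[symmetric] uq_sigma_class fconst_def)
  have S_carrier: "carrier ?S = carrier ?U \<times> carrier ?U"
    and S_add: "(a, b) \<oplus>\<^bsub>?S\<^esub> (a', b') = (a \<oplus>\<^bsub>?U\<^esub> a', b \<oplus>\<^bsub>?U\<^esub> b')"
    and S_mult: "(a, b) \<otimes>\<^bsub>?S\<^esub> (a', b') =
       (a \<otimes>\<^bsub>?U\<^esub> a' \<oplus>\<^bsub>?U\<^esub> b \<otimes>\<^bsub>?U\<^esub> uq_sigma m b', a \<otimes>\<^bsub>?U\<^esub> b' \<oplus>\<^bsub>?U\<^esub> b \<otimes>\<^bsub>?U\<^esub> uq_sigma m a')" for a b a' b'
    by (simp_all add: Uq_sigma_def Let_def)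
  have S_closed: "x \<oplus>\<^bsub>?S\<^esub> y \<in> carrier ?S" "x \<otimes>\<^bsub>?S\<^esub> y \<in> carrier ?S" if "x \<in> carrier ?S" "y \<in> carrier ?S" for x y
    using that by (auto simp: S_carrier S_add S_mult sigma_closed)
  have hom: "\<rho> (x \<oplus>\<^bsub>?S\<^esub> y) = \<rho> x \<oplus>\<^bsub>?E\<^esub> \<rho> y" "\<rho> (x \<otimes>\<^bsub>?S\<^esub> y) = \<rho> x \<otimes>\<^bsub>?E\<^esub> \<rho> y"
    if "x \<in> carrier ?S" "y \<in> carrier ?S" for x y
    using ring_hom_add[OF \<rho> that] ring_hom_mult[OF \<rho> that] by simp_all
  have elem_closed: "uqs_elem m n x \<in> carrier ?S" if "x \<in> carrier (uq_free m n)" for x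
    using that by (simp add: S_carrier uqs_elem_def)
  have \<sigma>_closed: "uqs_sigma m n \<in> carrier ?S" by (simp add: S_carrier uqs_sigma_def)
  have elem_hom: "uqs_elem m n (x + y) = uqs_elem m n x \<oplus>\<^bsub>?S\<^esub> uqs_elem m n y"
    "uqs_elem m n (x * y) = uqs_elem m n x \<otimes>\<^bsub>?S\<^esub> uqs_elem m n y"
    if xy: "x \<in> carrier (uq_free m n)" "y \<in> carrier (uq_free m n)" for x y
    using p.hom_add[OF xy] p.hom_mult[OF xy] p.hom_closed[OF xy(1)] p.hom_closed[OF xy(2)] sigma_closed
    by (simp_all add: uqs_elem_def S_add S_mult sigma_zero_one uq_free_def)
  have M_mult: "x \<otimes>\<^bsub>?E\<^esub> y \<in> ?M" and M_add: "x \<oplus>\<^bsub>?E\<^esub> y \<in> ?M" if "x \<in> ?M" "y \<in> ?M" for x y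
    using that by (auto simp: matrix_op_mult matrix_op_add intro: malg.mult malg.add)
  have elem_M: "\<rho> (uqs_elem m n x) \<in> ?M" if x: "x \<in> carrier (uq_free m n)" for x
  proof (rule free_algebra_image[where g = "\<lambda>x. \<rho> (uqs_elem m n x)" and S = "uq_gens m n"])
    fix x y assume "x \<in> carrier (free_algebra (uq_gens m n))" "y \<in> carrier (free_algebra (uq_gens m n))"
    then have xy: "x \<in> carrier (uq_free m n)" "y \<in> carrier (uq_free m n)" by (simp_all only: uq_free_def)
    show "\<rho> (uqs_elem m n (x + y)) = \<rho> (uqs_elem m n x) \<oplus>\<^bsub>?E\<^esub> \<rho> (uqs_elem m n y)"
      "\<rho> (uqs_elem m n (x * y)) = \<rho> (uqs_elem m n x) \<otimes>\<^bsub>?E\<^esub> \<rho> (uqs_elem m n y) \<or>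
        \<rho> (uqs_elem m n (x * y)) = \<rho> (uqs_elem m n y) \<otimes>\<^bsub>?E\<^esub> \<rho> (uqs_elem m n x)"
      using elem_hom[OF xy] hom[OF elem_closed elem_closed, OF xy] by simp_all
  qed (use const gen x in \<open>auto simp: uq_mat_gens_eq uq_free_def simp del: free_algebra_simps(1)\<close>)
  show ?thesis
  proof
    show "\<rho> ` carrier ?S \<subseteq> ?M"
    proof
      fix \<phi> assume "\<phi> \<in> \<rho> ` carrier ?S"
      then obtain x y where xy: "x \<in> carrier (uq_free m n)" "y \<in> carrier (uq_free m n)"
        and \<phi>: "\<phi> = \<rho> (uq_class m n x, uq_class m n y)" by (auto simp: S_carrier carrier_U)
      have c: "uq_class m n x \<in> carrier ?U" "uq_class m n y \<in> carrier ?U" using xy by simp_all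
      \<comment> \<open>The pair stands for x + y sigma, so the image is generated by that of
        \<open>Uq\<close> together with the operator of sigma.\<close>
      have "(uq_class m n x, uq_class m n y)
        = uqs_elem m n x \<oplus>\<^bsub>?S\<^esub> uqs_elem m n y \<otimes>\<^bsub>?S\<^esub> uqs_sigma m n"
        using c by (simp add: uqs_elem_def uqs_sigma_def S_add S_mult sigma_zero_one)
      then have "\<phi> = \<rho> (uqs_elem m n x) \<oplus>\<^bsub>?E\<^esub> \<rho> (uqs_elem m n y) \<otimes>\<^bsub>?E\<^esub> \<rho> (uqs_sigma m n)"
        using \<phi> hom elem_closed xy \<sigma>_closed S_closed by simp
      moreover have "\<rho> (uqs_sigma m n) \<in> ?M"
        unfolding \<sigma> by (intro imageI malg.gen) (simp add: uq_mat_gens_def)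
      ultimately show "\<phi> \<in> ?M" using elem_M xy M_mult M_add by simp
    qed
    show "?M \<subseteq> \<rho> ` carrier ?S"
    proof (rule matrix_op_malg_subset)
      fix X assume "X \<in> uq_mat_gens m n r"
      then consider "X = sq_mat m n r 1 (\<lambda>b. 0)" | t where "t \<in> uq_gens m n" "X = uq_gen_mat m n r t"
        by (auto simp: uq_mat_gens_eq)
      then show "matrix_op (m + n) r X \<in> \<rho> ` carrier ?S"
      proof cases
        case 1
        then show ?thesis using \<sigma> \<sigma>_closed by (metis imageI)
      next
        case (2 t)
        then have "fgen t \<in> carrier (uq_free m n)" unfolding uq_free_def by (intro free_algebra_gen_closed)
        then show ?thesis unfolding 2(2) gen[OF 2(1), symmetric] by (intro imageI elem_closed)
      qed
    next
      fix c
      show "scalar_op (m + n) r c \<in> \<rho> ` carrier ?S"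
        unfolding const[symmetric] by (intro imageI elem_closed) (simp only: uq_free_def free_algebra_const_closed)
    next
      fix x y assume "x \<in> \<rho> ` carrier ?S" "y \<in> \<rho> ` carrier ?S"
      then obtain a b where ab: "a \<in> carrier ?S" "b \<in> carrier ?S" "x = \<rho> a" "y = \<rho> b" by (elim imageE)
      show "x \<oplus>\<^bsub>?E\<^esub> y \<in> \<rho> ` carrier ?S" "x \<otimes>\<^bsub>?E\<^esub> y \<in> \<rho> ` carrier ?S"
        unfolding ab(3,4) hom[OF ab(1,2), symmetric] by (intro imageI S_closed ab)+
    qed (rule on_square_uq_gens)
  qed
qed

theorem theorem4p4:
  fixes m n r :: nat
    and \<pi> :: "nat fpoly set \<Rightarrow> operator"
    and \<rho> :: "uq_gen fpoly set \<times> uq_gen fpoly set \<Rightarrow> operator"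
  assumes "m + n \<ge> 1" and "r \<ge> 1"
    and "is_sign_q_perm_rep m n r \<pi>"
    and "is_tensor_rep m n r \<rho>"
  shows "commutant (tensor_End (m + n) r) (\<rho> ` carrier (Uq_sigma m n)) = \<pi> ` carrier (hecke r)
    \<and> commutant (tensor_End (m + n) r) (\<pi> ` carrier (hecke r)) = \<rho> ` carrier (Uq_sigma m n)"
  unfolding hecke_image[OF assms(3)] uq_image[OF assms(4)]
  using commutant_matrix_op[OF malg_on_square[OF _ on_square_uq_gens[of _ m n r]]]
    commutant_matrix_op[OF malg_on_square[OF _ on_square_hecke_gens[of _ m "m + n" r]]]
  by (simp add: matrix_duality)

end
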